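(* Let $n\ge2$, let $r+s=n$ be a partition with $r\ne s$, and let $I\subset\{0,\dots,\lfloor n/2\rfloor\}$ be a nonempty admissible subset. Let $R$ be an $\mathcal{O}_F$-algebra and $(\mathcal{F}_i)_i$ an $R$-point of $M_I^{\mathrm{naive}}$. If $(\mathcal{F}_i)_i$ satisfies conditions $(\mathrm{K}_{r+1})$ and $(\mathrm{K}_{s+1})$, then it satisfies the wedge condition: for all $i$, $$\bigwedge\nolimits_R^{s+1}(\pi\otimes1+1\otimes\pi\mid\mathcal{F}_i)=0\quad\text{and}\quad\bigwedge\nolimits_R^{r+1}(\pi\otimes1-1\otimes\pi\mid\mathcal{F}_i)=0.$$
   Context: Setting. $F/F_0$ is a ramified quadratic extension of discretely valued non-Archimedean fields, with rings of integers $\mathcal{O}_F,\mathcal{O}_{F_0}$, uniformizers $\pi,\pi_0$ with $\pi^2=\pi_0$, and common residue field of characteristic $\ne2$. $n\ge2$, $m=\lfloor n/2\rfloor$, $r+s=n$, $r\neq s$, and the reflex field is $E=F$. A nonempty $I\subset\{0,\dots,m\}$ is called admissible if: $n$ even and $m-1\in I$ imply $m\in I$. $e_1,\dots,e_n$ is the standard basis of $F^n$; $i^\vee=n+1-i$; $\phi$ is the $F/F_0$-Hermitian form with $\phi(ae_i,be_j)=\bar ab\,\delta_{i,j^\vee}$; $\langle x,y\rangle=\tfrac12\operatorname{tr}_{F/F_0}(\pi^{-1}\phi(x,y))$. For $i=bn+c$, $0\le c<n$, $\Lambda_i=\sum_{j=1}^c\pi^{-b-1}\mathcal{O}_Fe_j+\sum_{j=c+1}^n\pi^{-b}\mathcal{O}_Fe_j$;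 $\langle\ ,\ \rangle$ induces perfect pairings $\Lambda_i\times\Lambda_{-i}\to\mathcal{O}_{F_0}$. An $R$-point of $M_I^{\mathrm{naive}}$ is a family $(\mathcal{F}_i\subset\Lambda_i\otimes_{\mathcal{O}_{F_0}}R)_{i\in\pm I+n\mathbb{Z}}$ such that: (LM1) each $\mathcal{F}_i$ is an $\mathcal{O}_F\otimes_{\mathcal{O}_{F_0}}R$-submodule and an $R$-direct summand of rank $n$; (LM2) for $i<j$, $\Lambda_i\otimes R\to\Lambda_j\otimes R$ carries $\mathcal{F}_i$ into $\mathcal{F}_j$; (LM3) the isomorphism $\pi\otimes1:\Lambda_i\otimes R\to\Lambda_{i-n}\otimes R$ carries $\mathcal{F}_i$ onto $\mathcal{F}_{i-n}$; (LM4) $\mathcal{F}_i^\perp=\mathcal{F}_{-i}$ under $(\Lambda_i\otimes R)\times(\Lambda_{-i}\otimes R)\to R$; (Kottwitz condition) $\det(T\cdot\mathrm{id}-\pi\otimes1\mid\mathcal{F}_i)=(T-\pi)^s(T+\pi)^r$ in $R[T]$. Let $V=F^n\otimes_{F_0}F$ ($F$-space of dimension $2n$ via the right factor) and $V_{\pm\pi}\subset V$ the $\pm\pi$-eigenspace of $\pi\otimes1$. For $l\geq1$ let ${}^lW^{r,s}=\bigoplus_{j+k=l,\ j\le r,\ k\le s}\bigl(\bigwedge^j_FV_{-\pi}\otimes_F\bigwedge^k_FV_\pi\bigr)\subset\bigwedge^l_FV$, and for an $\mathcal{O}_{F_0}$-lattice $\Lambda\subset F^n$ let ${}^lW(\Lambda)^{r,s}={}^lW^{r,s}\cap\bigwedge^l_{\mathcal{O}_F}(\Lambda\otimes_{\mathcal{O}_{F_0}}\mathcal{O}_F)$.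 Condition $(\mathrm{K}_l)$: for all $i$, the subbundle $\bigwedge^l_R\mathcal{F}_i\subset\bigwedge^l_R(\Lambda_i\otimes_{\mathcal{O}_{F_0}}R)$ is contained in $\operatorname{im}\bigl[{}^lW(\Lambda_i)^{r,s}\otimes_{\mathcal{O}_F}R\to\bigwedge^l_R(\Lambda_i\otimes_{\mathcal{O}_{F_0}}R)\bigr]$. (For $l=n+1$ this is automatic, as both sides are $0$.) *)

theory Defs
  imports "HOL-Algebra.Algebra" "HOL-Algebra.Algebraic_Closure_Type"
begin

section \<open>Modules given by generators and relations\<close>

text \<open>The ring fields \<open>mult\<close> and \<open>one\<close> of a record of type \<open>module\<close> play no role in the
  locale \<^locale>\<open>module\<close>; they are left \<open>undefined\<close> below.\<close>

definition free_module :: "('a, 'z) ring_scheme \<Rightarrow> 'g set \<Rightarrow> ('a, 'g \<Rightarrow> 'a) module" where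
  "free_module R G =
     \<lparr> carrier = {c. (\<forall>g\<in>G. c g \<in> carrier R) \<and> (\<forall>g. g \<notin> G \<longrightarrow> c g = \<zero>\<^bsub>R\<^esub>)
                      \<and> finite {g. c g \<noteq> \<zero>\<^bsub>R\<^esub>}},
       monoid.mult = undefined, monoid.one = undefined,
       ring.zero = (\<lambda>_. \<zero>\<^bsub>R\<^esub>), ring.add = (\<lambda>c d g. c g \<oplus>\<^bsub>R\<^esub> d g),
       module.smult = (\<lambda>a c g. a \<otimes>\<^bsub>R\<^esub> c g) \<rparr>"

definition free_gen :: "('a, 'z) ring_scheme \<Rightarrow> 'g \<Rightarrow> 'g \<Rightarrow> 'a" where
  "free_gen R g = (\<lambda>x. if x = g then \<one>\<^bsub>R\<^esub> else \<zero>\<^bsub>R\<^esub>)"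

definition module_span ::
  "('a, 'z) ring_scheme \<Rightarrow> ('a, 'm, 'y) module_scheme \<Rightarrow> 'm set \<Rightarrow> 'm set" where
  "module_span R M S = \<Inter>{N. submodule N R M \<and> S \<subseteq> N}"

definition quotient_module ::
  "('a, 'm, 'y) module_scheme \<Rightarrow> 'm set \<Rightarrow> ('a, 'm set) module" where
  "quotient_module M N =
     \<lparr> carrier = a_rcosets\<^bsub>M\<^esub> N, monoid.mult = undefined, monoid.one = undefined,
       ring.zero = N, ring.add = (\<lambda>A B. A <+>\<^bsub>M\<^esub> B),
       module.smult = (\<lambda>a A. \<Union>x\<in>A. N +>\<^bsub>M\<^esub> (a \<odot>\<^bsub>M\<^esub> x)) \<rparr>"

definition presented_module ::
  "('a, 'z) ring_scheme \<Rightarrow> 'g set \<Rightarrow> ('g \<Rightarrow> 'a) set \<Rightarrow> ('a, ('g \<Rightarrow> 'a) set) module" where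
  "presented_module R G Rel =
     quotient_module (free_module R G) (module_span R (free_module R G) Rel)"

definition presented_gen ::
  "('a, 'z) ring_scheme \<Rightarrow> 'g set \<Rightarrow> ('g \<Rightarrow> 'a) set \<Rightarrow> 'g \<Rightarrow> ('g \<Rightarrow> 'a) set" where
  "presented_gen R G Rel g =
     module_span R (free_module R G) Rel +>\<^bsub>free_module R G\<^esub> free_gen R g"

text \<open>The map from a presented \<open>R\<close>-module to a module \<open>N\<close> over another ring that is
  semilinear along \<open>\<psi>\<close> and sends each generator \<open>g\<close> to \<open>h g\<close>.  As for homomorphisms out of
  factor groups in the library, the value on a coset is read off from its representatives; it is
  meaningful when \<open>h\<close> respects the relations.\<close>

definition presented_map ::
  "('a, 'z) ring_scheme \<Rightarrow> ('a \<Rightarrow> 'b) \<Rightarrow> ('b, 'm, 'y) module_scheme \<Rightarrow> ('g \<Rightarrow> 'm)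
     \<Rightarrow> ('g \<Rightarrow> 'a) set \<Rightarrow> 'm" where
  "presented_map R \<psi> N h A =
     the_elem ((\<lambda>c. \<Oplus>\<^bsub>N\<^esub>g\<in>{g. c g \<noteq> \<zero>\<^bsub>R\<^esub>}. \<psi> (c g) \<odot>\<^bsub>N\<^esub> h g) ` A)"

section \<open>Extension of scalars\<close>

text \<open>For \<open>\<phi> : A \<rightarrow> B\<close> and an \<open>A\<close>-module \<open>M\<close>, the \<open>B\<close>-module \<open>M \<otimes>\<^sub>A B\<close> has generators
  \<open>m \<otimes> 1\<close> subject to additivity in \<open>m\<close> and \<open>am \<otimes> 1 = \<phi>(a) (m \<otimes> 1)\<close>; the tensor
  \<open>m \<otimes> b\<close> is \<open>b (m \<otimes> 1)\<close>.\<close>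

definition base_change_rels ::
  "('a, 'z) ring_scheme \<Rightarrow> ('a \<Rightarrow> 'b) \<Rightarrow> ('b, 'w) ring_scheme \<Rightarrow> ('a, 'm, 'y) module_scheme
     \<Rightarrow> ('m \<Rightarrow> 'b) set" where
  "base_change_rels A \<phi> B M = (let L = free_module B (carrier M) in
     {free_gen B (x \<oplus>\<^bsub>M\<^esub> y) \<ominus>\<^bsub>L\<^esub> (free_gen B x \<oplus>\<^bsub>L\<^esub> free_gen B y) | x y.
        x \<in> carrier M \<and> y \<in> carrier M} \<union>
     {free_gen B (a \<odot>\<^bsub>M\<^esub> x) \<ominus>\<^bsub>L\<^esub> \<phi> a \<odot>\<^bsub>L\<^esub> free_gen B x | a x.
        a \<in> carrier A \<and> x \<in> carrier M})"

definition base_change ::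
  "('a, 'z) ring_scheme \<Rightarrow> ('a \<Rightarrow> 'b) \<Rightarrow> ('b, 'w) ring_scheme \<Rightarrow> ('a, 'm, 'y) module_scheme
     \<Rightarrow> ('b, ('m \<Rightarrow> 'b) set) module" where
  "base_change A \<phi> B M = presented_module B (carrier M) (base_change_rels A \<phi> B M)"

definition tensor_one ::
  "('a, 'z) ring_scheme \<Rightarrow> ('a \<Rightarrow> 'b) \<Rightarrow> ('b, 'w) ring_scheme \<Rightarrow> ('a, 'm, 'y) module_scheme
     \<Rightarrow> 'm \<Rightarrow> ('m \<Rightarrow> 'b) set" where
  "tensor_one A \<phi> B M m = presented_gen B (carrier M) (base_change_rels A \<phi> B M) m"

text \<open>\<open>base_change_map B \<psi> C A \<phi> N u\<close> is the map \<open>m \<otimes> b \<mapsto> u(m) \<otimes> \<psi>(b)\<close> from an extension of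
  scalars to \<open>B\<close> into \<open>N \<otimes>\<^sub>A C\<close>, where \<open>\<phi> : A \<rightarrow> C\<close> and \<open>\<psi> : B \<rightarrow> C\<close>.  The base ring of the
  source need not be \<open>A\<close> and does not enter.\<close>

definition base_change_map ::
  "('b, 'w) ring_scheme \<Rightarrow> ('b \<Rightarrow> 'c) \<Rightarrow> ('c, 'v) ring_scheme \<Rightarrow>
   ('a, 'z) ring_scheme \<Rightarrow> ('a \<Rightarrow> 'c) \<Rightarrow> ('a, 'n, 'y) module_scheme \<Rightarrow> ('m \<Rightarrow> 'n)
     \<Rightarrow> ('m \<Rightarrow> 'b) set \<Rightarrow> ('n \<Rightarrow> 'c) set" where
  "base_change_map B \<psi> C A \<phi> N u =
     presented_map B \<psi> (base_change A \<phi> C N) (\<lambda>m. tensor_one A \<phi> C N (u m))"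

section \<open>Exterior powers\<close>

definition exterior_rels ::
  "('a, 'z) ring_scheme \<Rightarrow> nat \<Rightarrow> ('a, 'm, 'y) module_scheme \<Rightarrow> ('m list \<Rightarrow> 'a) set" where
  "exterior_rels R l M =
    (let G = {xs. length xs = l \<and> set xs \<subseteq> carrier M}; L = free_module R G in
     {free_gen R (xs[i := x \<oplus>\<^bsub>M\<^esub> y])
        \<ominus>\<^bsub>L\<^esub> (free_gen R (xs[i := x]) \<oplus>\<^bsub>L\<^esub> free_gen R (xs[i := y])) | xs i x y.
        xs \<in> G \<and> i < l \<and> x \<in> carrier M \<and> y \<in> carrier M} \<union>
     {free_gen R (xs[i := a \<odot>\<^bsub>M\<^esub> x]) \<ominus>\<^bsub>L\<^esub> a \<odot>\<^bsub>L\<^esub> free_gen R (xs[i := x]) | xs i a x.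
        xs \<in> G \<and> i < l \<and> a \<in> carrier R \<and> x \<in> carrier M} \<union>
     {free_gen R xs | xs i j. xs \<in> G \<and> i < j \<and> j < l \<and> xs ! i = xs ! j})"

definition exterior_power ::
  "('a, 'z) ring_scheme \<Rightarrow> nat \<Rightarrow> ('a, 'm, 'y) module_scheme
     \<Rightarrow> ('a, ('m list \<Rightarrow> 'a) set) module" where
  "exterior_power R l M =
     presented_module R {xs. length xs = l \<and> set xs \<subseteq> carrier M} (exterior_rels R l M)"

definition wedge ::
  "('a, 'z) ring_scheme \<Rightarrow> nat \<Rightarrow> ('a, 'm, 'y) module_scheme \<Rightarrow> 'm list
     \<Rightarrow> ('m list \<Rightarrow> 'a) set" where
  "wedge R l M xs =
     presented_gen R {xs. length xs = l \<and> set xs \<subseteq> carrier M} (exterior_rels R l M) xs"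

text \<open>\<open>exterior_map R \<psi> S l N f\<close> is the map from the \<open>l\<close>-th exterior power of an \<open>R\<close>-module to
  that of the \<open>S\<close>-module \<open>N\<close> induced by a map \<open>f\<close> that is semilinear along \<open>\<psi> : R \<rightarrow> S\<close>:
  \<open>x\<^sub>1 \<and> \<dots> \<and> x\<^sub>l \<mapsto> f(x\<^sub>1) \<and> \<dots> \<and> f(x\<^sub>l)\<close>.\<close>

definition exterior_map ::
  "('a, 'z) ring_scheme \<Rightarrow> ('a \<Rightarrow> 'b) \<Rightarrow> ('b, 'w) ring_scheme \<Rightarrow> nat \<Rightarrow>
   ('b, 'n, 'y) module_scheme \<Rightarrow> ('m \<Rightarrow> 'n) \<Rightarrow> ('m list \<Rightarrow> 'a) set \<Rightarrow> ('n list \<Rightarrow> 'b) set" where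
  "exterior_map R \<psi> S l N f =
     presented_map R \<psi> (exterior_power S l N) (\<lambda>xs. wedge S l N (map f xs))"

definition exterior_power_vanishes ::
  "('a, 'z) ring_scheme \<Rightarrow> nat \<Rightarrow> ('a, 'm, 'y) module_scheme \<Rightarrow> ('m \<Rightarrow> 'm) \<Rightarrow> bool" where
  "exterior_power_vanishes R l M f \<longleftrightarrow>
     (\<forall>x\<in>carrier (exterior_power R l M).
        exterior_map R id R l M f x = \<zero>\<^bsub>exterior_power R l M\<^esub>)"

section \<open>Direct summands, rank and characteristic polynomial\<close>

definition direct_summand ::
  "('a, 'z) ring_scheme \<Rightarrow> ('a, 'm, 'y) module_scheme \<Rightarrow> 'm set \<Rightarrow> bool" where
  "direct_summand R M N \<longleftrightarrow> submodule N R M \<and>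
     (\<exists>N'. submodule N' R M \<and> N \<inter> N' = {\<zero>\<^bsub>M\<^esub>} \<and> N <+>\<^bsub>M\<^esub> N' = carrier M)"

text \<open>\<open>local_basis R M t n b\<close>: the images of \<open>b\<^sub>0, \<dots>, b\<^sub>n\<^sub>-\<^sub>1\<close> form a basis of the localization
  \<open>M[1/t]\<close> over \<open>R[1/t]\<close>.  Denominators have been cleared, so that the two clauses (generation and
  linear independence) speak about \<open>M\<close> itself.  Every basis of \<open>M[1/t]\<close> has this form after
  multiplication by a power of \<open>t\<close>.\<close>

definition local_basis ::
  "('a, 'z) ring_scheme \<Rightarrow> ('a, 'm, 'y) module_scheme \<Rightarrow> 'a \<Rightarrow> nat \<Rightarrow> (nat \<Rightarrow> 'm) \<Rightarrow> bool" where
  "local_basis R M t n b \<longleftrightarrow>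
     b \<in> {..<n} \<rightarrow> carrier M \<and>
     (\<forall>x\<in>carrier M. \<exists>k::nat. \<exists>c\<in>{..<n} \<rightarrow> carrier R.
        (t [^]\<^bsub>R\<^esub> k) \<odot>\<^bsub>M\<^esub> x = (\<Oplus>\<^bsub>M\<^esub>j\<in>{..<n}. c j \<odot>\<^bsub>M\<^esub> b j)) \<and>
     (\<forall>c\<in>{..<n} \<rightarrow> carrier R. (\<Oplus>\<^bsub>M\<^esub>j\<in>{..<n}. c j \<odot>\<^bsub>M\<^esub> b j) = \<zero>\<^bsub>M\<^esub> \<longrightarrow>
        (\<exists>k::nat. \<forall>j<n. t [^]\<^bsub>R\<^esub> k \<otimes>\<^bsub>R\<^esub> c j = \<zero>\<^bsub>R\<^esub>))"

definition locally_free_of_rank ::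
  "('a, 'z) ring_scheme \<Rightarrow> ('a, 'm, 'y) module_scheme \<Rightarrow> nat \<Rightarrow> bool" where
  "locally_free_of_rank R M n \<longleftrightarrow>
     (\<exists>S. S \<subseteq> carrier R \<and> finite S \<and> Idl\<^bsub>R\<^esub> S = carrier R
          \<and> (\<forall>t\<in>S. \<exists>b. local_basis R M t n b))"

text \<open>The determinant of an endomorphism \<open>f\<close> of a locally free module \<open>M\<close> of rank \<open>n\<close> is the
  scalar by which \<open>f\<close> acts on the invertible module given by the \<open>n\<close>-th exterior power of \<open>M\<close>.\<close>

definition has_det ::
  "('a, 'z) ring_scheme \<Rightarrow> nat \<Rightarrow> ('a, 'm, 'y) module_scheme \<Rightarrow> ('m \<Rightarrow> 'm) \<Rightarrow> 'a \<Rightarrow> bool" where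
  "has_det R n M f d \<longleftrightarrow>
     (\<forall>x\<in>carrier (exterior_power R n M).
        exterior_map R id R n M f x = d \<odot>\<^bsub>exterior_power R n M\<^esub> x)"

definition has_char_poly ::
  "('a, 'z) ring_scheme \<Rightarrow> nat \<Rightarrow> ('a, 'm, 'y) module_scheme \<Rightarrow> ('m \<Rightarrow> 'm) \<Rightarrow> (nat \<Rightarrow> 'a)
     \<Rightarrow> bool" where
  "has_char_poly R n M f p \<longleftrightarrow>
    (let P = UP R; C = (\<lambda>a. up_ring.monom P a 0); MT = base_change R C P M in
     has_det P n MT
       (\<lambda>x. up_ring.monom P \<one>\<^bsub>R\<^esub> 1 \<odot>\<^bsub>MT\<^esub> x \<ominus>\<^bsub>MT\<^esub> base_change_map P id P R C M f x) p)"

definition ring_as_module :: "('a, 'z) ring_scheme \<Rightarrow> ('a, 'a) module" where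
  "ring_as_module R =
     \<lparr> carrier = carrier R, monoid.mult = monoid.mult R, monoid.one = \<one>\<^bsub>R\<^esub>,
       ring.zero = \<zero>\<^bsub>R\<^esub>, ring.add = ring.add R, module.smult = monoid.mult R \<rparr>"

section \<open>The ramified quadratic extension and its lattices\<close>

text \<open>The map \<open>v\<close> is the normalized valuation of \<open>F\<close>, whose value at \<open>0\<close> is irrelevant.  That it
  takes even values on the nonzero elements of \<open>F\<^sub>0\<close> says that \<open>\<pi>\<^sup>2\<close>, an element of valuation
  \<open>2\<close>, is a uniformizer of \<open>F\<^sub>0\<close>, i.e. that the extension is ramified.\<close>

locale ramified_quadratic =
  fixes v :: "'f::field \<Rightarrow> int" and F0 :: "'f set" and \<pi> :: 'f
  assumes v_mult: "\<And>x y. x \<noteq> 0 \<Longrightarrow> y \<noteq> 0 \<Longrightarrow> v (x * y) = v x + v y"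
    and v_add: "\<And>x y. x \<noteq> 0 \<Longrightarrow> y \<noteq> 0 \<Longrightarrow> x + y \<noteq> 0 \<Longrightarrow> min (v x) (v y) \<le> v (x + y)"
    and subfield_F0: "subfield F0 (ring_of_type_algebra :: 'f ring)"
    and degree_2: "ring.dimension (ring_of_type_algebra :: 'f ring) 2 F0 UNIV"
    and uniformizer: "\<pi> \<noteq> 0" "v \<pi> = 1"
    and uniformizer_F0: "\<pi>\<^sup>2 \<in> F0" "\<And>x. x \<in> F0 \<Longrightarrow> x \<noteq> 0 \<Longrightarrow> even (v x)"
    and common_residue_field:
      "\<And>x. x = 0 \<or> 0 \<le> v x \<Longrightarrow> \<exists>a\<in>F0. (a = 0 \<or> 0 \<le> v a) \<and> (x - a = 0 \<or> 0 < v (x - a))"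
    and residue_char_not_2: "(2::'f) \<noteq> 0" "v 2 = 0"
begin

abbreviation F_ring :: "'f ring" where
  "F_ring \<equiv> ring_of_type_algebra"

abbreviation F0_ring :: "'f ring" where
  "F0_ring \<equiv> F_ring\<lparr>carrier := F0\<rparr>"

definition OF :: "'f set" where
  "OF = {x. x = 0 \<or> 0 \<le> v x}"

definition OF_ring :: "'f ring" where
  "OF_ring = F_ring\<lparr>carrier := OF\<rparr>"

definition OF0_ring :: "'f ring" where
  "OF0_ring = F_ring\<lparr>carrier := OF \<inter> F0\<rparr>"

definition galois_conj :: "'f \<Rightarrow> 'f" where
  "galois_conj = (THE \<sigma>. \<sigma> \<in> ring_iso F_ring F_ring \<and> (\<forall>a\<in>F0. \<sigma> a = a) \<and> \<sigma> \<noteq> id)"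

definition tr :: "'f \<Rightarrow> 'f" where
  "tr x = x + galois_conj x"

text \<open>A vector of \<open>F\<^sup>n\<close> is its family of coordinates, indexed by \<open>1, \<dots>, n\<close> and extended by \<open>0\<close>.
  The record below is used for \<open>F\<^sup>n\<close> as a module over \<open>F\<^sub>0\<close> and for lattices in it as modules over
  the ring of integers of \<open>F\<^sub>0\<close>.\<close>

definition vec_module :: "(nat \<Rightarrow> 'f) set \<Rightarrow> ('f, nat \<Rightarrow> 'f) module" where
  "vec_module A =
     \<lparr> carrier = A, monoid.mult = undefined, monoid.one = undefined,
       ring.zero = (\<lambda>_. 0), ring.add = (\<lambda>x y j. x j + y j), module.smult = (\<lambda>a x j. a * x j) \<rparr>"

definition Fn :: "nat \<Rightarrow> (nat \<Rightarrow> 'f) set" where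
  "Fn n = {x. \<forall>j. j \<notin> {1..n} \<longrightarrow> x j = 0}"

definition herm :: "nat \<Rightarrow> (nat \<Rightarrow> 'f) \<Rightarrow> (nat \<Rightarrow> 'f) \<Rightarrow> 'f" where
  "herm n x y = (\<Sum>j=1..n. galois_conj (x j) * y (n + 1 - j))"

definition alt_form :: "nat \<Rightarrow> (nat \<Rightarrow> 'f) \<Rightarrow> (nat \<Rightarrow> 'f) \<Rightarrow> 'f" where
  "alt_form n x y = tr (inverse \<pi> * herm n x y) / 2"

definition frac_ideal :: "int \<Rightarrow> 'f set" where
  "frac_ideal k = (\<lambda>a. \<pi> powi k * a) ` OF"

definition lattice :: "nat \<Rightarrow> int \<Rightarrow> (nat \<Rightarrow> 'f) set" where
  "lattice n i = {x \<in> Fn n. \<forall>j\<in>{1..n}.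
     x j \<in> (if int j \<le> i mod int n then frac_ideal (- (i div int n) - 1)
            else frac_ideal (- (i div int n)))}"

definition lattice_tensor ::
  "nat \<Rightarrow> 'r ring \<Rightarrow> ('f \<Rightarrow> 'r) \<Rightarrow> int \<Rightarrow> ('r, ((nat \<Rightarrow> 'f) \<Rightarrow> 'r) set) module" where
  "lattice_tensor n R \<alpha> i = base_change OF0_ring \<alpha> R (vec_module (lattice n i))"

text \<open>\<open>lattice_map n R \<alpha> j a\<close> is \<open>a \<otimes> 1 : \<Lambda>\<^sub>i \<otimes> R \<rightarrow> \<Lambda>\<^sub>j \<otimes> R\<close>, for any \<open>i\<close> with \<open>a \<Lambda>\<^sub>i \<subseteq> \<Lambda>\<^sub>j\<close>.\<close>

definition lattice_map ::
  "nat \<Rightarrow> 'r ring \<Rightarrow> ('f \<Rightarrow> 'r) \<Rightarrow> int \<Rightarrow> 'f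
     \<Rightarrow> ((nat \<Rightarrow> 'f) \<Rightarrow> 'r) set \<Rightarrow> ((nat \<Rightarrow> 'f) \<Rightarrow> 'r) set" where
  "lattice_map n R \<alpha> j a =
     base_change_map R id R OF0_ring \<alpha> (vec_module (lattice n j)) (\<lambda>x k. a * x k)"

text \<open>The \<open>R\<close>-bilinear extension of the form to \<open>(\<Lambda>\<^sub>i \<otimes> R) \<times> (\<Lambda>\<^sub>-\<^sub>i \<otimes> R) \<rightarrow> R\<close>.\<close>

definition lattice_pairing ::
  "nat \<Rightarrow> 'r ring \<Rightarrow> ('f \<Rightarrow> 'r)
     \<Rightarrow> ((nat \<Rightarrow> 'f) \<Rightarrow> 'r) set \<Rightarrow> ((nat \<Rightarrow> 'f) \<Rightarrow> 'r) set \<Rightarrow> 'r" where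
  "lattice_pairing n R \<alpha> A B =
     presented_map R id (ring_as_module R)
       (\<lambda>x. presented_map R id (ring_as_module R) (\<lambda>y. \<alpha> (alt_form n x y)) B) A"

section \<open>The naive local model\<close>

definition index_set :: "nat \<Rightarrow> nat set \<Rightarrow> int set" where
  "index_set n I = {i. \<exists>k\<in>I. \<exists>t. i = int k + int n * t \<or> i = - int k + int n * t}"

text \<open>A family \<open>\<F>\<close> is indexed by all integers, but only its members at \<open>i \<in> \<plusminus>I + n\<int>\<close> matter.
  A submodule over \<open>\<O>\<^sub>F \<otimes> R\<close> is an \<open>R\<close>-submodule stable under \<open>a \<otimes> 1\<close> for all \<open>a \<in> \<O>\<^sub>F\<close>.\<close>

definition LM1 ::
  "nat \<Rightarrow> nat set \<Rightarrow> 'r ring \<Rightarrow> ('f \<Rightarrow> 'r) \<Rightarrow> (int \<Rightarrow> ((nat \<Rightarrow> 'f) \<Rightarrow> 'r) set set) \<Rightarrow> bool" where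
  "LM1 n I R \<alpha> \<F> \<longleftrightarrow> (\<forall>i\<in>index_set n I.
     direct_summand R (lattice_tensor n R \<alpha> i) (\<F> i) \<and>
     (\<forall>a\<in>OF. lattice_map n R \<alpha> i a ` \<F> i \<subseteq> \<F> i) \<and>
     locally_free_of_rank R (lattice_tensor n R \<alpha> i\<lparr>carrier := \<F> i\<rparr>) n)"

definition LM2 ::
  "nat \<Rightarrow> nat set \<Rightarrow> 'r ring \<Rightarrow> ('f \<Rightarrow> 'r) \<Rightarrow> (int \<Rightarrow> ((nat \<Rightarrow> 'f) \<Rightarrow> 'r) set set) \<Rightarrow> bool" where
  "LM2 n I R \<alpha> \<F> \<longleftrightarrow> (\<forall>i\<in>index_set n I. \<forall>j\<in>index_set n I. i < j \<longrightarrow>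
     lattice_map n R \<alpha> j 1 ` \<F> i \<subseteq> \<F> j)"

definition LM3 ::
  "nat \<Rightarrow> nat set \<Rightarrow> 'r ring \<Rightarrow> ('f \<Rightarrow> 'r) \<Rightarrow> (int \<Rightarrow> ((nat \<Rightarrow> 'f) \<Rightarrow> 'r) set set) \<Rightarrow> bool" where
  "LM3 n I R \<alpha> \<F> \<longleftrightarrow> (\<forall>i\<in>index_set n I.
     lattice_map n R \<alpha> (i - int n) \<pi> ` \<F> i = \<F> (i - int n))"

definition LM4 ::
  "nat \<Rightarrow> nat set \<Rightarrow> 'r ring \<Rightarrow> ('f \<Rightarrow> 'r) \<Rightarrow> (int \<Rightarrow> ((nat \<Rightarrow> 'f) \<Rightarrow> 'r) set set) \<Rightarrow> bool" where
  "LM4 n I R \<alpha> \<F> \<longleftrightarrow> (\<forall>i\<in>index_set n I.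
     {y \<in> carrier (lattice_tensor n R \<alpha> (- i)).
        \<forall>x\<in>\<F> i. lattice_pairing n R \<alpha> x y = \<zero>\<^bsub>R\<^esub>} = \<F> (- i))"

definition kottwitz ::
  "nat \<Rightarrow> nat \<Rightarrow> nat \<Rightarrow> nat set \<Rightarrow> 'r ring \<Rightarrow> ('f \<Rightarrow> 'r)
     \<Rightarrow> (int \<Rightarrow> ((nat \<Rightarrow> 'f) \<Rightarrow> 'r) set set) \<Rightarrow> bool" where
  "kottwitz n r s I R \<alpha> \<F> \<longleftrightarrow> (\<forall>i\<in>index_set n I.
     let P = UP R; T = up_ring.monom P \<one>\<^bsub>R\<^esub> 1; c = up_ring.monom P (\<alpha> \<pi>) 0 in
     has_char_poly R n (lattice_tensor n R \<alpha> i\<lparr>carrier := \<F> i\<rparr>) (lattice_map n R \<alpha> i \<pi>)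
       ((T \<ominus>\<^bsub>P\<^esub> c) [^]\<^bsub>P\<^esub> s \<otimes>\<^bsub>P\<^esub> (T \<oplus>\<^bsub>P\<^esub> c) [^]\<^bsub>P\<^esub> r))"

definition naive_point ::
  "nat \<Rightarrow> nat \<Rightarrow> nat \<Rightarrow> nat set \<Rightarrow> 'r ring \<Rightarrow> ('f \<Rightarrow> 'r)
     \<Rightarrow> (int \<Rightarrow> ((nat \<Rightarrow> 'f) \<Rightarrow> 'r) set set) \<Rightarrow> bool" where
  "naive_point n r s I R \<alpha> \<F> \<longleftrightarrow>
     LM1 n I R \<alpha> \<F> \<and> LM2 n I R \<alpha> \<F> \<and> LM3 n I R \<alpha> \<F> \<and> LM4 n I R \<alpha> \<F> \<and> kottwitz n r s I R \<alpha> \<F>"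

section \<open>The conditions on exterior powers\<close>

text \<open>The \<open>F\<close>-vector space \<open>V\<close> is the extension of scalars of \<open>F\<^sup>n\<close> from \<open>F\<^sub>0\<close> to \<open>F\<close>;
  \<open>eigenspace n c\<close> is the \<open>c\<close>-eigenspace of \<open>\<pi> \<otimes> 1\<close> on it.\<close>

definition V :: "nat \<Rightarrow> ('f, ((nat \<Rightarrow> 'f) \<Rightarrow> 'f) set) module" where
  "V n = base_change F0_ring id F_ring (vec_module (Fn n))"

definition eigenspace :: "nat \<Rightarrow> 'f \<Rightarrow> ((nat \<Rightarrow> 'f) \<Rightarrow> 'f) set set" where
  "eigenspace n c = {x \<in> carrier (V n).
     base_change_map F_ring id F_ring F0_ring id (vec_module (Fn n)) (\<lambda>x k. \<pi> * x k) x
       = c \<odot>\<^bsub>V n\<^esub> x}"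

text \<open>The summand of \<open>W l n r s\<close> for \<open>(j, k)\<close>, viewed inside the \<open>l\<close>-th exterior power of \<open>V\<close>, is
  spanned by the products of \<open>j\<close> vectors in the \<open>-\<pi>\<close>-eigenspace with \<open>k\<close> vectors in the
  \<open>\<pi>\<close>-eigenspace.\<close>

definition W :: "nat \<Rightarrow> nat \<Rightarrow> nat \<Rightarrow> nat \<Rightarrow> (((nat \<Rightarrow> 'f) \<Rightarrow> 'f) set list \<Rightarrow> 'f) set set" where
  "W l n r s = module_span F_ring (exterior_power F_ring l (V n))
     {wedge F_ring l (V n) (xs @ ys) | xs ys.
        length xs + length ys = l \<and> length xs \<le> r \<and> length ys \<le> s \<and>
        set xs \<subseteq> eigenspace n (- \<pi>) \<and> set ys \<subseteq> eigenspace n \<pi>}"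

text \<open>The intersection of \<open>W l n r s\<close> with the \<open>l\<close>-th exterior power of \<open>\<Lambda>\<^sub>i \<otimes> \<O>\<^sub>F\<close>, formed as the
  preimage of \<open>W l n r s\<close> under the canonical embedding of that exterior power into the one of
  \<open>V\<close>.\<close>

definition lattice_W ::
  "nat \<Rightarrow> nat \<Rightarrow> nat \<Rightarrow> nat \<Rightarrow> int \<Rightarrow> (((nat \<Rightarrow> 'f) \<Rightarrow> 'f) set list \<Rightarrow> 'f) set set" where
  "lattice_W l n r s i =
     {w \<in> carrier (exterior_power OF_ring l (lattice_tensor n OF_ring id i)).
        exterior_map OF_ring id F_ring l (V n)
          (base_change_map OF_ring id F_ring F0_ring id (vec_module (Fn n)) id) w \<in> W l n r s}"

text \<open>In the next definition the left-hand side is the image of the \<open>l\<close>-th exterior power of \<open>\<F>\<^sub>i\<close>,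
  and the right-hand side is the \<open>R\<close>-module generated by the image of \<open>lattice_W l n r s i\<close>, that
  is, the image of its extension of scalars to \<open>R\<close>.\<close>

definition K_condition ::
  "nat \<Rightarrow> nat \<Rightarrow> nat \<Rightarrow> nat \<Rightarrow> nat set \<Rightarrow> 'r ring \<Rightarrow> ('f \<Rightarrow> 'r)
     \<Rightarrow> (int \<Rightarrow> ((nat \<Rightarrow> 'f) \<Rightarrow> 'r) set set) \<Rightarrow> bool" where
  "K_condition l n r s I R \<alpha> \<F> \<longleftrightarrow> (\<forall>i\<in>index_set n I.
     exterior_map R id R l (lattice_tensor n R \<alpha> i) id
         ` carrier (exterior_power R l (lattice_tensor n R \<alpha> i\<lparr>carrier := \<F> i\<rparr>))
     \<subseteq> module_span R (exterior_power R l (lattice_tensor n R \<alpha> i))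
         (exterior_map OF_ring \<alpha> R l (lattice_tensor n R \<alpha> i)
            (base_change_map OF_ring \<alpha> R OF0_ring \<alpha> (vec_module (lattice n i)) id)
            ` lattice_W l n r s i))"

text \<open>Exterior powers of endomorphisms of \<open>\<F>\<^sub>i\<close> itself, not of its ambient module.\<close>

definition wedge_condition ::
  "nat \<Rightarrow> nat \<Rightarrow> nat \<Rightarrow> nat set \<Rightarrow> 'r ring \<Rightarrow> ('f \<Rightarrow> 'r)
     \<Rightarrow> (int \<Rightarrow> ((nat \<Rightarrow> 'f) \<Rightarrow> 'r) set set) \<Rightarrow> bool" where
  "wedge_condition n r s I R \<alpha> \<F> \<longleftrightarrow> (\<forall>i\<in>index_set n I.
     let L = lattice_tensor n R \<alpha> i; p = lattice_map n R \<alpha> i \<pi> in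
     exterior_power_vanishes R (s + 1) (L\<lparr>carrier := \<F> i\<rparr>) (\<lambda>x. p x \<oplus>\<^bsub>L\<^esub> \<alpha> \<pi> \<odot>\<^bsub>L\<^esub> x) \<and>
     exterior_power_vanishes R (r + 1) (L\<lparr>carrier := \<F> i\<rparr>) (\<lambda>x. p x \<ominus>\<^bsub>L\<^esub> \<alpha> \<pi> \<odot>\<^bsub>L\<^esub> x))"

end

definition admissible :: "nat \<Rightarrow> nat set \<Rightarrow> bool" where
  "admissible n I \<longleftrightarrow> (even n \<and> n div 2 - 1 \<in> I \<longrightarrow> n div 2 \<in> I)"

end

theory Submission
  imports Defs "HOL-Combinatorics.Permutations"
begin

text \<open>Each product of \<open>s + 1\<close> eigenvectors in \<open>W\<close> contains a factor from the \<open>-\<pi>\<close>-eigenspace, so the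
  exterior power of \<open>\<pi> \<otimes> 1 + 1 \<otimes> \<pi>\<close> kills \<open>W\<close>.  The exterior powers of the free \<open>\<O>\<^sub>F\<close>-module
  \<open>\<Lambda>\<^sub>i \<otimes> \<O>\<^sub>F\<close> embed into those of \<open>V\<close>, so this operator also kills the lattice in \<open>W\<close> and hence,
  after base change to \<open>R\<close>, the submodule that by the condition on \<open>\<F>\<^sub>i\<close> contains the image of the
  exterior power of \<open>\<F>\<^sub>i\<close>.  As \<open>\<F>\<^sub>i\<close> is a direct summand, its exterior power embeds into that of
  \<open>\<Lambda>\<^sub>i \<otimes> R\<close>.  The second half is the same with \<open>\<pi>\<close> replaced by \<open>-\<pi>\<close> and \<open>s\<close> by \<open>r\<close>.\<close>

section \<open>Semilinear maps\<close>

text \<open>The exterior powers involved live over three rings: those of \<Lambda>_i \<otimes> O_F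
  over O_F, of V over F and of \<Lambda>_i \<otimes> R over R. The maps between them are linear only
  along O_F \<rightarrow> F and O_F \<rightarrow> R, hence semilinearity along \<psi> as the basic
  notion. No canonical map leads from V to \<Lambda>_i \<otimes> R, so vanishing on W can reach R
  only through O_F, and this is what makes injectivity over O_F indispensable. It comes from
  explicit coordinates: valuations on F0 are even, so O_F is free over O_F0 on 1 and \<pi>, and
  \<Lambda>_i gets a basis of 2n vectors. Its coordinate functions are F0-linear on all of F^n,
  hence extend to V, and their l-by-l minors recover the coefficients of an element from its image
  in the exterior power of V. Over R an inclusion may lose injectivity under exterior powers; for
  \<F>_i a projection onto it provides a left inverse. Since all modules are given by generators and
  relations, identities are checked on the elements m \<otimes> 1 and on pure wedges.\<close>

definition semilinear ::
  "('a, 'z) ring_scheme \<Rightarrow> ('a \<Rightarrow> 'b) \<Rightarrow> ('a, 'm, 'y) module_scheme \<Rightarrow> ('b, 'n, 'x) module_scheme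
     \<Rightarrow> ('m \<Rightarrow> 'n) \<Rightarrow> bool" where
  "semilinear R \<psi> M N f \<longleftrightarrow> f \<in> carrier M \<rightarrow> carrier N \<and>
     (\<forall>x\<in>carrier M. \<forall>y\<in>carrier M. f (x \<oplus>\<^bsub>M\<^esub> y) = f x \<oplus>\<^bsub>N\<^esub> f y) \<and>
     (\<forall>a\<in>carrier R. \<forall>x\<in>carrier M. f (a \<odot>\<^bsub>M\<^esub> x) = \<psi> a \<odot>\<^bsub>N\<^esub> f x)"

lemma semilinearI:
  assumes "\<And>x. x \<in> carrier M \<Longrightarrow> f x \<in> carrier N"
    and "\<And>x y. x \<in> carrier M \<Longrightarrow> y \<in> carrier M \<Longrightarrow> f (x \<oplus>\<^bsub>M\<^esub> y) = f x \<oplus>\<^bsub>N\<^esub> f y"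
    and "\<And>a x. a \<in> carrier R \<Longrightarrow> x \<in> carrier M \<Longrightarrow> f (a \<odot>\<^bsub>M\<^esub> x) = \<psi> a \<odot>\<^bsub>N\<^esub> f x"
  shows "semilinear R \<psi> M N f"
  using assms by (auto simp: semilinear_def)

lemma semilinear_closed: "semilinear R \<psi> M N f \<Longrightarrow> x \<in> carrier M \<Longrightarrow> f x \<in> carrier N"
  by (auto simp: semilinear_def)

lemma semilinear_add:
  "semilinear R \<psi> M N f \<Longrightarrow> x \<in> carrier M \<Longrightarrow> y \<in> carrier M \<Longrightarrow>
     f (x \<oplus>\<^bsub>M\<^esub> y) = f x \<oplus>\<^bsub>N\<^esub> f y"
  by (auto simp: semilinear_def)

lemma semilinear_smult:
  "semilinear R \<psi> M N f \<Longrightarrow> a \<in> carrier R \<Longrightarrow> x \<in> carrier M \<Longrightarrow>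
     f (a \<odot>\<^bsub>M\<^esub> x) = \<psi> a \<odot>\<^bsub>N\<^esub> f x"
  by (auto simp: semilinear_def)

lemma module_cring: "module R M \<Longrightarrow> cring R"
  by (simp add: module_def)

lemma module_abelian_group: "module R M \<Longrightarrow> abelian_group M"
  by (simp add: module_def)

lemma semilinear_hom:
  assumes "module R M" "module S N" "semilinear R \<psi> M N f"
  shows "abelian_group_hom M N f"
proof -
  interpret M: module R M by fact
  interpret N: module S N by fact
  show ?thesis
    using assms(3)
    by (auto intro!: abelian_group_homI group_hom.intro group_hom_axioms.intro M.a_group N.a_group
          M.abelian_group_axioms N.abelian_group_axioms homI simp: semilinear_def)
qed

lemma semilinear_zero:
  assumes "module R M" "module S N" "semilinear R \<psi> M N f"
  shows "f \<zero>\<^bsub>M\<^esub> = \<zero>\<^bsub>N\<^esub>"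
  using abelian_group_hom.hom_zero[OF semilinear_hom[OF assms]] .

lemma semilinear_a_inv:
  assumes "module R M" "module S N" "semilinear R \<psi> M N f" "x \<in> carrier M"
  shows "f (\<ominus>\<^bsub>M\<^esub> x) = \<ominus>\<^bsub>N\<^esub> f x"
  using abelian_group_hom.hom_a_inv[OF semilinear_hom[OF assms(1-3)]] assms(4) .

lemma semilinear_minus:
  assumes "module R M" "module S N" "semilinear R \<psi> M N f" "x \<in> carrier M" "y \<in> carrier M"
  shows "f (x \<ominus>\<^bsub>M\<^esub> y) = f x \<ominus>\<^bsub>N\<^esub> f y"
proof -
  interpret M: module R M by fact
  interpret N: module S N by fact
  show ?thesis
    using assms by (simp add: a_minus_def semilinear_add[OF assms(3)] semilinear_a_inv[OF assms(1-3)])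
qed

text \<open>The composite ring map is any \<theta> that agrees with \<chi> after \<psi> on the
  carrier of R. Two sides of a commuting square can thus be stated along literally the same map, as
  \<open>base_change_eqI\<close> and \<open>exterior_power_eqI\<close> demand.\<close>

lemma semilinear_comp:
  assumes "semilinear R \<psi> M N f" "semilinear S \<chi> N P g" "\<psi> \<in> carrier R \<rightarrow> carrier S"
    and "\<And>a. a \<in> carrier R \<Longrightarrow> \<theta> a = \<chi> (\<psi> a)"
  shows "semilinear R \<theta> M P (\<lambda>x. g (f x))"
  using assms by (auto simp: semilinear_def Pi_iff)

lemma id_ring_hom: "id \<in> ring_hom R R"
  by (simp add: ring_hom_def)

lemma semilinear_id: "semilinear R id M M id"
  by (simp add: semilinear_def)

text \<open>Multiplication by c is linear because R is commutative. The operators \<pi> \<otimes> 1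
  + 1 \<otimes> c are of this form, with \<pi> \<otimes> 1 as f.\<close>

lemma semilinear_plus_smult:
  assumes "module R M" "semilinear R id M M f" "c \<in> carrier R"
  shows "semilinear R id M M (\<lambda>x. f x \<oplus>\<^bsub>M\<^esub> c \<odot>\<^bsub>M\<^esub> x)"
proof -
  interpret M: module R M by fact
  note f = semilinear_closed[OF assms(2)]
  show ?thesis
  proof (rule semilinearI)
    fix a x assume "a \<in> carrier R" "x \<in> carrier M"
    moreover have "c \<odot>\<^bsub>M\<^esub> (a \<odot>\<^bsub>M\<^esub> x) = a \<odot>\<^bsub>M\<^esub> (c \<odot>\<^bsub>M\<^esub> x)"
      using assms(3) calculation by (metis M.smult_assoc1 M.m_comm)
    ultimately show "f (a \<odot>\<^bsub>M\<^esub> x) \<oplus>\<^bsub>M\<^esub> c \<odot>\<^bsub>M\<^esub> (a \<odot>\<^bsub>M\<^esub> x) = id a \<odot>\<^bsub>M\<^esub> (f x \<oplus>\<^bsub>M\<^esub> c \<odot>\<^bsub>M\<^esub> x)"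
      using assms by (simp add: semilinear_smult[OF assms(2)] M.smult_r_distr f)
  qed (use assms f in \<open>simp_all add: semilinear_add[OF assms(2)] M.smult_r_distr
         M.add.m_ac\<close>)
qed

lemma submodule_subset: "submodule N R M \<Longrightarrow> N \<subseteq> carrier M"
  using subgroup.subset[OF submodule.axioms(1)] by fastforce

lemma submodule_zero: "submodule N R M \<Longrightarrow> \<zero>\<^bsub>M\<^esub> \<in> N"
  using subgroup.one_closed[OF submodule.axioms(1)] by fastforce

lemma submodule_add: "submodule N R M \<Longrightarrow> x \<in> N \<Longrightarrow> y \<in> N \<Longrightarrow> x \<oplus>\<^bsub>M\<^esub> y \<in> N"
  using subgroup.m_closed[OF submodule.axioms(1)] by fastforce

lemma submodule_smult: "submodule N R M \<Longrightarrow> a \<in> carrier R \<Longrightarrow> x \<in> N \<Longrightarrow> a \<odot>\<^bsub>M\<^esub> x \<in> N"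
  by (rule submodule.smult_closed)

lemma submodule_a_inv: "module R M \<Longrightarrow> submodule N R M \<Longrightarrow> x \<in> N \<Longrightarrow> \<ominus>\<^bsub>M\<^esub> x \<in> N"
  by (rule module.submoduleE(3))

lemma semilinear_vimage_submodule:
  assumes "module R M" "module S N" "semilinear R \<psi> M N f" "\<psi> \<in> carrier R \<rightarrow> carrier S"
    and "submodule K S N"
  shows "submodule {x \<in> carrier M. f x \<in> K} R M"
proof -
  interpret M: module R M by fact
  interpret N: module S N by fact
  show ?thesis
    using assms
    by (intro M.submoduleI)
      (auto simp: semilinear_add[OF assms(3)] semilinear_smult[OF assms(3)] semilinear_zero[OF assms(1-3)]
         semilinear_a_inv[OF assms(1-3)] submodule_zero submodule_add submodule_smult submodule_a_inv Pi_iff)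
qed

lemma zero_submodule:
  assumes "module R M"
  shows "submodule {\<zero>\<^bsub>M\<^esub>} R M"
proof -
  interpret M: module R M by fact
  show ?thesis by (intro M.submoduleI) auto
qed

lemma semilinear_kernel_submodule:
  assumes "module R M" "module S N" "semilinear R \<psi> M N f" "\<psi> \<in> carrier R \<rightarrow> carrier S"
  shows "submodule {x \<in> carrier M. f x = \<zero>\<^bsub>N\<^esub>} R M"
  using semilinear_vimage_submodule[OF assms zero_submodule[OF assms(2)]] by simp

text \<open>The uniqueness half of every universal property below: maps that agree on generators
  agree on everything that these generate.\<close>

lemma semilinear_equalizer_submodule:
  assumes "module R M" "module S N" "semilinear R \<psi> M N f" "semilinear R \<psi> M N g"
  shows "submodule {x \<in> carrier M. f x = g x} R M"
proof -
  interpret M: module R M by fact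
  interpret N: module S N by fact
  show ?thesis
    using assms semilinear_zero[OF assms(1-3)] semilinear_zero[OF assms(1,2,4)]
    by (intro M.submoduleI)
      (simp_all add: semilinear_add semilinear_smult semilinear_a_inv[OF assms(1,2)])
qed

lemma semilinear_range_submodule:
  assumes "module R M" "module R N" "semilinear R id M N f"
  shows "submodule (f ` carrier M) R N"
proof -
  interpret M: module R M by fact
  interpret N: module R N by fact
  show ?thesis
  proof (rule N.submoduleI)
    show "f ` carrier M \<subseteq> carrier N" using semilinear_closed[OF assms(3)] by blast
    show "\<zero>\<^bsub>N\<^esub> \<in> f ` carrier M"
      using semilinear_zero[OF assms] M.zero_closed by (metis image_eqI)
    fix a b assume "a \<in> f ` carrier M"
    then obtain x where x: "x \<in> carrier M" "a = f x" by blast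
    show "\<ominus>\<^bsub>N\<^esub> a \<in> f ` carrier M"
      using semilinear_a_inv[OF assms x(1)] x M.a_inv_closed by (metis image_eqI)
    assume "b \<in> f ` carrier M"
    then obtain y where y: "y \<in> carrier M" "b = f y" by blast
    show "a \<oplus>\<^bsub>N\<^esub> b \<in> f ` carrier M"
      using semilinear_add[OF assms(3) x(1) y(1)] x y M.a_closed by (metis image_eqI)
  next
    fix r a assume r: "r \<in> carrier R" and "a \<in> f ` carrier M"
    then obtain x where x: "x \<in> carrier M" "a = f x" by blast
    show "r \<odot>\<^bsub>N\<^esub> a \<in> f ` carrier M"
      using semilinear_smult[OF assms(3) r x(1)] x M.smult_closed[OF r] by (metis id_apply image_eqI)
  qed
qed

lemma module_span_submodule:
  assumes "module R M" "S \<subseteq> carrier M"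
  shows "submodule (module_span R M S) R M"
proof -
  interpret M: module R M by fact
  show ?thesis
  proof (rule M.submoduleI)
    \<comment> \<open>The assumption \<open>S \<subseteq> carrier M\<close> makes the carrier a
      member of the intersected family; an empty family would have intersection
      \<open>UNIV\<close>.\<close>
    show "module_span R M S \<subseteq> carrier M"
      unfolding module_span_def using M.carrier_is_submodule assms(2) by blast
  qed (auto simp: module_span_def
         intro: submodule_zero submodule_add submodule_smult submodule_a_inv[OF assms(1)])
qed

lemma module_span_superset: "S \<subseteq> module_span R M S"
  by (auto simp: module_span_def)

lemma module_span_minimal: "submodule N R M \<Longrightarrow> S \<subseteq> N \<Longrightarrow> module_span R M S \<subseteq> N"
  by (auto simp: module_span_def)

section \<open>Presented modules\<close>

lemma free_module_simps [simp]:
  "\<zero>\<^bsub>free_module R G\<^esub> = (\<lambda>_. \<zero>\<^bsub>R\<^esub>)"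
  "c \<oplus>\<^bsub>free_module R G\<^esub> d = (\<lambda>g. c g \<oplus>\<^bsub>R\<^esub> d g)"
  "a \<odot>\<^bsub>free_module R G\<^esub> c = (\<lambda>g. a \<otimes>\<^bsub>R\<^esub> c g)"
  by (simp_all add: free_module_def)

lemma free_module_carrier:
  "c \<in> carrier (free_module R G) \<longleftrightarrow> (\<forall>g\<in>G. c g \<in> carrier R) \<and> {g. c g \<noteq> \<zero>\<^bsub>R\<^esub>} \<subseteq> G
     \<and> finite {g. c g \<noteq> \<zero>\<^bsub>R\<^esub>}"
  by (auto simp: free_module_def)

lemma free_module_closed:
  "cring R \<Longrightarrow> c \<in> carrier (free_module R G) \<Longrightarrow> c g \<in> carrier R"
  using cring.cring_simprules(2)[of R] by (cases "g \<in> G") (auto simp: free_module_def)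

lemma free_module_module:
  assumes "cring R"
  shows "module R (free_module R G)"
proof -
  interpret R: cring R by fact
  let ?L = "free_module R G"
  note cl [simp] = free_module_closed[OF assms]
  have add: "c \<oplus>\<^bsub>?L\<^esub> d \<in> carrier ?L" if "c \<in> carrier ?L" "d \<in> carrier ?L" for c d
  proof -
    have "{g. c g \<oplus>\<^bsub>R\<^esub> d g \<noteq> \<zero>\<^bsub>R\<^esub>} \<subseteq> {g. c g \<noteq> \<zero>\<^bsub>R\<^esub>} \<union> {g. d g \<noteq> \<zero>\<^bsub>R\<^esub>}"
      by auto
    with that show ?thesis
      unfolding free_module_carrier by (auto intro: finite_subset)
  qed
  have smult: "a \<odot>\<^bsub>?L\<^esub> c \<in> carrier ?L" if "a \<in> carrier R" "c \<in> carrier ?L" for a c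
  proof -
    have "{g. a \<otimes>\<^bsub>R\<^esub> c g \<noteq> \<zero>\<^bsub>R\<^esub>} \<subseteq> {g. c g \<noteq> \<zero>\<^bsub>R\<^esub>}"
      using that by auto
    with that show ?thesis
      unfolding free_module_carrier by (auto intro: finite_subset)
  qed
  have "abelian_group ?L"
  proof (rule abelian_groupI)
    fix c assume c: "c \<in> carrier ?L"
    have "(\<ominus>\<^bsub>R\<^esub> \<one>\<^bsub>R\<^esub>) \<odot>\<^bsub>?L\<^esub> c \<oplus>\<^bsub>?L\<^esub> c = \<zero>\<^bsub>?L\<^esub>"
      using c by (auto simp: R.l_minus R.l_neg)
    then show "\<exists>d\<in>carrier ?L. d \<oplus>\<^bsub>?L\<^esub> c = \<zero>\<^bsub>?L\<^esub>"
      using smult[OF _ c] by (metis R.add.inv_closed R.one_closed)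
  qed (use add in \<open>auto simp: R.a_ac free_module_carrier[of "\<lambda>_. \<zero>\<^bsub>R\<^esub>"]\<close>)
  then show ?thesis
    using smult by (intro moduleI assms) (auto simp: R.l_distr R.r_distr R.m_assoc)
qed

lemma free_gen_closed: "cring R \<Longrightarrow> g \<in> G \<Longrightarrow> free_gen R g \<in> carrier (free_module R G)"
  using cring.cring_simprules(2,6)[of R] by (auto simp: free_module_carrier free_gen_def)

text \<open>Induction on the finite support: c is the sum of c with one nonzero coefficient erased
  and of that coefficient times its generator.\<close>

lemma free_module_induct:
  assumes "cring R" "submodule N R (free_module R G)" "\<And>g. g \<in> G \<Longrightarrow> free_gen R g \<in> N"
    and "c \<in> carrier (free_module R G)"
  shows "c \<in> N"
proof -
  interpret R: cring R by fact
  let ?L = "free_module R G"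
  have "finite {g. c g \<noteq> \<zero>\<^bsub>R\<^esub>}"
    using assms(4) by (simp add: free_module_carrier)
  then show ?thesis
    using assms(4)
  proof (induction "{g. c g \<noteq> \<zero>\<^bsub>R\<^esub>}" arbitrary: c rule: finite_psubset_induct)
    case psubset
    note c = \<open>c \<in> carrier ?L\<close>
    show ?case
    proof (cases "\<exists>g. c g \<noteq> \<zero>\<^bsub>R\<^esub>")
      case False
      then have "c = \<zero>\<^bsub>?L\<^esub>" by auto
      then show ?thesis using submodule_zero[OF assms(2)] by simp
    next
      case True
      then obtain g where g: "c g \<noteq> \<zero>\<^bsub>R\<^esub>" by blast
      then have "g \<in> G" using c by (auto simp: free_module_carrier)
      let ?d = "c(g := \<zero>\<^bsub>R\<^esub>)"
      have sub: "{h. ?d h \<noteq> \<zero>\<^bsub>R\<^esub>} \<subset> {h. c h \<noteq> \<zero>\<^bsub>R\<^esub>}" using g by auto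
      then have "finite {h. ?d h \<noteq> \<zero>\<^bsub>R\<^esub>}" "{h. ?d h \<noteq> \<zero>\<^bsub>R\<^esub>} \<subseteq> G"
        using c finite_subset[OF less_imp_le[OF sub]] sub by (simp_all add: free_module_carrier) blast
      then have "?d \<in> carrier ?L"
        using c unfolding free_module_carrier by simp
      then have "?d \<in> N" using psubset(2)[OF sub] by blast
      moreover have "c g \<odot>\<^bsub>?L\<^esub> free_gen R g \<in> N"
        using submodule_smult[OF assms(2)] assms(3)[OF \<open>g \<in> G\<close>] free_module_closed[OF assms(1) c] by blast
      moreover have "c = ?d \<oplus>\<^bsub>?L\<^esub> c g \<odot>\<^bsub>?L\<^esub> free_gen R g"
        using free_module_closed[OF assms(1) c] by (auto simp: free_gen_def fun_eq_iff)
      ultimately show ?thesis using submodule_add[OF assms(2)] by metis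
    qed
  qed
qed

text \<open>The value of \<open>presented_map\<close> on a single representative. Semilinearity is
  proved for it on the free module and then passed to cosets.\<close>

definition linear_extension ::
  "('a, 'z) ring_scheme \<Rightarrow> ('a \<Rightarrow> 'b) \<Rightarrow> ('b, 'm, 'y) module_scheme \<Rightarrow> ('g \<Rightarrow> 'm) \<Rightarrow> ('g \<Rightarrow> 'a) \<Rightarrow> 'm"
  where "linear_extension R \<psi> N h c = (\<Oplus>\<^bsub>N\<^esub>g\<in>{g. c g \<noteq> \<zero>\<^bsub>R\<^esub>}. \<psi> (c g) \<odot>\<^bsub>N\<^esub> h g)"

lemma ring_hom_zero_cring: "cring R \<Longrightarrow> cring S \<Longrightarrow> \<psi> \<in> ring_hom R S \<Longrightarrow> \<psi> \<zero>\<^bsub>R\<^esub> = \<zero>\<^bsub>S\<^esub>"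
  by (simp add: cring.axioms(1) ring_hom_zero)

text \<open>The supports of c, d and c + d differ, so sums over them become comparable only on a
  common finite index set. The added terms vanish because \<psi> maps 0 to 0.\<close>

lemma linear_extension_eq:
  assumes "cring R" "module S N" "\<psi> \<in> ring_hom R S" "h \<in> G \<rightarrow> carrier N"
    and "c \<in> carrier (free_module R G)" "finite B" "{g. c g \<noteq> \<zero>\<^bsub>R\<^esub>} \<subseteq> B" "B \<subseteq> G"
  shows "linear_extension R \<psi> N h c = (\<Oplus>\<^bsub>N\<^esub>g\<in>B. \<psi> (c g) \<odot>\<^bsub>N\<^esub> h g)"
proof -
  interpret N: module S N by fact
  have "\<psi> \<zero>\<^bsub>R\<^esub> = \<zero>\<^bsub>S\<^esub>"
    using ring_hom_zero_cring[OF assms(1) N.is_cring assms(3)] .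
  then show ?thesis
    unfolding linear_extension_def using assms
    by (intro N.add.finprod_mono_neutral_cong_left)
      (auto simp: Pi_iff subset_iff free_module_closed ring_hom_closed[OF assms(3)])
qed

lemma linear_extension_semilinear:
  assumes "cring R" "module S N" "\<psi> \<in> ring_hom R S" "h \<in> G \<rightarrow> carrier N"
  shows "semilinear R \<psi> (free_module R G) N (linear_extension R \<psi> N h)"
proof -
  interpret R: cring R by fact
  interpret N: module S N by fact
  let ?L = "free_module R G"
  let ?supp = "\<lambda>c. {g. c g \<noteq> \<zero>\<^bsub>R\<^esub>}"
  interpret L: module R ?L by (rule free_module_module[OF assms(1)])
  note cl = free_module_closed[OF assms(1)]
  note \<psi> = ring_hom_closed[OF assms(3)]
  note eq = linear_extension_eq[OF assms]
  have fin: "finite (?supp c)" "?supp c \<subseteq> G" if "c \<in> carrier ?L" for c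
    using that by (auto simp: free_module_carrier)
  show ?thesis
  proof (rule semilinearI)
    fix c assume c: "c \<in> carrier ?L"
    then show "linear_extension R \<psi> N h c \<in> carrier N"
      unfolding linear_extension_def using assms(4) fin[OF c]
      by (intro N.finsum_closed) (auto simp: \<psi> cl Pi_iff subset_iff)
  next
    fix c d assume c: "c \<in> carrier ?L" and d: "d \<in> carrier ?L"
    let ?B = "?supp c \<union> ?supp d"
    have B: "finite ?B" "?B \<subseteq> G" using fin[OF c] fin[OF d] by auto
    have h: "h g \<in> carrier N" if "g \<in> ?B" for g using assms(4) B(2) that by blast
    have "linear_extension R \<psi> N h (c \<oplus>\<^bsub>?L\<^esub> d) = (\<Oplus>\<^bsub>N\<^esub>g\<in>?B. \<psi> ((c \<oplus>\<^bsub>?L\<^esub> d) g) \<odot>\<^bsub>N\<^esub> h g)"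
      using c d B by (intro eq L.a_closed) auto
    also have "\<dots> = (\<Oplus>\<^bsub>N\<^esub>g\<in>?B. \<psi> (c g) \<odot>\<^bsub>N\<^esub> h g \<oplus>\<^bsub>N\<^esub> \<psi> (d g) \<odot>\<^bsub>N\<^esub> h g)"
      using h cl[OF c] cl[OF d]
      by (intro N.finsum_cong') (auto simp: \<psi> ring_hom_add[OF assms(3)] N.smult_l_distr)
    also have "\<dots> = (\<Oplus>\<^bsub>N\<^esub>g\<in>?B. \<psi> (c g) \<odot>\<^bsub>N\<^esub> h g) \<oplus>\<^bsub>N\<^esub> (\<Oplus>\<^bsub>N\<^esub>g\<in>?B. \<psi> (d g) \<odot>\<^bsub>N\<^esub> h g)"
      using h cl[OF c] cl[OF d] by (intro N.finsum_addf) (auto simp: \<psi>)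
    finally show "linear_extension R \<psi> N h (c \<oplus>\<^bsub>?L\<^esub> d) =
        linear_extension R \<psi> N h c \<oplus>\<^bsub>N\<^esub> linear_extension R \<psi> N h d"
      using eq[OF c B(1) _ B(2)] eq[OF d B(1) _ B(2)] by simp
  next
    fix a c assume a: "a \<in> carrier R" and c: "c \<in> carrier ?L"
    have h: "h g \<in> carrier N" if "g \<in> ?supp c" for g using assms(4) fin(2)[OF c] that by blast
    have "linear_extension R \<psi> N h (a \<odot>\<^bsub>?L\<^esub> c) = (\<Oplus>\<^bsub>N\<^esub>g\<in>?supp c. \<psi> ((a \<odot>\<^bsub>?L\<^esub> c) g) \<odot>\<^bsub>N\<^esub> h g)"
      using a c fin[OF c] by (intro eq L.smult_closed) auto
    also have "\<dots> = (\<Oplus>\<^bsub>N\<^esub>g\<in>?supp c. \<psi> a \<odot>\<^bsub>N\<^esub> (\<psi> (c g) \<odot>\<^bsub>N\<^esub> h g))"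
      using h a cl[OF c]
      by (intro N.finsum_cong') (auto simp: \<psi> ring_hom_mult[OF assms(3)] N.smult_assoc1)
    also have "\<dots> = \<psi> a \<odot>\<^bsub>N\<^esub> (\<Oplus>\<^bsub>N\<^esub>g\<in>?supp c. \<psi> (c g) \<odot>\<^bsub>N\<^esub> h g)"
      using h a cl[OF c] fin[OF c] by (intro N.finsum_smult_ldistr[symmetric]) (auto simp: \<psi>)
    finally show "linear_extension R \<psi> N h (a \<odot>\<^bsub>?L\<^esub> c) = \<psi> a \<odot>\<^bsub>N\<^esub> linear_extension R \<psi> N h c"
      by (simp add: linear_extension_def)
  qed
qed

lemma linear_extension_gen:
  assumes "cring R" "module S N" "\<psi> \<in> ring_hom R S" "h \<in> G \<rightarrow> carrier N" "g \<in> G"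
  shows "linear_extension R \<psi> N h (free_gen R g) = h g"
proof -
  interpret N: module S N by fact
  have "linear_extension R \<psi> N h (free_gen R g) = (\<Oplus>\<^bsub>N\<^esub>x\<in>{g}. \<psi> (free_gen R g x) \<odot>\<^bsub>N\<^esub> h x)"
    using assms by (intro linear_extension_eq[where G = G] free_gen_closed) (auto simp: free_gen_def)
  also have "\<dots> = h g"
    using assms by (auto simp: free_gen_def ring_hom_one[OF assms(3)] Pi_iff)
  finally show ?thesis .
qed

lemma quotient_module_simps [simp]:
  "carrier (quotient_module M N) = a_rcosets\<^bsub>M\<^esub> N"
  "\<zero>\<^bsub>quotient_module M N\<^esub> = N"
  "A \<oplus>\<^bsub>quotient_module M N\<^esub> B = A <+>\<^bsub>M\<^esub> B"
  "a \<odot>\<^bsub>quotient_module M N\<^esub> A = (\<Union>x\<in>A. N +>\<^bsub>M\<^esub> (a \<odot>\<^bsub>M\<^esub> x))"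
  by (simp_all add: quotient_module_def)

lemma submodule_abelian_subgroup:
  assumes "module R M" "submodule N R M"
  shows "abelian_subgroup N M"
  using assms module_abelian_group submodule.axioms(1)
  by (intro abelian_subgroupI3 additive_subgroup.intro) blast+

text \<open>The scalar action on a quotient is a union over all representatives y of a coset. It
  collapses to one coset: y and x differ by some h in N, and a h lies in N again.\<close>

lemma rcoset_smult:
  assumes "module R M" "submodule N R M" "a \<in> carrier R" "x \<in> carrier M"
  shows "(\<Union>y\<in>N +>\<^bsub>M\<^esub> x. N +>\<^bsub>M\<^esub> (a \<odot>\<^bsub>M\<^esub> y)) = N +>\<^bsub>M\<^esub> (a \<odot>\<^bsub>M\<^esub> x)"
proof -
  interpret M: module R M by fact
  interpret S: abelian_subgroup N M by (rule submodule_abelian_subgroup[OF assms(1,2)])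
  have "N +>\<^bsub>M\<^esub> (a \<odot>\<^bsub>M\<^esub> y) = N +>\<^bsub>M\<^esub> (a \<odot>\<^bsub>M\<^esub> x)" if y: "y \<in> N +>\<^bsub>M\<^esub> x" for y
  proof -
    obtain h where h: "h \<in> N" "y = h \<oplus>\<^bsub>M\<^esub> x" using y by (auto simp: a_r_coset_def')
    then have "a \<odot>\<^bsub>M\<^esub> y = a \<odot>\<^bsub>M\<^esub> h \<oplus>\<^bsub>M\<^esub> a \<odot>\<^bsub>M\<^esub> x"
      using assms S.a_subset by (auto simp: M.smult_r_distr)
    then have "a \<odot>\<^bsub>M\<^esub> y \<in> N +>\<^bsub>M\<^esub> (a \<odot>\<^bsub>M\<^esub> x)"
      using h(1) submodule_smult[OF assms(2,3)] assms(3,4) S.a_subset by (auto intro!: M.a_rcosI)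
    then show ?thesis
      using M.a_repr_independence[OF _ _ S.a_subgroup] assms(3,4) by (metis M.smult_closed)
  qed
  moreover have "x \<in> N +>\<^bsub>M\<^esub> x" using assms(4) by (rule S.a_rcos_self)
  ultimately show ?thesis by blast
qed

lemma quotient_module_module:
  assumes "module R M" "submodule N R M"
  shows "module R (quotient_module M N)"
proof -
  interpret M: module R M by fact
  interpret S: abelian_subgroup N M by (rule submodule_abelian_subgroup[OF assms])
  let ?Q = "quotient_module M N"
  have rep: "\<exists>x\<in>carrier M. A = N +>\<^bsub>M\<^esub> x" if "A \<in> carrier ?Q" for A
    using that by (auto simp: A_RCOSETS_def')
  have "abelian_group ?Q"
  proof (rule abelian_groupI)
    fix A B assume "A \<in> carrier ?Q" "B \<in> carrier ?Q"
    then obtain x y where "x \<in> carrier M" "A = N +>\<^bsub>M\<^esub> x" "y \<in> carrier M" "B = N +>\<^bsub>M\<^esub> y"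
      using rep by metis
    then show "A \<oplus>\<^bsub>?Q\<^esub> B = B \<oplus>\<^bsub>?Q\<^esub> A"
      by (simp add: S.a_rcos_sum M.a_comm)
  next
    fix A assume "A \<in> carrier ?Q"
    then show "\<exists>B\<in>carrier ?Q. B \<oplus>\<^bsub>?Q\<^esub> A = \<zero>\<^bsub>?Q\<^esub>"
      using S.a_rcosets_inv_mult_group_eq S.a_setinv_closed by auto
  qed (simp_all add: S.a_setmult_closed S.a_subgroup_in_rcosets S.a_rcosets_assoc S.rcosets_add_eq)
  then show ?thesis
  proof (intro moduleI M.is_cring, goal_cases)
    case (2 a A)
    then obtain x where "x \<in> carrier M" "A = N +>\<^bsub>M\<^esub> x" using rep by metis
    with 2 show ?case
      using S.a_subset by (simp add: rcoset_smult[OF assms] M.a_rcosetsI)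
  next
    case (3 a b A)
    then obtain x where "x \<in> carrier M" "A = N +>\<^bsub>M\<^esub> x" using rep by metis
    with 3 show ?case
      by (simp add: rcoset_smult[OF assms] S.a_rcos_sum M.smult_l_distr)
  next
    case (4 a A B)
    then obtain x y where "x \<in> carrier M" "A = N +>\<^bsub>M\<^esub> x" "y \<in> carrier M" "B = N +>\<^bsub>M\<^esub> y" using rep by metis
    with 4 show ?case
      by (simp add: rcoset_smult[OF assms] S.a_rcos_sum M.smult_r_distr)
  next
    case (5 a b A)
    then obtain x where "x \<in> carrier M" "A = N +>\<^bsub>M\<^esub> x" using rep by metis
    with 5 show ?case
      by (simp add: rcoset_smult[OF assms] M.smult_assoc1)
  next
    case (6 A)
    then obtain x where "x \<in> carrier M" "A = N +>\<^bsub>M\<^esub> x" using rep by metis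
    then show ?case
      by (simp add: rcoset_smult[OF assms])
  qed
qed

lemma quotient_projection_semilinear:
  assumes "module R M" "submodule N R M"
  shows "semilinear R id M (quotient_module M N) (\<lambda>x. N +>\<^bsub>M\<^esub> x)"
proof -
  interpret M: module R M by fact
  interpret S: abelian_subgroup N M by (rule submodule_abelian_subgroup[OF assms])
  show ?thesis
    using S.a_subset by (intro semilinearI) (auto simp: M.a_rcosetsI S.a_rcos_sum rcoset_smult[OF assms])
qed

section \<open>The universal property of a module given by generators and relations\<close>

context
  fixes R :: "('a, 'z) ring_scheme" and G :: "'g set" and Rel
  assumes R: "cring R" and Rel: "Rel \<subseteq> carrier (free_module R G)"
begin

lemma presented_relations_submodule:
  "submodule (module_span R (free_module R G) Rel) R (free_module R G)"
  by (rule module_span_submodule[OF free_module_module[OF R] Rel])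

lemma presented_module_module: "module R (presented_module R G Rel)"
  unfolding presented_module_def
  by (intro quotient_module_module free_module_module R presented_relations_submodule)

definition presented_proj where
  "presented_proj = (\<lambda>c. module_span R (free_module R G) Rel +>\<^bsub>free_module R G\<^esub> c)"

lemma presented_proj_semilinear:
  "semilinear R id (free_module R G) (presented_module R G Rel) presented_proj"
  unfolding presented_module_def presented_proj_def
  by (intro quotient_projection_semilinear free_module_module R presented_relations_submodule)

lemma presented_proj_gen: "presented_proj (free_gen R g) = presented_gen R G Rel g"
  by (simp add: presented_proj_def presented_gen_def)

lemma presented_proj_rel:
  assumes "c \<in> Rel"
  shows "presented_proj c = \<zero>\<^bsub>presented_module R G Rel\<^esub>"
proof -
  interpret L: module R "free_module R G" by (rule free_module_module[OF R])
  have "presented_proj c = module_span R (free_module R G) Rel"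
    unfolding presented_proj_def
    by (rule L.a_coset_join2[OF subsetD[OF Rel assms] submodule.axioms(1)[OF presented_relations_submodule]
          subsetD[OF module_span_superset assms]])
  then show ?thesis by (simp add: presented_module_def)
qed

lemma presented_proj_surj:
  assumes "A \<in> carrier (presented_module R G Rel)"
  obtains c where "c \<in> carrier (free_module R G)" "A = presented_proj c"
  using assms by (auto simp: presented_module_def A_RCOSETS_def' presented_proj_def)

lemma presented_gen_closed:
  "g \<in> G \<Longrightarrow> presented_gen R G Rel g \<in> carrier (presented_module R G Rel)"
  using semilinear_closed[OF presented_proj_semilinear free_gen_closed[OF R]] presented_proj_gen by metis

text \<open>Pulled back along the projection, N becomes a submodule of the free module, to which the
  induction over supports applies.\<close>

lemma presented_module_induct:
  assumes "submodule N R (presented_module R G Rel)" "\<And>g. g \<in> G \<Longrightarrow> presented_gen R G Rel g \<in> N"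
    and "A \<in> carrier (presented_module R G Rel)"
  shows "A \<in> N"
proof -
  obtain c where c: "c \<in> carrier (free_module R G)" "A = presented_proj c"
    using presented_proj_surj[OF assms(3)] .
  let ?K = "{x \<in> carrier (free_module R G). presented_proj x \<in> N}"
  have "submodule ?K R (free_module R G)"
    by (rule semilinear_vimage_submodule[OF free_module_module[OF R]
          presented_module_module presented_proj_semilinear _ assms(1)]) simp
  then have "c \<in> ?K"
    by (rule free_module_induct[OF R _ _ c(1)])
      (simp add: presented_proj_gen assms(2) free_gen_closed[OF R])
  then show ?thesis using c(2) by simp
qed

context
  fixes S :: "('b, 'w) ring_scheme" and N :: "('b, 'm, 'y) module_scheme" and \<psi> h
  assumes N: "module S N" and \<psi>: "\<psi> \<in> ring_hom R S" and h: "h \<in> G \<rightarrow> carrier N"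
    and kills: "\<And>c. c \<in> Rel \<Longrightarrow> linear_extension R \<psi> N h c = \<zero>\<^bsub>N\<^esub>"
begin

text \<open>\<open>presented_map\<close> uses \<open>the_elem\<close>, so all representatives of a
  coset must give the same sum. They do: they differ by an element of the span of the relations, and
  the kernel of the linear extension is a submodule containing the relations.\<close>

lemma presented_map_proj:
  assumes c: "c \<in> carrier (free_module R G)"
  shows "presented_map R \<psi> N h (presented_proj c) = linear_extension R \<psi> N h c"
proof -
  let ?L = "free_module R G" and ?f = "linear_extension R \<psi> N h"
  let ?K = "module_span R ?L Rel"
  interpret L: module R ?L by (rule free_module_module[OF R])
  interpret N: module S N by (rule N)
  note f = linear_extension_semilinear[OF R N \<psi> h]
  have "?K \<subseteq> {x \<in> carrier ?L. ?f x = \<zero>\<^bsub>N\<^esub>}"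
    using kills Rel ring_hom_closed[OF \<psi>]
    by (intro module_span_minimal semilinear_kernel_submodule[OF L.module_axioms N f]) auto
  then have "?f d = ?f c" if d: "d \<in> presented_proj c" for d
  proof -
    obtain k where k: "k \<in> ?K" "d = k \<oplus>\<^bsub>?L\<^esub> c" using d by (auto simp: presented_proj_def a_r_coset_def')
    then have "?f d = ?f k \<oplus>\<^bsub>N\<^esub> ?f c" and "?f k = \<zero>\<^bsub>N\<^esub>"
      using semilinear_add[OF f _ c] \<open>?K \<subseteq> _\<close> by auto
    then show ?thesis using semilinear_closed[OF f c] by simp
  qed
  moreover have "c \<in> presented_proj c"
    unfolding presented_proj_def
    using abelian_subgroup.a_rcos_self[OF submodule_abelian_subgroup[OF L.module_axioms
          presented_relations_submodule] c] .
  ultimately have "?f ` presented_proj c = {?f c}" by blast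
  then show ?thesis
    by (simp add: presented_map_def linear_extension_def[abs_def])
qed

lemma presented_map_semilinear:
  "semilinear R \<psi> (presented_module R G Rel) N (presented_map R \<psi> N h)"
proof -
  interpret L: module R "free_module R G" by (rule free_module_module[OF R])
  note f = linear_extension_semilinear[OF R N \<psi> h]
  note p = presented_proj_semilinear
  show ?thesis
  proof (rule semilinearI)
    fix A assume "A \<in> carrier (presented_module R G Rel)"
    then obtain c where c: "c \<in> carrier (free_module R G)" "A = presented_proj c"
      using presented_proj_surj by blast
    then show "presented_map R \<psi> N h A \<in> carrier N"
      by (simp add: presented_map_proj semilinear_closed[OF f])
    fix B assume "B \<in> carrier (presented_module R G Rel)"
    then obtain d where d: "d \<in> carrier (free_module R G)" "B = presented_proj d"
      using presented_proj_surj by blast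
    show "presented_map R \<psi> N h (A \<oplus>\<^bsub>presented_module R G Rel\<^esub> B) =
        presented_map R \<psi> N h A \<oplus>\<^bsub>N\<^esub> presented_map R \<psi> N h B"
      unfolding c d semilinear_add[OF p c(1) d(1), symmetric]
      using c(1) d(1) L.a_closed[OF c(1) d(1)]
      by (simp only: presented_map_proj semilinear_add[OF f])
  next
    fix a A assume a: "a \<in> carrier R" and "A \<in> carrier (presented_module R G Rel)"
    then obtain c where c: "c \<in> carrier (free_module R G)" "A = presented_proj c"
      using presented_proj_surj by blast
    have "a \<odot>\<^bsub>presented_module R G Rel\<^esub> A = presented_proj (a \<odot>\<^bsub>free_module R G\<^esub> c)"
      using semilinear_smult[OF p a c(1)] c(2) by simp
    then show "presented_map R \<psi> N h (a \<odot>\<^bsub>presented_module R G Rel\<^esub> A) = \<psi> a \<odot>\<^bsub>N\<^esub> presented_map R \<psi> N h A"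
      using c a L.smult_closed[OF a c(1)]
      by (simp only: presented_map_proj semilinear_smult[OF f])
  qed
qed

lemma presented_map_gen: "g \<in> G \<Longrightarrow> presented_map R \<psi> N h (presented_gen R G Rel g) = h g"
  using presented_map_proj[OF free_gen_closed[OF R]] linear_extension_gen[OF R N \<psi> h]
  by (simp add: presented_proj_gen)

end

end

text \<open>Relations with two sides are recorded as differences; this reduces the hypothesis
  \<open>kills\<close> of the universal property to an equation between the values of the two
  sides.\<close>

lemma linear_extension_minus:
  assumes "cring R" "module S N" "\<psi> \<in> ring_hom R S" "h \<in> G \<rightarrow> carrier N"
    and "c \<in> carrier (free_module R G)" "d \<in> carrier (free_module R G)"
    and "linear_extension R \<psi> N h c = linear_extension R \<psi> N h d"
  shows "linear_extension R \<psi> N h (c \<ominus>\<^bsub>free_module R G\<^esub> d) = \<zero>\<^bsub>N\<^esub>"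
proof -
  interpret N: module S N by fact
  note f = linear_extension_semilinear[OF assms(1-4)]
  show ?thesis
    unfolding semilinear_minus[OF free_module_module[OF assms(1)] assms(2) f assms(5,6)] assms(7)
    using semilinear_closed[OF f assms(6)] by (simp add: N.r_neg a_minus_def)
qed

lemma presented_proj_eq:
  assumes "cring R" "Rel \<subseteq> carrier (free_module R G)"
    and "c \<in> carrier (free_module R G)" "d \<in> carrier (free_module R G)"
    and "c \<ominus>\<^bsub>free_module R G\<^esub> d \<in> Rel"
  shows "presented_proj R G Rel c = presented_proj R G Rel d"
proof -
  interpret N: module R "presented_module R G Rel" by (rule presented_module_module[OF assms(1,2)])
  note f = presented_proj_semilinear[OF assms(1,2)]
  have "presented_proj R G Rel c \<ominus>\<^bsub>presented_module R G Rel\<^esub> presented_proj R G Rel d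
      = \<zero>\<^bsub>presented_module R G Rel\<^esub>"
    using presented_proj_rel[OF assms(1,2,5)]
      semilinear_minus[OF free_module_module[OF assms(1)] N.module_axioms f assms(3,4)] by simp
  then show ?thesis
    using semilinear_closed[OF f assms(3)] semilinear_closed[OF f assms(4)]
    by (metis N.add.inv_closed N.add.inv_equality N.minus_minus a_minus_def)
qed

section \<open>Extension of scalars\<close>

context
  fixes A :: "('a, 'z) ring_scheme" and \<phi> :: "'a \<Rightarrow> 'b" and B :: "('b, 'w) ring_scheme"
    and M :: "('a, 'm, 'y) module_scheme"
  assumes M: "module A M" and B: "cring B" and \<phi>: "\<phi> \<in> carrier A \<rightarrow> carrier B"
begin

lemma base_change_rels_closed: "base_change_rels A \<phi> B M \<subseteq> carrier (free_module B (carrier M))"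
proof -
  interpret M: module A M by (rule M)
  interpret L: module B "free_module B (carrier M)" by (rule free_module_module[OF B])
  note gen = free_gen_closed[OF B, where G = "carrier M"]
  show ?thesis
    unfolding base_change_rels_def Let_def using \<phi>
    by (intro Un_least subsetI)
      (elim CollectE exE conjE, hypsubst, intro L.minus_closed L.a_closed L.smult_closed gen;
        blast intro: M.a_closed M.smult_closed)+
qed

lemma base_change_module: "module B (base_change A \<phi> B M)"
  unfolding base_change_def by (rule presented_module_module[OF B base_change_rels_closed])

lemma tensor_one_closed: "x \<in> carrier M \<Longrightarrow> tensor_one A \<phi> B M x \<in> carrier (base_change A \<phi> B M)"
  unfolding base_change_def tensor_one_def by (rule presented_gen_closed[OF B base_change_rels_closed])

lemma tensor_one_semilinear: "semilinear A \<phi> M (base_change A \<phi> B M) (tensor_one A \<phi> B M)"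
proof -
  interpret M: module A M by (rule M)
  let ?L = "free_module B (carrier M)"
  interpret L: module B ?L by (rule free_module_module[OF B])
  note p = presented_proj_semilinear[OF B base_change_rels_closed]
  note gen = free_gen_closed[OF B, where G = "carrier M"]
  note defs = base_change_def tensor_one_def presented_proj_gen[symmetric, OF B base_change_rels_closed]
  show ?thesis
  proof (rule semilinearI)
    fix x y assume x: "x \<in> carrier M" and y: "y \<in> carrier M"
    have "presented_proj B (carrier M) (base_change_rels A \<phi> B M) (free_gen B (x \<oplus>\<^bsub>M\<^esub> y)) =
      presented_proj B (carrier M) (base_change_rels A \<phi> B M) (free_gen B x \<oplus>\<^bsub>?L\<^esub> free_gen B y)"
      using x y by (intro presented_proj_eq[OF B base_change_rels_closed] gen M.a_closed L.a_closed)
        (auto simp only: base_change_rels_def Let_def)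
    then show "tensor_one A \<phi> B M (x \<oplus>\<^bsub>M\<^esub> y) =
        tensor_one A \<phi> B M x \<oplus>\<^bsub>base_change A \<phi> B M\<^esub> tensor_one A \<phi> B M y"
      unfolding defs semilinear_add[OF p gen[OF x] gen[OF y]] .
  next
    fix a x assume a: "a \<in> carrier A" and x: "x \<in> carrier M"
    have \<phi>a: "\<phi> a \<in> carrier B" using \<phi> a by blast
    have "presented_proj B (carrier M) (base_change_rels A \<phi> B M) (free_gen B (a \<odot>\<^bsub>M\<^esub> x)) =
      presented_proj B (carrier M) (base_change_rels A \<phi> B M) (\<phi> a \<odot>\<^bsub>?L\<^esub> free_gen B x)"
      using a x \<phi>a
      by (intro presented_proj_eq[OF B base_change_rels_closed] gen M.smult_closed L.smult_closed)
        (auto simp only: base_change_rels_def Let_def)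
    then show "tensor_one A \<phi> B M (a \<odot>\<^bsub>M\<^esub> x) = \<phi> a \<odot>\<^bsub>base_change A \<phi> B M\<^esub> tensor_one A \<phi> B M x"
      unfolding defs semilinear_smult[OF p \<phi>a gen[OF x]] id_apply .
  qed (rule tensor_one_closed)
qed

lemma base_change_induct:
  assumes "submodule N B (base_change A \<phi> B M)" "\<And>x. x \<in> carrier M \<Longrightarrow> tensor_one A \<phi> B M x \<in> N"
    and "z \<in> carrier (base_change A \<phi> B M)"
  shows "z \<in> N"
  using presented_module_induct[OF B base_change_rels_closed] assms
  unfolding base_change_def tensor_one_def by blast

lemma base_change_eqI:
  assumes "module C N" "semilinear B \<psi> (base_change A \<phi> B M) N f" "semilinear B \<psi> (base_change A \<phi> B M) N g"
    and "\<And>x. x \<in> carrier M \<Longrightarrow> f (tensor_one A \<phi> B M x) = g (tensor_one A \<phi> B M x)"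
    and "z \<in> carrier (base_change A \<phi> B M)"
  shows "f z = g z"
proof -
  let ?K = "{z \<in> carrier (base_change A \<phi> B M). f z = g z}"
  have "z \<in> ?K"
    by (rule base_change_induct[OF semilinear_equalizer_submodule[OF base_change_module assms(1-3)] _ assms(5)])
      (simp add: assms(4) tensor_one_closed)
  then show ?thesis by simp
qed

context
  fixes C :: "('c, 'v) ring_scheme" and N :: "('c, 'n, 'x) module_scheme" and \<psi> h
  assumes N: "module C N" and \<psi>: "\<psi> \<in> ring_hom B C" and h: "semilinear A (\<lambda>a. \<psi> (\<phi> a)) M N h"
begin

text \<open>The two families of relations match the two clauses of semilinearity of h: additivity,
  and h(a x) = \<psi>(\<phi> a) h(x), whose right side is also the value at \<phi>(a) times the
  generator x.\<close>

lemma base_change_rels_kill: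
  assumes "c \<in> base_change_rels A \<phi> B M"
  shows "linear_extension B \<psi> N h c = \<zero>\<^bsub>N\<^esub>"
proof -
  interpret M: module A M by (rule M)
  interpret N: module C N by (rule N)
  let ?L = "free_module B (carrier M)"
  interpret L: module B ?L by (rule free_module_module[OF B])
  have hc: "h \<in> carrier M \<rightarrow> carrier N" using semilinear_closed[OF h] by blast
  note gen = free_gen_closed[OF B, where G = "carrier M"]
  note f = linear_extension_semilinear[OF B N \<psi> hc]
  note fg = linear_extension_gen[OF B N \<psi> hc]
  note minus = linear_extension_minus[OF B N \<psi> hc]
  consider (add) x y where "x \<in> carrier M" "y \<in> carrier M"
      "c = free_gen B (x \<oplus>\<^bsub>M\<^esub> y) \<ominus>\<^bsub>?L\<^esub> (free_gen B x \<oplus>\<^bsub>?L\<^esub> free_gen B y)"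
    | (smult) a x where "a \<in> carrier A" "x \<in> carrier M"
      "c = free_gen B (a \<odot>\<^bsub>M\<^esub> x) \<ominus>\<^bsub>?L\<^esub> \<phi> a \<odot>\<^bsub>?L\<^esub> free_gen B x"
    using assms unfolding base_change_rels_def Let_def by blast
  then show ?thesis
  proof cases
    case add
    show ?thesis
      unfolding add(3)
      by (intro minus gen L.a_closed M.a_closed add(1,2))
        (simp only: fg add(1,2) M.a_closed semilinear_add[OF f gen gen] semilinear_add[OF h])
  next
    case smult
    have \<phi>a: "\<phi> a \<in> carrier B" using \<phi> smult(1) by blast
    show ?thesis
      unfolding smult(3)
      by (intro minus gen L.smult_closed M.smult_closed \<phi>a smult(1,2))
        (simp only: fg smult(1,2) \<phi>a M.smult_closed semilinear_smult[OF f _ gen] semilinear_smult[OF h])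
  qed
qed

lemma base_change_lift_semilinear:
  "semilinear B \<psi> (base_change A \<phi> B M) N (presented_map B \<psi> N h)"
  unfolding base_change_def using semilinear_closed[OF h]
  by (intro presented_map_semilinear[OF B base_change_rels_closed N \<psi> _ base_change_rels_kill]) auto

lemma base_change_lift_tensor_one:
  "x \<in> carrier M \<Longrightarrow> presented_map B \<psi> N h (tensor_one A \<phi> B M x) = h x"
  unfolding tensor_one_def using semilinear_closed[OF h]
  by (intro presented_map_gen[OF B base_change_rels_closed N \<psi> _ base_change_rels_kill]) auto

end

end

section \<open>Functoriality of extension of scalars\<close>

context
  fixes A :: "('a, 'z) ring_scheme" and \<phi> :: "'a \<Rightarrow> 'b" and B :: "('b, 'w) ring_scheme"
    and M :: "('a, 'm, 'y) module_scheme"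
    and A' :: "('d, 'u) ring_scheme" and \<phi>' :: "'d \<Rightarrow> 'c" and C :: "('c, 'v) ring_scheme"
    and N :: "('d, 'n, 'x) module_scheme" and \<psi> \<theta> u
  assumes M: "module A M" and B: "cring B" and \<phi>: "\<phi> \<in> carrier A \<rightarrow> carrier B"
    and N: "module A' N" and C: "cring C" and \<phi>': "\<phi>' \<in> carrier A' \<rightarrow> carrier C"
    and \<psi>: "\<psi> \<in> ring_hom B C" and u: "semilinear A \<theta> M N u" and \<theta>: "\<theta> \<in> carrier A \<rightarrow> carrier A'"
    and comm: "\<And>a. a \<in> carrier A \<Longrightarrow> \<psi> (\<phi> a) = \<phi>' (\<theta> a)"
begin

text \<open>The square \<psi> \<phi> = \<phi>' \<theta> turns the \<theta>-semilinear u, followed by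
  tensoring with 1, into a map semilinear along \<psi> \<phi>, the form that lifts to the extension
  of scalars.\<close>

lemma base_change_map_lift:
  "semilinear A (\<lambda>a. \<psi> (\<phi> a)) M (base_change A' \<phi>' C N) (\<lambda>m. tensor_one A' \<phi>' C N (u m))"
  by (rule semilinear_comp[OF u tensor_one_semilinear[OF N C \<phi>'] \<theta> comm])

lemma base_change_map_semilinear:
  "semilinear B \<psi> (base_change A \<phi> B M) (base_change A' \<phi>' C N) (base_change_map B \<psi> C A' \<phi>' N u)"
  unfolding base_change_map_def
  by (rule base_change_lift_semilinear[OF M B \<phi> base_change_module[OF N C \<phi>'] \<psi> base_change_map_lift])

lemma base_change_map_tensor_one:
  "x \<in> carrier M \<Longrightarrow>
     base_change_map B \<psi> C A' \<phi>' N u (tensor_one A \<phi> B M x) = tensor_one A' \<phi>' C N (u x)"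
  unfolding base_change_map_def
  by (rule base_change_lift_tensor_one[OF M B \<phi> base_change_module[OF N C \<phi>'] \<psi> base_change_map_lift])

end

text \<open>Both sides are semilinear along \<psi>, and on m \<otimes> 1 both are u(\<tau> m)
  \<otimes> 1 + \<psi>(c) (u(m) \<otimes> 1). It serves for the map from \<Lambda>_i \<otimes> O_F
  to V and for the one to \<Lambda>_i \<otimes> R.\<close>

lemma base_change_map_shift:
  assumes M: "module A M" and B: "cring B" and \<phi>: "\<phi> \<in> carrier A \<rightarrow> carrier B"
    and N: "module A' N" and C: "cring C" and \<phi>': "\<phi>' \<in> carrier A' \<rightarrow> carrier C"
    and \<psi>: "\<psi> \<in> ring_hom B C" and u: "semilinear A \<theta> M N u" and \<theta>: "\<theta> \<in> carrier A \<rightarrow> carrier A'"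
    and comm: "\<And>a. a \<in> carrier A \<Longrightarrow> \<psi> (\<phi> a) = \<phi>' (\<theta> a)"
    and \<tau>: "semilinear A id M M \<tau>" and \<tau>': "semilinear A' id N N \<tau>'"
    and u\<tau>: "\<And>x. x \<in> carrier M \<Longrightarrow> u (\<tau> x) = \<tau>' (u x)"
    and c: "c \<in> carrier B" and z: "z \<in> carrier (base_change A \<phi> B M)"
  shows "base_change_map B \<psi> C A' \<phi>' N u
      (base_change_map B id B A \<phi> M \<tau> z \<oplus>\<^bsub>base_change A \<phi> B M\<^esub> c \<odot>\<^bsub>base_change A \<phi> B M\<^esub> z) =
    base_change_map C id C A' \<phi>' N \<tau>' (base_change_map B \<psi> C A' \<phi>' N u z)
      \<oplus>\<^bsub>base_change A' \<phi>' C N\<^esub> \<psi> c \<odot>\<^bsub>base_change A' \<phi>' C N\<^esub> base_change_map B \<psi> C A' \<phi>' N u z"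
proof -
  let ?M = "base_change A \<phi> B M" and ?N = "base_change A' \<phi>' C N"
  let ?u = "base_change_map B \<psi> C A' \<phi>' N u"
  note MB = base_change_module[OF M B \<phi>] and NC = base_change_module[OF N C \<phi>']
  interpret MB: module B ?M by (rule MB)
  have \<psi>': "\<psi> \<in> carrier B \<rightarrow> carrier C" using ring_hom_closed[OF \<psi>] by blast
  have idc: "id \<in> carrier A \<rightarrow> carrier A" "id \<in> carrier A' \<rightarrow> carrier A'" by simp_all
  have eqi: "id (\<phi> a) = \<phi> (id a)" "id (\<phi>' a') = \<phi>' (id a')" for a a' by simp_all
  have us: "semilinear B \<psi> ?M ?N ?u"
    by (rule base_change_map_semilinear[OF M B \<phi> N C \<phi>' \<psi> u \<theta> comm])
  have ut: "?u (tensor_one A \<phi> B M x) = tensor_one A' \<phi>' C N (u x)" if "x \<in> carrier M" for x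
    by (rule base_change_map_tensor_one[OF M B \<phi> N C \<phi>' \<psi> u \<theta> comm that])
  note \<tau>s = base_change_map_semilinear[OF M B \<phi> M B \<phi> id_ring_hom \<tau> idc(1) eqi(1)]
  note \<tau>t = base_change_map_tensor_one[OF M B \<phi> M B \<phi> id_ring_hom \<tau> idc(1) eqi(1)]
  note \<tau>'s = base_change_map_semilinear[OF N C \<phi>' N C \<phi>' id_ring_hom \<tau>' idc(2) eqi(2)]
  note \<tau>'t = base_change_map_tensor_one[OF N C \<phi>' N C \<phi>' id_ring_hom \<tau>' idc(2) eqi(2)]
  note t1 = tensor_one_closed[OF M B \<phi>]
  show ?thesis
  proof (rule base_change_eqI[OF M B \<phi> NC _ _ _ z])
    show "semilinear B \<psi> ?M ?N (\<lambda>z. ?u (base_change_map B id B A \<phi> M \<tau> z \<oplus>\<^bsub>?M\<^esub> c \<odot>\<^bsub>?M\<^esub> z))"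
      by (rule semilinear_comp[OF semilinear_plus_smult[OF MB \<tau>s c] us]) auto
    show "semilinear B \<psi> ?M ?N
        (\<lambda>z. base_change_map C id C A' \<phi>' N \<tau>' (?u z) \<oplus>\<^bsub>?N\<^esub> \<psi> c \<odot>\<^bsub>?N\<^esub> ?u z)"
      by (rule semilinear_comp[OF us semilinear_plus_smult[OF NC \<tau>'s] \<psi>']) (use c \<psi>' in auto)
    fix x assume x: "x \<in> carrier M"
    have \<tau>x: "\<tau> x \<in> carrier M" and ux: "u x \<in> carrier N"
      using x semilinear_closed[OF \<tau>] semilinear_closed[OF u] by auto
    show "?u (base_change_map B id B A \<phi> M \<tau> (tensor_one A \<phi> B M x) \<oplus>\<^bsub>?M\<^esub> c \<odot>\<^bsub>?M\<^esub> tensor_one A \<phi> B M x) =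
        base_change_map C id C A' \<phi>' N \<tau>' (?u (tensor_one A \<phi> B M x))
          \<oplus>\<^bsub>?N\<^esub> \<psi> c \<odot>\<^bsub>?N\<^esub> ?u (tensor_one A \<phi> B M x)"
      unfolding \<tau>t[OF x] semilinear_add[OF us t1[OF \<tau>x] MB.smult_closed[OF c t1[OF x]]]
        semilinear_smult[OF us c t1[OF x]] ut[OF x] ut[OF \<tau>x] u\<tau>[OF x] \<tau>'t[OF ux] ..
  qed
qed

section \<open>Exterior powers\<close>

text \<open>Closure of h is a separate clause since for l = 0 there is no position i whose
  semilinearity would supply it. The ring map \<psi> is built in, so that wedges over another ring
  are covered.\<close>

definition alternating ::
  "('a, 'z) ring_scheme \<Rightarrow> ('a \<Rightarrow> 'b) \<Rightarrow> nat \<Rightarrow> ('a, 'm, 'y) module_scheme \<Rightarrow> ('b, 'n, 'x) module_scheme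
     \<Rightarrow> ('m list \<Rightarrow> 'n) \<Rightarrow> bool" where
  "alternating R \<psi> l M N h \<longleftrightarrow>
     (\<forall>xs. length xs = l \<longrightarrow> set xs \<subseteq> carrier M \<longrightarrow>
        (\<forall>i<l. semilinear R \<psi> M N (\<lambda>x. h (xs[i := x]))) \<and>
        h xs \<in> carrier N \<and>
        (\<forall>i j. i < j \<longrightarrow> j < l \<longrightarrow> xs ! i = xs ! j \<longrightarrow> h xs = \<zero>\<^bsub>N\<^esub>))"

context
  fixes R :: "('a, 'z) ring_scheme" and l :: nat and M :: "('a, 'm, 'y) module_scheme"
    and G
  assumes M: "module R M"
  defines "G \<equiv> {xs. length xs = l \<and> set xs \<subseteq> carrier M}"
begin

interpretation M: module R M by (rule M)
interpretation L: module R "free_module R G" by (rule free_module_module[OF M.is_cring])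

lemma update_mem: "xs \<in> G \<Longrightarrow> x \<in> carrier M \<Longrightarrow> xs[i := x] \<in> G"
  using set_update_subset_insert[of xs i x] by (auto simp: G_def)

lemma exterior_rels_eq:
  "exterior_rels R l M =
     {free_gen R (xs[i := x \<oplus>\<^bsub>M\<^esub> y])
        \<ominus>\<^bsub>free_module R G\<^esub> (free_gen R (xs[i := x]) \<oplus>\<^bsub>free_module R G\<^esub> free_gen R (xs[i := y]))
        | xs i x y. xs \<in> G \<and> i < l \<and> x \<in> carrier M \<and> y \<in> carrier M} \<union>
     {free_gen R (xs[i := a \<odot>\<^bsub>M\<^esub> x]) \<ominus>\<^bsub>free_module R G\<^esub> a \<odot>\<^bsub>free_module R G\<^esub> free_gen R (xs[i := x])
        | xs i a x. xs \<in> G \<and> i < l \<and> a \<in> carrier R \<and> x \<in> carrier M} \<union>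
     {free_gen R xs | xs i j. xs \<in> G \<and> i < j \<and> j < l \<and> xs ! i = xs ! j}"
  unfolding exterior_rels_def Let_def G_def[symmetric] ..

lemma exterior_rels_closed: "exterior_rels R l M \<subseteq> carrier (free_module R G)"
proof -
  note gen = free_gen_closed[OF M.is_cring, where G = G]
  show ?thesis
    unfolding exterior_rels_eq
    by (intro Un_least subsetI; elim CollectE exE conjE; hypsubst)
      (intro L.minus_closed L.a_closed L.smult_closed gen update_mem M.a_closed M.smult_closed; assumption)+
qed

lemma exterior_power_module: "module R (exterior_power R l M)"
  unfolding exterior_power_def G_def[symmetric]
  by (rule presented_module_module[OF M.is_cring exterior_rels_closed])

lemma wedge_closed:
  "length xs = l \<Longrightarrow> set xs \<subseteq> carrier M \<Longrightarrow> wedge R l M xs \<in> carrier (exterior_power R l M)"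
  unfolding exterior_power_def wedge_def G_def[symmetric]
  by (rule presented_gen_closed[OF M.is_cring exterior_rels_closed]) (simp add: G_def)

lemma wedge_alternating: "alternating R id l M (exterior_power R l M) (wedge R l M)"
proof -
  let ?L = "free_module R G"
  let ?p = "presented_proj R G (exterior_rels R l M)"
  note cl = exterior_rels_closed
  note p = presented_proj_semilinear[OF M.is_cring cl]
  note gen = free_gen_closed[OF M.is_cring, where G = G]
  note defs = exterior_power_def wedge_def G_def[symmetric] presented_proj_gen[symmetric, OF M.is_cring cl]
  show ?thesis
    unfolding alternating_def
  proof (intro allI impI conjI)
    fix xs i assume "length xs = l" "set xs \<subseteq> carrier M" and i: "i < l"
    then have xs: "xs \<in> G" by (simp add: G_def)
    show "semilinear R id M (exterior_power R l M) (\<lambda>x. wedge R l M (xs[i := x]))"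
    proof (rule semilinearI)
      fix x assume "x \<in> carrier M"
      then show "wedge R l M (xs[i := x]) \<in> carrier (exterior_power R l M)"
        using update_mem[OF xs] by (intro wedge_closed) (auto simp: G_def)
    next
      fix x y assume x: "x \<in> carrier M" and y: "y \<in> carrier M"
      have "?p (free_gen R (xs[i := x \<oplus>\<^bsub>M\<^esub> y])) =
          ?p (free_gen R (xs[i := x]) \<oplus>\<^bsub>?L\<^esub> free_gen R (xs[i := y]))"
        using x y xs i by (intro presented_proj_eq[OF M.is_cring cl] gen update_mem M.a_closed L.a_closed)
          (auto simp only: exterior_rels_eq)
      then show "wedge R l M (xs[i := x \<oplus>\<^bsub>M\<^esub> y]) =
          wedge R l M (xs[i := x]) \<oplus>\<^bsub>exterior_power R l M\<^esub> wedge R l M (xs[i := y])"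
        unfolding defs semilinear_add[OF p gen[OF update_mem[OF xs x]] gen[OF update_mem[OF xs y]]] .
    next
      fix a x assume a: "a \<in> carrier R" and x: "x \<in> carrier M"
      have "?p (free_gen R (xs[i := a \<odot>\<^bsub>M\<^esub> x])) = ?p (a \<odot>\<^bsub>?L\<^esub> free_gen R (xs[i := x]))"
        using a x xs i by (intro presented_proj_eq[OF M.is_cring cl] gen update_mem M.smult_closed L.smult_closed)
          (auto simp only: exterior_rels_eq)
      then show "wedge R l M (xs[i := a \<odot>\<^bsub>M\<^esub> x]) = id a \<odot>\<^bsub>exterior_power R l M\<^esub> wedge R l M (xs[i := x])"
        unfolding defs semilinear_smult[OF p a gen[OF update_mem[OF xs x]]] .
    qed
  next
    fix xs i j assume "length xs = l" "set xs \<subseteq> carrier M" "i < j" "j < l" "xs ! i = xs ! j"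
    then have "free_gen R xs \<in> exterior_rels R l M"
      unfolding exterior_rels_eq by (auto simp: G_def)
    then show "wedge R l M xs = \<zero>\<^bsub>exterior_power R l M\<^esub>"
      using presented_proj_rel[OF M.is_cring cl] unfolding defs by blast
  qed (rule wedge_closed)
qed

lemma exterior_power_induct:
  assumes "submodule N R (exterior_power R l M)"
    and "\<And>xs. length xs = l \<Longrightarrow> set xs \<subseteq> carrier M \<Longrightarrow> wedge R l M xs \<in> N"
    and "z \<in> carrier (exterior_power R l M)"
  shows "z \<in> N"
  by (rule presented_module_induct[OF M.is_cring exterior_rels_closed])
    (use assms in \<open>simp_all add: exterior_power_def wedge_def G_def\<close>)

lemma exterior_power_eqI:
  assumes "module C N" "semilinear R \<psi> (exterior_power R l M) N f" "semilinear R \<psi> (exterior_power R l M) N g"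
    and "\<And>xs. length xs = l \<Longrightarrow> set xs \<subseteq> carrier M \<Longrightarrow> f (wedge R l M xs) = g (wedge R l M xs)"
    and "z \<in> carrier (exterior_power R l M)"
  shows "f z = g z"
proof -
  let ?K = "{z \<in> carrier (exterior_power R l M). f z = g z}"
  have "z \<in> ?K"
    by (rule exterior_power_induct[OF semilinear_equalizer_submodule[OF exterior_power_module assms(1-3)] _ assms(5)])
      (simp add: assms(4) wedge_closed)
  then show ?thesis by simp
qed

context
  fixes S :: "('b, 'w) ring_scheme" and N :: "('b, 'n, 'x) module_scheme" and \<psi> h
  assumes N: "module S N" and \<psi>: "\<psi> \<in> ring_hom R S" and h: "alternating R \<psi> l M N h"
begin

lemma exterior_rels_kill:
  assumes "c \<in> exterior_rels R l M"
  shows "linear_extension R \<psi> N h c = \<zero>\<^bsub>N\<^esub>"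
proof -
  interpret N: module S N by (rule N)
  let ?L = "free_module R G"
  have hc: "h \<in> G \<rightarrow> carrier N" using h by (auto simp: alternating_def G_def)
  have sl: "semilinear R \<psi> M N (\<lambda>x. h (xs[i := x]))" if "xs \<in> G" "i < l" for xs i
    using h that by (auto simp: alternating_def G_def)
  note gen = free_gen_closed[OF M.is_cring, where G = G]
  note f = linear_extension_semilinear[OF M.is_cring N \<psi> hc]
  note fg = linear_extension_gen[OF M.is_cring N \<psi> hc]
  note minus = linear_extension_minus[OF M.is_cring N \<psi> hc]
  consider (add) xs i x y where "xs \<in> G" "i < l" "x \<in> carrier M" "y \<in> carrier M"
      "c = free_gen R (xs[i := x \<oplus>\<^bsub>M\<^esub> y]) \<ominus>\<^bsub>?L\<^esub>
         (free_gen R (xs[i := x]) \<oplus>\<^bsub>?L\<^esub> free_gen R (xs[i := y]))"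
    | (smult) xs i a x where "xs \<in> G" "i < l" "a \<in> carrier R" "x \<in> carrier M"
      "c = free_gen R (xs[i := a \<odot>\<^bsub>M\<^esub> x]) \<ominus>\<^bsub>?L\<^esub> a \<odot>\<^bsub>?L\<^esub> free_gen R (xs[i := x])"
    | (alt) xs i j where "xs \<in> G" "i < j" "j < l" "xs ! i = xs ! j" "c = free_gen R xs"
    using assms unfolding exterior_rels_eq by blast
  then show ?thesis
  proof cases
    case add
    note u = update_mem[OF add(1)]
    show ?thesis
      unfolding add(5)
      by (intro minus gen L.a_closed M.a_closed add(3,4) u)
        (simp only: fg add u M.a_closed semilinear_add[OF f gen gen] semilinear_add[OF sl])
  next
    case smult
    note u = update_mem[OF smult(1)]
    show ?thesis
      unfolding smult(5)
      by (intro minus gen L.smult_closed M.smult_closed smult(3,4) u)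
        (simp only: fg smult u M.smult_closed semilinear_smult[OF f _ gen] semilinear_smult[OF sl])
  next
    case alt
    then show ?thesis
      using h by (auto simp: fg alternating_def G_def)
  qed
qed

lemma exterior_lift_semilinear:
  "semilinear R \<psi> (exterior_power R l M) N (presented_map R \<psi> N h)"
  unfolding exterior_power_def G_def[symmetric] using h
  by (intro presented_map_semilinear[OF M.is_cring exterior_rels_closed N \<psi> _ exterior_rels_kill])
    (auto simp: alternating_def G_def)

lemma exterior_lift_wedge:
  "length xs = l \<Longrightarrow> set xs \<subseteq> carrier M \<Longrightarrow> presented_map R \<psi> N h (wedge R l M xs) = h xs"
  unfolding wedge_def G_def[symmetric] using h
  by (intro presented_map_gen[OF M.is_cring exterior_rels_closed N \<psi> _ exterior_rels_kill])
    (auto simp: alternating_def G_def)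

end

end

section \<open>Functoriality of exterior powers\<close>

lemma alternating_map:
  assumes "alternating S \<chi> l N P h" "semilinear R \<psi> M N f" "\<psi> \<in> carrier R \<rightarrow> carrier S"
    and "\<And>a. a \<in> carrier R \<Longrightarrow> \<theta> a = \<chi> (\<psi> a)"
  shows "alternating R \<theta> l M P (\<lambda>xs. h (map f xs))"
  unfolding alternating_def
proof (intro allI impI)
  fix xs assume xs: "length xs = l" "set xs \<subseteq> carrier M"
  let ?ys = "map f xs"
  have ys: "length ?ys = l" "set ?ys \<subseteq> carrier N"
    using xs semilinear_closed[OF assms(2)] by auto
  show "(\<forall>i<l. semilinear R \<theta> M P (\<lambda>x. h (map f (xs[i := x])))) \<and> h ?ys \<in> carrier P \<and>
      (\<forall>i j. i < j \<longrightarrow> j < l \<longrightarrow> xs ! i = xs ! j \<longrightarrow> h ?ys = \<zero>\<^bsub>P\<^esub>)"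
  proof (intro conjI allI impI)
    fix i assume "i < l"
    then have "semilinear S \<chi> N P (\<lambda>y. h (?ys[i := y]))"
      using assms(1) ys unfolding alternating_def by blast
    from semilinear_comp[OF assms(2) this assms(3,4)]
    show "semilinear R \<theta> M P (\<lambda>x. h (map f (xs[i := x])))" by (simp add: map_update)
  next
    show "h ?ys \<in> carrier P" using assms(1) ys unfolding alternating_def by blast
  next
    fix i j assume "i < j" "j < l" "xs ! i = xs ! j"
    then show "h ?ys = \<zero>\<^bsub>P\<^esub>"
      using assms(1) ys xs(1) unfolding alternating_def by (metis nth_map order.strict_trans)
  qed
qed

context
  fixes R :: "('a, 'z) ring_scheme" and l :: nat and M :: "('a, 'm, 'y) module_scheme"
    and S :: "('b, 'w) ring_scheme" and N :: "('b, 'n, 'x) module_scheme" and \<psi> f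
  assumes M: "module R M" and N: "module S N" and \<psi>: "\<psi> \<in> ring_hom R S"
    and f: "semilinear R \<psi> M N f"
begin

lemma wedge_map_alternating:
  "alternating R \<psi> l M (exterior_power S l N) (\<lambda>xs. wedge S l N (map f xs))"
  using ring_hom_closed[OF \<psi>] by (intro alternating_map[OF wedge_alternating[OF N] f]) auto

lemma exterior_map_semilinear:
  "semilinear R \<psi> (exterior_power R l M) (exterior_power S l N) (exterior_map R \<psi> S l N f)"
  unfolding exterior_map_def
  by (rule exterior_lift_semilinear[OF M exterior_power_module[OF N] \<psi> wedge_map_alternating])

lemma exterior_map_wedge:
  "length xs = l \<Longrightarrow> set xs \<subseteq> carrier M \<Longrightarrow>
     exterior_map R \<psi> S l N f (wedge R l M xs) = wedge S l N (map f xs)"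
  unfolding exterior_map_def
  by (rule exterior_lift_wedge[OF M exterior_power_module[OF N] \<psi> wedge_map_alternating])

end

text \<open>Both composites send a pure wedge to the wedge of the images of its factors. The four
  corners may have different base rings, and identity sides are allowed, so one statement serves for
  the comparison with V, the passage to R and the retraction onto a summand.\<close>

lemma exterior_map_commute:
  assumes M: "module R M" "module S N" "module S' N'" "module T P"
    and f: "\<psi> \<in> ring_hom R S" "semilinear R \<psi> M N f"
    and g: "\<chi> \<in> ring_hom S T" "semilinear S \<chi> N P g"
    and f': "\<psi>' \<in> ring_hom R S'" "semilinear R \<psi>' M N' f'"
    and g': "\<chi>' \<in> ring_hom S' T" "semilinear S' \<chi>' N' P g'"
    and comm: "\<And>x. x \<in> carrier M \<Longrightarrow> g (f x) = g' (f' x)"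
      "\<And>a. a \<in> carrier R \<Longrightarrow> \<chi> (\<psi> a) = \<chi>' (\<psi>' a)"
    and w: "w \<in> carrier (exterior_power R l M)"
  shows "exterior_map S \<chi> T l P g (exterior_map R \<psi> S l N f w) =
    exterior_map S' \<chi>' T l P g' (exterior_map R \<psi>' S' l N' f' w)"
proof (rule exterior_power_eqI[OF M(1) exterior_power_module[OF M(4)] _ _ _ w])
  show "semilinear R (\<lambda>a. \<chi> (\<psi> a)) (exterior_power R l M) (exterior_power T l P)
      (\<lambda>w. exterior_map S \<chi> T l P g (exterior_map R \<psi> S l N f w))"
    using ring_hom_closed[OF f(1)]
    by (intro semilinear_comp[OF exterior_map_semilinear[OF M(1,2) f] exterior_map_semilinear[OF M(2,4) g]]) auto
  show "semilinear R (\<lambda>a. \<chi> (\<psi> a)) (exterior_power R l M) (exterior_power T l P)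
      (\<lambda>w. exterior_map S' \<chi>' T l P g' (exterior_map R \<psi>' S' l N' f' w))"
    using ring_hom_closed[OF f'(1)] comm(2)
    by (intro semilinear_comp[OF exterior_map_semilinear[OF M(1,3) f'] exterior_map_semilinear[OF M(3,4) g']]) auto
next
  fix xs assume xs: "length xs = l" "set xs \<subseteq> carrier M"
  then have "set (map f xs) \<subseteq> carrier N" "set (map f' xs) \<subseteq> carrier N'"
    using semilinear_closed[OF f(2)] semilinear_closed[OF f'(2)] by auto
  moreover have "map (\<lambda>x. g (f x)) xs = map (\<lambda>x. g' (f' x)) xs"
    using xs(2) comm(1) by (intro map_cong) auto
  ultimately show "exterior_map S \<chi> T l P g (exterior_map R \<psi> S l N f (wedge R l M xs)) =
      exterior_map S' \<chi>' T l P g' (exterior_map R \<psi>' S' l N' f' (wedge R l M xs))"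
    using xs by (simp add: exterior_map_wedge[OF M(1,2) f] exterior_map_wedge[OF M(1,3) f']
        exterior_map_wedge[OF M(2,4) g] exterior_map_wedge[OF M(3,4) g'] comp_def
        del: map_eq_conv)
qed

lemma exterior_map_id:
  assumes M: "module R M" and w: "w \<in> carrier (exterior_power R l M)"
  shows "exterior_map R id R l M id w = w"
proof (rule exterior_power_eqI[OF M exterior_power_module[OF M] _ _ _ w])
  show "semilinear R id (exterior_power R l M) (exterior_power R l M) (exterior_map R id R l M id)"
    by (rule exterior_map_semilinear[OF M M id_ring_hom semilinear_id])
  show "semilinear R id (exterior_power R l M) (exterior_power R l M) (\<lambda>w. w)"
    by (simp add: semilinear_def)
  show "exterior_map R id R l M id (wedge R l M xs) = wedge R l M xs"
    if "length xs = l" "set xs \<subseteq> carrier M" for xs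
    using exterior_map_wedge[OF M M id_ring_hom semilinear_id that] by simp
qed

lemma alternating_zero_entry:
  assumes "module R M" "module S N" "alternating R \<psi> l M N h"
    and "length xs = l" "set xs \<subseteq> carrier M" "\<zero>\<^bsub>M\<^esub> \<in> set xs"
  shows "h xs = \<zero>\<^bsub>N\<^esub>"
proof -
  obtain i where i: "i < l" "xs ! i = \<zero>\<^bsub>M\<^esub>" using assms(4,6) by (metis in_set_conv_nth)
  then have "semilinear R \<psi> M N (\<lambda>x. h (xs[i := x]))"
    using assms(3-5) unfolding alternating_def by blast
  \<comment> \<open>Writing xs as its own update at i exhibits h xs as the value at zero of a
    semilinear map.\<close>
  then have "h (xs[i := xs ! i]) = \<zero>\<^bsub>N\<^esub>"
    using semilinear_zero[OF assms(1,2)] i(2) by simp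
  then show ?thesis by simp
qed

text \<open>The retraction is the projection along a complement N'. Over a general ring exterior
  powers can destroy injectivity of an inclusion; a left inverse survives, being expressed by an
  equation between maps.\<close>

lemma direct_summand_retraction:
  assumes L: "module R L" and N: "direct_summand R L N"
  obtains p where "semilinear R id L (L\<lparr>carrier := N\<rparr>) p" "\<And>x. x \<in> N \<Longrightarrow> p x = x"
proof -
  interpret L: module R L by (rule L)
  obtain N' where N: "submodule N R L" and N': "submodule N' R L"
    and int: "N \<inter> N' = {\<zero>\<^bsub>L\<^esub>}" and sum: "N <+>\<^bsub>L\<^esub> N' = carrier L"
    using N unfolding direct_summand_def by blast
  have sub [simp]: "x \<in> N \<Longrightarrow> x \<in> carrier L" "x \<in> N' \<Longrightarrow> x \<in> carrier L" for x
    using submodule_subset[OF N] submodule_subset[OF N'] by auto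
  have ex: "\<exists>y\<in>N. \<exists>y'\<in>N'. x = y \<oplus>\<^bsub>L\<^esub> y'" if "x \<in> carrier L" for x
    using that unfolding sum[symmetric] set_add_def' by blast
  have unique: "y = z" if y: "y \<in> N" "y' \<in> N'" and z: "z \<in> N" "z' \<in> N'"
    and eq: "y \<oplus>\<^bsub>L\<^esub> y' = z \<oplus>\<^bsub>L\<^esub> z'" for y y' z z'
  proof -
    have "y \<oplus>\<^bsub>L\<^esub> \<ominus>\<^bsub>L\<^esub> z = (y \<oplus>\<^bsub>L\<^esub> y') \<oplus>\<^bsub>L\<^esub> \<ominus>\<^bsub>L\<^esub> y' \<oplus>\<^bsub>L\<^esub> \<ominus>\<^bsub>L\<^esub> z"
      using y z by (simp add: L.a_assoc L.r_neg)
    also have "\<dots> = (z \<oplus>\<^bsub>L\<^esub> \<ominus>\<^bsub>L\<^esub> z) \<oplus>\<^bsub>L\<^esub> (z' \<oplus>\<^bsub>L\<^esub> \<ominus>\<^bsub>L\<^esub> y')"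
      unfolding eq using y z by (simp add: L.a_ac)
    also have "\<dots> = z' \<oplus>\<^bsub>L\<^esub> \<ominus>\<^bsub>L\<^esub> y'" using y z by (simp add: L.r_neg)
    finally have "y \<oplus>\<^bsub>L\<^esub> \<ominus>\<^bsub>L\<^esub> z = z' \<oplus>\<^bsub>L\<^esub> \<ominus>\<^bsub>L\<^esub> y'" .
    moreover have "y \<oplus>\<^bsub>L\<^esub> \<ominus>\<^bsub>L\<^esub> z \<in> N" "z' \<oplus>\<^bsub>L\<^esub> \<ominus>\<^bsub>L\<^esub> y' \<in> N'"
      using y z by (auto intro: submodule_add[OF N] submodule_add[OF N'] submodule_a_inv[OF L N]
          submodule_a_inv[OF L N'])
    \<comment> \<open>The element y - z = z' - y' lies in N and in N', whose intersection is zero.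
      This uniqueness makes the \<open>THE\<close> below well defined.\<close>
    ultimately have "y \<oplus>\<^bsub>L\<^esub> \<ominus>\<^bsub>L\<^esub> z = \<zero>\<^bsub>L\<^esub>" using int by auto
    then show "y = z"
      using y z by (metis L.add.inv_closed L.add.inv_equality L.minus_minus sub(1))
  qed
  define p where "p = (\<lambda>x. THE y. y \<in> N \<and> (\<exists>y'\<in>N'. x = y \<oplus>\<^bsub>L\<^esub> y'))"
  have p: "p (y \<oplus>\<^bsub>L\<^esub> y') = y" if "y \<in> N" "y' \<in> N'" for y y'
    unfolding p_def by (rule the_equality) (use that unique in auto)
  have "semilinear R id L (L\<lparr>carrier := N\<rparr>) p"
  proof (rule semilinearI)
    fix x assume "x \<in> carrier L"
    then obtain y y' where x: "y \<in> N" "y' \<in> N'" "x = y \<oplus>\<^bsub>L\<^esub> y'" using ex by blast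
    then show "p x \<in> carrier (L\<lparr>carrier := N\<rparr>)" using p by simp
    fix a assume a: "a \<in> carrier R"
    then have "a \<odot>\<^bsub>L\<^esub> x = a \<odot>\<^bsub>L\<^esub> y \<oplus>\<^bsub>L\<^esub> a \<odot>\<^bsub>L\<^esub> y'" using x by (simp add: L.smult_r_distr)
    then show "p (a \<odot>\<^bsub>L\<^esub> x) = id a \<odot>\<^bsub>L\<lparr>carrier := N\<rparr>\<^esub> p x"
      using p x a submodule_smult[OF N a] submodule_smult[OF N' a] by simp
  next
    fix x z assume "x \<in> carrier L" "z \<in> carrier L"
    then obtain y y' t t' where x: "y \<in> N" "y' \<in> N'" "x = y \<oplus>\<^bsub>L\<^esub> y'"
      and z: "t \<in> N" "t' \<in> N'" "z = t \<oplus>\<^bsub>L\<^esub> t'" using ex by metis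
    have "x \<oplus>\<^bsub>L\<^esub> z = (y \<oplus>\<^bsub>L\<^esub> t) \<oplus>\<^bsub>L\<^esub> (y' \<oplus>\<^bsub>L\<^esub> t')"
      using x z by (simp add: L.a_ac)
    then show "p (x \<oplus>\<^bsub>L\<^esub> z) = p x \<oplus>\<^bsub>L\<lparr>carrier := N\<rparr>\<^esub> p z"
      using p x z submodule_add[OF N] submodule_add[OF N'] by simp
  qed
  moreover have "p x = x" if "x \<in> N" for x
    using p[OF that submodule_zero[OF N']] that by simp
  ultimately show thesis by (rule that)
qed

text \<open>The map f is prescribed only on N, so it may be the literal expression in the wedge
  condition. By naturality the value of its exterior power at w becomes zero in the exterior power
  of L; the exterior power of the retraction then recovers this value itself.\<close>

lemma exterior_power_vanishes_summand:
  assumes L: "module R L" and N: "direct_summand R L N"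
    and g: "semilinear R id L L g" "\<And>x. x \<in> N \<Longrightarrow> g x \<in> N"
    and zero: "\<And>w. w \<in> carrier (exterior_power R l (L\<lparr>carrier := N\<rparr>)) \<Longrightarrow>
      exterior_map R id R l L g (exterior_map R id R l L id w) = \<zero>\<^bsub>exterior_power R l L\<^esub>"
    and f: "\<And>x. x \<in> N \<Longrightarrow> f x = g x"
  shows "exterior_power_vanishes R l (L\<lparr>carrier := N\<rparr>) f"
  unfolding exterior_power_vanishes_def
proof
  let ?N = "L\<lparr>carrier := N\<rparr>"
  fix w assume w: "w \<in> carrier (exterior_power R l ?N)"
  have sub: "submodule N R L" using N by (simp add: direct_summand_def)
  have NM: "module R ?N" by (rule submodule.submodule_is_module[OF sub L])
  have NL: "N \<subseteq> carrier L" by (rule submodule_subset[OF sub])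
  have inc: "semilinear R id ?N L id" using NL by (auto simp: semilinear_def)
  have fN: "semilinear R id ?N ?N f"
    using g f NL L submodule_add[OF sub] submodule_smult[OF sub]
    by (auto intro!: semilinearI simp: semilinear_add[OF g(1)] semilinear_smult[OF g(1)] subset_iff)
  obtain p where p: "semilinear R id L ?N p" "\<And>x. x \<in> N \<Longrightarrow> p x = x"
    using direct_summand_retraction[OF L N] by blast
  let ?fw = "exterior_map R id R l ?N f w"
  have fw: "?fw \<in> carrier (exterior_power R l ?N)"
    by (rule semilinear_closed[OF exterior_map_semilinear[OF NM NM id_ring_hom fN] w])
  have "exterior_map R id R l L id ?fw = exterior_map R id R l L g (exterior_map R id R l L id w)"
    by (rule exterior_map_commute[OF NM NM L L id_ring_hom fN id_ring_hom inc id_ring_hom inc id_ring_hom g(1) _ _ w]) (simp_all add: f)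
  also have "\<dots> = \<zero>\<^bsub>exterior_power R l L\<^esub>" by (rule zero[OF w])
  finally have "exterior_map R id R l ?N p (exterior_map R id R l L id ?fw)
      = exterior_map R id R l ?N p \<zero>\<^bsub>exterior_power R l L\<^esub>" by simp
  also have "\<dots> = \<zero>\<^bsub>exterior_power R l ?N\<^esub>"
    by (rule semilinear_zero[OF exterior_power_module[OF L] exterior_power_module[OF NM]
          exterior_map_semilinear[OF L NM id_ring_hom p(1)]])
  finally have "exterior_map R id R l ?N p (exterior_map R id R l L id ?fw) = \<zero>\<^bsub>exterior_power R l ?N\<^esub>" .
  moreover have "exterior_map R id R l ?N p (exterior_map R id R l L id ?fw)
      = exterior_map R id R l ?N id (exterior_map R id R l ?N id ?fw)"
    by (rule exterior_map_commute[OF NM L NM NM id_ring_hom inc id_ring_hom p(1) id_ring_hom semilinear_id id_ring_hom semilinear_id _ _ fw])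
      (simp_all add: p(2))
  ultimately show "?fw = \<zero>\<^bsub>exterior_power R l ?N\<^esub>"
    using exterior_map_id[OF NM fw] by simp
qed

section \<open>Exterior powers of free modules\<close>

text \<open>Insertion sort moves an entry by exchanging neighbours only, and \<open>swap\<close>
  undoes each exchange. The prefix us lets the induction pass to tails.\<close>

lemma sort_by_adjacent_swaps:
  fixes xs :: "'a::linorder list"
  assumes swap: "\<And>us x y vs. P (us @ x # y # vs) \<Longrightarrow> P (us @ y # x # vs)"
  shows "P (us @ sort xs) \<Longrightarrow> P (us @ xs)"
proof (induction xs arbitrary: us)
  case (Cons a xs)
  have insort: "P (us @ insort a ys) \<Longrightarrow> P (us @ a # ys)" for us ys
  proof (induction ys arbitrary: us)
    case (Cons c ys)
    show ?case
    proof (cases "a \<le> c")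
      case False
      then have "P ((us @ [c]) @ insort a ys)" using Cons.prems by simp
      from Cons.IH[OF this] show ?thesis using swap[of us c a ys] by simp
    qed (use Cons.prems in simp)
  qed simp
  have "P ((us @ [a]) @ sort xs)" using insort[of us "sort xs"] Cons.prems by simp
  from Cons.IH[OF this] show ?case by simp
qed simp

text \<open>Polarization: expanding the value at equal neighbours x + y, x + y leaves only the two
  mixed terms, which therefore cancel.\<close>

lemma alternating_swap:
  assumes "module R M" "module S N" "alternating R \<psi> l M N h"
    and l: "length us + length vs + 2 = l"
    and cl: "set us \<subseteq> carrier M" "set vs \<subseteq> carrier M" "x \<in> carrier M" "y \<in> carrier M"
  shows "h (us @ y # x # vs) = \<ominus>\<^bsub>N\<^esub> h (us @ x # y # vs)"
proof -
  interpret M: module R M by fact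
  interpret N: module S N by fact
  define B where "B = (\<lambda>u v. h (us @ u # v # vs))"
  have left: "semilinear R \<psi> M N (\<lambda>u. B u v)" if v: "v \<in> carrier M" for v
  proof -
    let ?xs = "us @ v # v # vs"
    have "length ?xs = l" "set ?xs \<subseteq> carrier M" "length us < l" using l cl v by auto
    with assms(3) have "semilinear R \<psi> M N (\<lambda>u. h (?xs[length us := u]))"
      unfolding alternating_def by blast
    then show ?thesis by (simp add: B_def)
  qed
  have right: "semilinear R \<psi> M N (\<lambda>v. B u v)" if u: "u \<in> carrier M" for u
  proof -
    let ?xs = "us @ u # u # vs"
    have "length ?xs = l" "set ?xs \<subseteq> carrier M" "Suc (length us) < l" using l cl u by auto
    with assms(3) have "semilinear R \<psi> M N (\<lambda>v. h (?xs[Suc (length us) := v]))"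
      unfolding alternating_def by blast
    moreover have "?xs[Suc (length us) := v] = us @ u # v # vs" for v
      by (simp add: list_update_append)
    ultimately show ?thesis by (simp add: B_def)
  qed
  have diag: "B u u = \<zero>\<^bsub>N\<^esub>" if u: "u \<in> carrier M" for u
  proof -
    let ?xs = "us @ u # u # vs"
    have "length ?xs = l" "set ?xs \<subseteq> carrier M" "Suc (length us) < l" using l cl u by auto
    moreover have "?xs ! length us = ?xs ! Suc (length us)" by (simp add: nth_append)
    ultimately show ?thesis
      using assms(3) unfolding alternating_def B_def by (metis lessI)
  qed
  note c = semilinear_closed[OF right]
  have "\<zero>\<^bsub>N\<^esub> = B (x \<oplus>\<^bsub>M\<^esub> y) (x \<oplus>\<^bsub>M\<^esub> y)" using diag cl by simp
  also have "\<dots> = (B x x \<oplus>\<^bsub>N\<^esub> B y x) \<oplus>\<^bsub>N\<^esub> (B x y \<oplus>\<^bsub>N\<^esub> B y y)"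
    using cl semilinear_add[OF right, of "x \<oplus>\<^bsub>M\<^esub> y" x y] semilinear_add[OF left[OF cl(3)], of x y]
      semilinear_add[OF left[OF cl(4)], of x y] by simp
  also have "\<dots> = B y x \<oplus>\<^bsub>N\<^esub> B x y" using cl c diag by simp
  finally have "B y x = \<ominus>\<^bsub>N\<^esub> B x y"
    using cl c by (metis N.minus_equality)
  then show ?thesis by (simp add: B_def)
qed

text \<open>These lists encode the l-element subsets of \<open>{..<d}\<close>, the usual index set
  for a basis of the l-th exterior power of a free module of rank d.\<close>

definition increasing_lists :: "nat \<Rightarrow> nat \<Rightarrow> nat list set" where
  "increasing_lists d l = {ks. length ks = l \<and> set ks \<subseteq> {..<d} \<and> sorted ks \<and> distinct ks}"

text \<open>Spanning is phrased through arbitrary submodules on both levels, so that no finite sums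
  have to be expanded: each entry of a wedge is handled by the preimage of K under the map that
  varies this entry. Rearranging basis vectors costs only a sign, and a repeated one gives
  zero.\<close>

lemma exterior_power_spanned_by_increasing:
  assumes M: "module R M"
    and b: "\<And>k. k < d \<Longrightarrow> b k \<in> carrier M"
    and span: "\<And>K. submodule K R M \<Longrightarrow> (\<And>k. k < d \<Longrightarrow> b k \<in> K) \<Longrightarrow> carrier M \<subseteq> K"
    and K: "submodule K R (exterior_power R l M)"
    and gens: "\<And>ks. ks \<in> increasing_lists d l \<Longrightarrow> wedge R l M (map b ks) \<in> K"
    and z: "z \<in> carrier (exterior_power R l M)"
  shows "z \<in> K"
proof -
  note E = exterior_power_module[OF M, where l = l]
  note alt = wedge_alternating[OF M, where l = l]
  have sl: "semilinear R id M (exterior_power R l M) (\<lambda>x. wedge R l M (xs[i := x]))"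
    if "length xs = l" "set xs \<subseteq> carrier M" "i < l" for xs i
    using alt that unfolding alternating_def by blast
  \<comment> \<open>The side conditions on ks are part of the property, so that it makes sense for
    all lists, as sorting by swaps requires.\<close>
  let ?P = "\<lambda>ks. length ks = l \<and> set ks \<subseteq> {..<d} \<longrightarrow> wedge R l M (map b ks) \<in> K"
  have basis_lists: "?P ks" for ks
  proof -
    have swap: "?P (us @ x # y # vs) \<Longrightarrow> ?P (us @ y # x # vs)" for us x y vs
    proof (intro impI)
      assume *: "?P (us @ x # y # vs)" and **: "length (us @ y # x # vs) = l \<and> set (us @ y # x # vs) \<subseteq> {..<d}"
      have "wedge R l M (map b us @ b y # b x # map b vs)
          = \<ominus>\<^bsub>exterior_power R l M\<^esub> wedge R l M (map b us @ b x # b y # map b vs)"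
        using ** b by (intro alternating_swap[OF M E alt]) auto
      then show "wedge R l M (map b (us @ y # x # vs)) \<in> K"
        using * ** submodule_a_inv[OF E K] by simp
    qed
    have "?P (sort ks)"
    proof (intro impI)
      assume ks: "length (sort ks) = l \<and> set (sort ks) \<subseteq> {..<d}"
      show "wedge R l M (map b (sort ks)) \<in> K"
      proof (cases "distinct (sort ks)")
        case True
        then show ?thesis using ks by (intro gens) (simp add: increasing_lists_def)
      next
        case False
        then obtain i j where ij: "i < l" "j < l" "i \<noteq> j" "sort ks ! i = sort ks ! j"
          using ks unfolding distinct_conv_nth by auto
        have "\<exists>i j. i < j \<and> j < l \<and> map b (sort ks) ! i = map b (sort ks) ! j"
        proof (cases "i < j")
          case True
          then show ?thesis using ij ks by (intro exI[of _ i] exI[of _ j]) simp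
        next
          case False
          then show ?thesis using ij ks by (intro exI[of _ j] exI[of _ i]) simp
        qed
        moreover have "length (map b (sort ks)) = l" "set (map b (sort ks)) \<subseteq> carrier M"
          using ks b by auto
        ultimately have "wedge R l M (map b (sort ks)) = \<zero>\<^bsub>exterior_power R l M\<^esub>"
          using alt unfolding alternating_def by blast
        then show ?thesis using submodule_zero[OF K] by simp
      qed
    qed
    then show ?thesis using sort_by_adjacent_swaps[of ?P "[]" ks, OF swap] by simp
  qed
  \<comment> \<open>The number m counts the leading entries that may be arbitrary; all later ones
    are basis vectors. At m = l this is no restriction.\<close>
  have "wedge R l M xs \<in> K" if "length xs = l" "set xs \<subseteq> carrier M" "\<And>i. m \<le> i \<Longrightarrow> i < l \<Longrightarrow> xs ! i \<in> b ` {..<d}"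
    "m \<le> l" for xs m
    using that
  proof (induction m arbitrary: xs)
    case 0
    then have "set xs \<subseteq> b ` {..<d}" by (auto simp: set_conv_nth)
    then have "xs \<in> lists (b ` {..<d})" by auto
    then obtain ks where "set ks \<subseteq> {..<d}" "xs = map b ks" unfolding lists_image by auto
    then show ?case using basis_lists[of ks] 0(1) by simp
  next
    case (Suc m)
    let ?f = "\<lambda>x. wedge R l M (xs[m := x])"
    have "submodule {x \<in> carrier M. ?f x \<in> K} R M"
      using Suc.prems by (intro semilinear_vimage_submodule[OF M E sl _ K]) auto
    moreover have "?f (b k) \<in> K" if k: "k < d" for k
    proof (rule Suc.IH)
      show "set (xs[m := b k]) \<subseteq> carrier M"
        using set_update_subset_insert[of xs m "b k"] Suc.prems(2) b[OF k] by blast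
      fix i assume "m \<le> i" "i < l"
      then show "xs[m := b k] ! i \<in> b ` {..<d}"
        using Suc.prems k by (cases "i = m") auto
    qed (use Suc.prems in auto)
    ultimately have "carrier M \<subseteq> {x \<in> carrier M. ?f x \<in> K}"
      using b by (intro span) auto
    moreover have "xs ! m \<in> carrier M" using Suc.prems nth_mem[of m xs] by auto
    ultimately have "?f (xs ! m) \<in> K" by blast
    then show ?case by simp
  qed
  from this[where m = l] show ?thesis
    by (intro exterior_power_induct[OF M K _ z]) auto
qed

section \<open>The base ring as a module, and determinant forms with values in it\<close>

lemma ring_as_module_simps [simp]:
  "carrier (ring_as_module R) = carrier R"
  "\<zero>\<^bsub>ring_as_module R\<^esub> = \<zero>\<^bsub>R\<^esub>"
  "x \<oplus>\<^bsub>ring_as_module R\<^esub> y = x \<oplus>\<^bsub>R\<^esub> y"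
  "a \<odot>\<^bsub>ring_as_module R\<^esub> x = a \<otimes>\<^bsub>R\<^esub> x"
  by (simp_all add: ring_as_module_def)

lemma ring_as_module_module:
  assumes "cring R"
  shows "module R (ring_as_module R)"
proof -
  interpret R: cring R by fact
  have "abelian_group (ring_as_module R)"
  proof (rule abelian_groupI)
    fix x assume "x \<in> carrier (ring_as_module R)"
    then show "\<exists>y\<in>carrier (ring_as_module R). y \<oplus>\<^bsub>ring_as_module R\<^esub> x = \<zero>\<^bsub>ring_as_module R\<^esub>"
      using R.l_neg R.a_inv_closed by auto
  qed (auto simp: R.a_ac)
  then show ?thesis
    by (intro moduleI assms) (auto simp: R.l_distr R.r_distr R.m_assoc)
qed

lemma ring_of_type_algebra_simps [simp]:
  "carrier (ring_of_type_algebra :: 'a::ring_1 ring) = UNIV"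
  "x \<otimes>\<^bsub>(ring_of_type_algebra :: 'a::ring_1 ring)\<^esub> y = x * y"
  "\<one>\<^bsub>(ring_of_type_algebra :: 'a::ring_1 ring)\<^esub> = 1"
  "x \<oplus>\<^bsub>(ring_of_type_algebra :: 'a::ring_1 ring)\<^esub> y = x + y"
  "\<zero>\<^bsub>(ring_of_type_algebra :: 'a::ring_1 ring)\<^esub> = 0"
  by (simp_all add: ring_of_type_algebra_def)

text \<open>The Leibniz formula for the determinant of the matrix with entry
  \<open>e (T ! j) (xs ! i)\<close> in row j and column i. If the e k are dual to a basis and T is
  increasing, it is the coordinate at T of the wedge of xs.\<close>

definition det_form :: "nat \<Rightarrow> (nat \<Rightarrow> 'm \<Rightarrow> 'f::field) \<Rightarrow> nat list \<Rightarrow> 'm list \<Rightarrow> 'f" where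
  "det_form l e T xs =
     (\<Sum>p | p permutes {..<l}. of_int (sign p) * (\<Prod>i<l. e (T ! p i) (xs ! i)))"

text \<open>Composing each permutation with the transposition of i and j flips its sign and, as the
  two entries agree, keeps its product. Hence the form equals its negative, and it vanishes because
  2 is nonzero.\<close>

lemma det_form_identical:
  assumes "i < j" "j < l" "xs ! i = xs ! j" "(2::'f::field) \<noteq> 0"
  shows "det_form l e T xs = (0::'f)"
proof -
  let ?t = "transpose i j"
  let ?P = "{p. p permutes {..<l}}"
  let ?f = "\<lambda>p. of_int (sign p) * (\<Prod>i<l. e (T ! p i) (xs ! i))"
  have t: "?t permutes {..<l}" using assms by (intro permutes_swap_id) auto
  have xs: "xs ! ?t k = xs ! k" for k using assms(3) by (auto simp: transpose_def)
  have "det_form l e T xs = (\<Sum>p\<in>?P. ?f (p \<circ> ?t))"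
    unfolding det_form_def by (rule sum_permutations_compose_right[OF t])
  also have "\<dots> = (\<Sum>p\<in>?P. - ?f p)"
  proof (rule sum.cong[OF refl])
    fix p assume p: "p \<in> ?P"
    then have "permutation p" "permutation ?t"
      using t permutation_permutes by blast+
    then have "sign (p \<circ> ?t) = - sign p"
      using assms(1) by (simp add: sign_compose sign_swap_id)
    moreover have "(\<Prod>k<l. e (T ! p (?t k)) (xs ! k)) = (\<Prod>k<l. e (T ! p k) (xs ! k))"
      using prod.permute[OF t, of "\<lambda>k. e (T ! p k) (xs ! k)"] by (simp add: comp_def xs)
    ultimately show "?f (p \<circ> ?t) = - ?f p" by simp
  qed
  also have "\<dots> = - det_form l e T xs"
    by (simp add: det_form_def sum_negf)
  finally have "2 * det_form l e T xs = 0" by simp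
  then show ?thesis using assms(4) by simp
qed

text \<open>A term survives only if T ! p i = S ! i for all i. Then S and T have the same entries,
  so they are equal as increasing lists, and distinctness of the entries leaves only p = id.\<close>

lemma det_form_dual:
  assumes e: "\<And>j k. j < d \<Longrightarrow> k < d \<Longrightarrow> e j (b k) = (if j = k then 1 else (0::'f::field))"
    and S: "S \<in> increasing_lists d l" and T: "T \<in> increasing_lists d l"
  shows "det_form l e T (map b S) = (if S = T then 1 else 0)"
proof -
  have lS: "length S = l" "\<And>i. i < l \<Longrightarrow> S ! i < d" and lT: "length T = l" "\<And>i. i < l \<Longrightarrow> T ! i < d"
    using S T nth_mem[of _ S] nth_mem[of _ T] by (force simp: increasing_lists_def)+
  have pl: "p i < l" if "p permutes {..<l}" "i < l" for p i
    using permutes_in_image[OF that(1)] that(2) by blast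
  have zero: "(\<Prod>i<l. e (T ! p i) (map b S ! i)) = 0"
    if p: "p permutes {..<l}" and i: "i < l" "T ! p i \<noteq> S ! i" for p i
    using i lS lT pl[OF p] e by (intro prod_zero) auto
  have id: "S = T \<and> p = id" if p: "p permutes {..<l}" and all: "\<And>i. i < l \<Longrightarrow> T ! p i = S ! i" for p
  proof -
    have "set S \<subseteq> set T"
      using all pl[OF p] lS lT by (metis in_set_conv_nth subsetI)
    moreover have "card (set S) = card (set T)"
      using S T by (simp add: increasing_lists_def distinct_card)
    ultimately have "set S = set T" by (simp add: card_subset_eq)
    then have "S = T"
      using S T by (intro sorted_distinct_set_unique) (auto simp: increasing_lists_def)
    moreover have "p i = i" for i
    proof (cases "i < l")
      case True
      then show ?thesis
        using all[OF True] pl[OF p True] T \<open>S = T\<close> by (simp add: increasing_lists_def nth_eq_iff_index_eq)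
    next
      case False
      then show ?thesis using p by (simp add: permutes_def)
    qed
    ultimately show ?thesis by (simp add: fun_eq_iff)
  qed
  have one: "(\<Prod>i<l. e (T ! id i) (map b T ! i)) = 1"
    using lT e by (intro prod.neutral) auto
  have "det_form l e T (map b S) =
      (\<Sum>p\<in>{p. p permutes {..<l}}. if p = id then (if S = T then 1 else 0) else 0)"
    unfolding det_form_def
  proof (rule sum.cong[OF refl])
    fix p assume "p \<in> {p. p permutes {..<l}}"
    then have p: "p permutes {..<l}" by simp
    show "of_int (sign p) * (\<Prod>i<l. e (T ! p i) (map b S ! i)) =
        (if p = id then (if S = T then 1 else 0) else 0)"
    proof (cases "\<forall>i<l. T ! p i = S ! i")
      case True
      then have "S = T" "p = id" using id[OF p] by auto
      then show ?thesis using one by simp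
    next
      case False
      then obtain i where "i < l" "T ! p i \<noteq> S ! i" by blast
      moreover from this have "\<not> (S = T \<and> p = id)" by auto
      ultimately show ?thesis using zero[OF p] by auto
    qed
  qed
  also have "\<dots> = (if S = T then 1 else 0)"
    by (simp add: finite_permutations permutes_id)
  finally show ?thesis .
qed

lemma det_form_alternating:
  fixes e :: "nat \<Rightarrow> 'm \<Rightarrow> 'f::field" and V :: "('f, 'm, 'y) module_scheme"
  defines "F \<equiv> (ring_of_type_algebra :: 'f ring)"
  assumes e: "\<And>k. k < d \<Longrightarrow> semilinear F id V (ring_as_module F) (e k)"
    and T: "length T = l" "set T \<subseteq> {..<d}" and two: "(2::'f) \<noteq> 0"
  shows "alternating F id l V (ring_as_module F) (det_form l e T)"
  unfolding alternating_def
proof (intro allI impI conjI)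
  fix xs :: "'m list" and i j assume "i < j" "j < l" "xs ! i = xs ! j"
  then show "det_form l e T xs = \<zero>\<^bsub>ring_as_module F\<^esub>"
    using det_form_identical[OF _ _ _ two] by (simp add: F_def)
next
  fix xs :: "'m list" and i assume xs: "length xs = l" "set xs \<subseteq> carrier V" and i: "i < l"
  \<comment> \<open>In each Leibniz term the i-th entry occurs in exactly one factor; C p collects
    the sign and the other factors. This makes linearity in that entry visible.\<close>
  define C where "C p = of_int (sign p) * (\<Prod>j\<in>{..<l} - {i}. e (T ! p j) (xs ! j))" for p
  have upd: "det_form l e T (xs[i := x]) = (\<Sum>p | p permutes {..<l}. C p * e (T ! p i) x)" for x
  proof -
    have "(\<Prod>j<l. e (T ! p j) (xs[i := x] ! j)) =
        e (T ! p i) x * (\<Prod>j\<in>{..<l} - {i}. e (T ! p j) (xs ! j))" for p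
      using i xs(1) by (subst prod.remove[of _ i]) auto
    then show ?thesis unfolding det_form_def C_def by (simp add: mult_ac)
  qed
  have e': "semilinear F id V (ring_as_module F) (e (T ! p i))" if "p permutes {..<l}" for p
  proof (rule e)
    have "p i < length T" using permutes_in_image[OF that, of i] i T(1) by simp
    then show "T ! p i < d" using T(2) nth_mem by blast
  qed
  show "semilinear F id V (ring_as_module F) (\<lambda>x. det_form l e T (xs[i := x]))"
    unfolding upd
  proof (rule semilinearI)
    fix x y assume "x \<in> carrier V" "y \<in> carrier V"
    then show "(\<Sum>p | p permutes {..<l}. C p * e (T ! p i) (x \<oplus>\<^bsub>V\<^esub> y)) =
      (\<Sum>p | p permutes {..<l}. C p * e (T ! p i) x) \<oplus>\<^bsub>ring_as_module F\<^esub>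
      (\<Sum>p | p permutes {..<l}. C p * e (T ! p i) y)"
      by (simp add: semilinear_add[OF e'] F_def[symmetric])
        (simp add: F_def distrib_left sum.distrib)
  next
    fix a x assume "a \<in> carrier F" "x \<in> carrier V"
    then show "(\<Sum>p | p permutes {..<l}. C p * e (T ! p i) (a \<odot>\<^bsub>V\<^esub> x)) =
      id a \<odot>\<^bsub>ring_as_module F\<^esub> (\<Sum>p | p permutes {..<l}. C p * e (T ! p i) x)"
      by (simp add: semilinear_smult[OF e'])
        (simp add: F_def sum_distrib_left mult_ac)
  qed (simp add: F_def)
qed (simp add: F_def)

text \<open>The coefficients of an element with respect to the wedges of increasing lists of basis vectors
  are recovered by the determinant forms of the dual basis, which already live on \<open>V\<close>.\<close>

lemma exterior_map_injective:
  fixes e :: "nat \<Rightarrow> 'v \<Rightarrow> 'f::field" and V :: "('f, 'v, 'y) module_scheme"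
  defines "F \<equiv> (ring_of_type_algebra :: 'f ring)"
  assumes L: "module R L" and V: "module F V" and \<psi>: "\<psi> \<in> ring_hom R F"
    and inj: "\<And>a. a \<in> carrier R \<Longrightarrow> \<psi> a = 0 \<Longrightarrow> a = \<zero>\<^bsub>R\<^esub>"
    and \<iota>: "semilinear R \<psi> L V \<iota>"
    and b: "\<And>k. k < d \<Longrightarrow> b k \<in> carrier L"
    and span: "\<And>K. submodule K R L \<Longrightarrow> (\<And>k. k < d \<Longrightarrow> b k \<in> K) \<Longrightarrow> carrier L \<subseteq> K"
    and e: "\<And>k. k < d \<Longrightarrow> semilinear F id V (ring_as_module F) (e k)"
    and dual: "\<And>j k. j < d \<Longrightarrow> k < d \<Longrightarrow> e j (\<iota> (b k)) = (if j = k then 1 else 0)"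
    and two: "(2::'f) \<noteq> 0"
    and z: "z \<in> carrier (exterior_power R l L)"
      "exterior_map R \<psi> F l V \<iota> z = \<zero>\<^bsub>exterior_power F l V\<^esub>"
  shows "z = \<zero>\<^bsub>exterior_power R l L\<^esub>"
proof -
  let ?E = "exterior_power R l L" and ?G = "increasing_lists d l"
  let ?h = "\<lambda>ks. wedge R l L (map b ks)"
  have R: "cring R" using L by (rule module_cring)
  have F: "cring F" using V by (rule module_cring)
  note E = exterior_power_module[OF L, where l = l]
  note EV = exterior_power_module[OF V, where l = l]
  note FM = ring_as_module_module[OF F]
  have bG: "length (map b ks) = l" "set (map b ks) \<subseteq> carrier L" if "ks \<in> ?G" for ks
    using that b by (auto simp: increasing_lists_def)
  have h: "?h \<in> ?G \<rightarrow> carrier ?E" using wedge_closed[OF L] bG by blast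
  have id: "id \<in> ring_hom R R" by (simp add: ring_hom_def)
  note f = linear_extension_semilinear[OF R E id h]
  note fg = linear_extension_gen[OF R E id h]
  \<comment> \<open>Independence of the wedges of increasing lists is not known at this point. So z
    is written as a combination with some coefficients c, and these are then shown to
    vanish.\<close>
  have "z \<in> linear_extension R id ?E ?h ` carrier (free_module R ?G)"
  proof (rule exterior_power_spanned_by_increasing[OF L b span
        semilinear_range_submodule[OF free_module_module[OF R] E f] _ z(1)])
    fix ks assume "ks \<in> ?G"
    then show "?h ks \<in> linear_extension R id ?E ?h ` carrier (free_module R ?G)"
      using fg free_gen_closed[OF R] by (metis image_eqI)
  qed
  then obtain c where c: "c \<in> carrier (free_module R ?G)" "z = linear_extension R id ?E ?h c" by blast
  have "c T = \<zero>\<^bsub>R\<^esub>" for T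
  proof (cases "T \<in> ?G")
    case T: True
    let ?D = "presented_map F id (ring_as_module F) (det_form l e T)"
    let ?\<Phi> = "\<lambda>c. ?D (exterior_map R \<psi> F l V \<iota> (linear_extension R id ?E ?h c))"
    have alt: "alternating F id l V (ring_as_module F) (det_form l e T)"
      using det_form_alternating[OF e[unfolded F_def] _ _ two] T by (simp add: increasing_lists_def F_def)
    have idF: "id \<in> ring_hom F F" by (simp add: ring_hom_def)
    note D = exterior_lift_semilinear[OF V FM idF alt]
    note m = exterior_map_semilinear[OF L V \<psi> \<iota>, where l = l]
    have \<Phi>: "semilinear R \<psi> (free_module R ?G) (ring_as_module F) ?\<Phi>"
      using ring_hom_closed[OF \<psi>]
      by (intro semilinear_comp[OF semilinear_comp[OF f m] D, where \<psi> = \<psi>]) auto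
    have ev: "semilinear R \<psi> (free_module R ?G) (ring_as_module F) (\<lambda>c. \<psi> (c T))"
      using ring_hom_closed[OF \<psi>] free_module_closed[OF R, of _ ?G T]
      by (intro semilinearI) (auto simp: ring_hom_add[OF \<psi>] ring_hom_mult[OF \<psi>])
    \<comment> \<open>Both sides are semilinear along \<psi> in c, so duality on the generators S is
      enough. For the c that represents z the left side is the form at 0.\<close>
    have "c \<in> {c \<in> carrier (free_module R ?G). ?\<Phi> c = \<psi> (c T)}"
    proof (rule free_module_induct[OF R semilinear_equalizer_submodule[OF free_module_module[OF R] FM \<Phi> ev] _ c(1)])
      fix S assume S: "S \<in> ?G"
      have "?\<Phi> (free_gen R S) = ?D (wedge F l V (map \<iota> (map b S)))"
        unfolding fg[OF S] exterior_map_wedge[OF L V \<psi> \<iota> bG[OF S]] ..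
      also have "\<dots> = det_form l e T (map \<iota> (map b S))"
        using bG[OF S] semilinear_closed[OF \<iota>]
        by (intro exterior_lift_wedge[OF V FM idF alt]) auto
      also have "\<dots> = (if S = T then 1 else 0)"
        using det_form_dual[of d e "\<lambda>k. \<iota> (b k)", OF dual S T] by (simp add: comp_def)
      also have "\<dots> = \<psi> (free_gen R S T)"
        using ring_hom_one[OF \<psi>] ring_hom_zero_cring[OF R F \<psi>] by (auto simp: free_gen_def F_def)
      finally show "free_gen R S \<in> {c \<in> carrier (free_module R ?G). ?\<Phi> c = \<psi> (c T)}"
        using free_gen_closed[OF R S] by simp
    qed
    then have "\<psi> (c T) = ?D \<zero>\<^bsub>exterior_power F l V\<^esub>" using c(2) z(2) by simp
    also have "\<dots> = 0" using semilinear_zero[OF EV FM D] by (simp add: F_def)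
    finally show ?thesis using inj free_module_closed[OF R c(1)] by blast
  next
    case False
    then show ?thesis using c(1) by (auto simp: free_module_carrier)
  qed
  then have "c = \<zero>\<^bsub>free_module R ?G\<^esub>" by auto
  then show ?thesis
    using c(2) semilinear_zero[OF free_module_module[OF R] E f] by simp
qed

section \<open>Scalars and coordinates in the ramified extension\<close>

lemma ring_of_type_algebra_a_inv [simp]:
  "\<ominus>\<^bsub>(ring_of_type_algebra :: 'a::comm_ring_1 ring)\<^esub> x = - x"
proof -
  interpret F: cring "ring_of_type_algebra :: 'a ring" by (rule cring_from_type_algebra)
  show ?thesis by (rule F.minus_equality) auto
qed

context ramified_quadratic
begin

lemma F_cring: "cring F_ring"
  by (rule cring_from_type_algebra)

lemma F0_subring: "subring F0 F_ring"
  by (rule subfieldE(1)[OF subfield_F0])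

lemma F0_closed:
  "1 \<in> F0" "0 \<in> F0" "a \<in> F0 \<Longrightarrow> - a \<in> F0"
  "a \<in> F0 \<Longrightarrow> b \<in> F0 \<Longrightarrow> a + b \<in> F0" "a \<in> F0 \<Longrightarrow> b \<in> F0 \<Longrightarrow> a - b \<in> F0"
  "a \<in> F0 \<Longrightarrow> b \<in> F0 \<Longrightarrow> a * b \<in> F0"
proof -
  show 1: "1 \<in> F0" "0 \<in> F0" "a \<in> F0 \<Longrightarrow> - a \<in> F0" "a \<in> F0 \<Longrightarrow> b \<in> F0 \<Longrightarrow> a * b \<in> F0"
    "a \<in> F0 \<Longrightarrow> b \<in> F0 \<Longrightarrow> a + b \<in> F0" for a b
    using subringE[OF F0_subring] by auto
  show "a \<in> F0 \<Longrightarrow> b \<in> F0 \<Longrightarrow> a - b \<in> F0"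
    using 1(3)[of b] 1(5)[of a "- b"] by simp
qed

lemma F0_inverse: "a \<in> F0 \<Longrightarrow> inverse a \<in> F0"
proof (cases "a = 0")
  case False
  interpret F: field F_ring by (rule field_from_type_algebra)
  assume "a \<in> F0"
  then have "inv\<^bsub>F_ring\<^esub> a \<in> F0"
    using F.subfield_m_inv(1)[OF subfield_F0, of a] False by auto
  moreover have "inv\<^bsub>F_ring\<^esub> a = inverse a"
    using False by (intro F.comm_inv_char) auto
  ultimately show ?thesis by simp
qed (simp add: F0_closed)

lemma v_one: "v 1 = 0"
  using v_mult[of 1 1] by simp

lemma v_minus: "x \<noteq> 0 \<Longrightarrow> v (- x) = v x"
  using v_mult[of "-1" "-1"] v_mult[of "-1" x] v_one by simp

lemma OF_closed:
  "1 \<in> OF" "0 \<in> OF" "a \<in> OF \<Longrightarrow> - a \<in> OF" "a \<in> OF \<Longrightarrow> b \<in> OF \<Longrightarrow> a * b \<in> OF"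
  "a \<in> OF \<Longrightarrow> b \<in> OF \<Longrightarrow> a + b \<in> OF" "\<pi> \<in> OF"
proof -
  show "1 \<in> OF" "0 \<in> OF" "\<pi> \<in> OF" "a \<in> OF \<Longrightarrow> - a \<in> OF"
    using v_one uniformizer v_minus[of a] by (auto simp: OF_def)
  show "a \<in> OF \<Longrightarrow> b \<in> OF \<Longrightarrow> a * b \<in> OF"
    using v_mult[of a b] by (auto simp: OF_def)
  show "a \<in> OF \<Longrightarrow> b \<in> OF \<Longrightarrow> a + b \<in> OF"
    using v_add[of a b] by (cases "a = 0"; cases "b = 0"; cases "a + b = 0") (auto simp: OF_def)
qed

lemma subring_cring: "subring A F_ring \<Longrightarrow> cring (F_ring\<lparr>carrier := A\<rparr>)"
  using cring.subcringI'[OF F_cring] ring.subcring_iff[OF cring.axioms(1)[OF F_cring]] by simp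

lemma OF_subring: "subring OF F_ring"
  using OF_closed by (intro ring.subringI[OF cring.axioms(1)[OF F_cring]]) auto

lemma OF_cring: "cring OF_ring"
  unfolding OF_ring_def by (rule subring_cring[OF OF_subring])

lemma F0_cring: "cring F0_ring"
  by (rule subring_cring[OF F0_subring])

lemma OF0_cring: "cring OF0_ring"
  unfolding OF0_ring_def using OF_closed F0_closed
  by (intro subring_cring ring.subringI[OF cring.axioms(1)[OF F_cring]]) auto

section \<open>The basis 1, \<pi> of F over F0\<close>

lemma pi_notin_F0: "\<pi> \<notin> F0"
  using uniformizer uniformizer_F0(2)[of \<pi>] by auto

text \<open>The pair 1, \<pi> is independent over F0, hence spans F, which has dimension 2: from 1 =
  k \<pi> with k in F0 it would follow that \<pi> lies in F0, although its valuation is odd.\<close>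

lemma decomposition: "\<exists>a\<in>F0. \<exists>b\<in>F0. x = a + \<pi> * b"
proof -
  interpret F: field F_ring by (rule field_from_type_algebra)
  have "\<pi> \<notin> F.Span F0 []" using uniformizer by simp
  moreover have "1 \<notin> F.Span F0 [\<pi>]"
  proof
    assume "1 \<in> F.Span F0 [\<pi>]"
    then obtain k where k: "k \<in> F0" "1 = k * \<pi>"
      by (auto simp: F.line_extension_mem_iff)
    then have "\<pi> = inverse k" using uniformizer by (metis inverse_unique)
    then show False using F0_inverse[OF k(1)] pi_notin_F0 by simp
  qed
  ultimately have "F.independent F0 [1, \<pi>]"
    by (intro F.li_Cons F.li_Nil) auto
  then have "F.Span F0 [1, \<pi>] = UNIV"
    using F.independent_length_eq_dimension[OF subfield_F0 degree_2, of "[1, \<pi>]"] by simp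
  then have "x \<in> F.Span F0 [1, \<pi>]" by simp
  then obtain a b where "a \<in> F0" "b \<in> F0" "x = a + b * \<pi>"
    by (auto simp: F.line_extension_mem_iff)
  then show ?thesis by (metis mult.commute)
qed

lemma decomposition_unique:
  assumes "a \<in> F0" "b \<in> F0" "a' \<in> F0" "b' \<in> F0" "a + \<pi> * b = a' + \<pi> * b'"
  shows "a = a' \<and> b = b'"
proof -
  have eq: "a - a' = \<pi> * (b' - b)" using assms(5) by (simp add: algebra_simps)
  have "b' = b"
  proof (rule ccontr)
    assume "b' \<noteq> b"
    then have "\<pi> = (a - a') * inverse (b' - b)" using eq by simp
    then show False using assms pi_notin_F0 F0_closed F0_inverse by metis
  qed
  then show ?thesis using eq by simp
qed

text \<open>The Boolean selects the coefficient of \<pi> (\<open>True\<close>) or of 1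
  (\<open>False\<close>), so that the parity of a basis index can be passed directly.\<close>

definition coord :: "bool \<Rightarrow> 'f \<Rightarrow> 'f" where
  "coord c x = (THE a. \<exists>b\<in>F0. a \<in> F0 \<and> x = (if c then b + \<pi> * a else a + \<pi> * b))"

lemma coord_eq:
  assumes "a \<in> F0" "b \<in> F0"
  shows "coord False (a + \<pi> * b) = a" "coord True (a + \<pi> * b) = b"
  unfolding coord_def using assms
  by (auto intro!: the_equality dest: decomposition_unique[OF _ _ assms] decomposition_unique[OF assms])

lemma coord_linear:
  "coord c (x + y) = coord c x + coord c y"
  "k \<in> F0 \<Longrightarrow> coord c (k * x) = k * coord c x"
proof -
  obtain a b where x: "a \<in> F0" "b \<in> F0" "x = a + \<pi> * b" using decomposition by blast
  obtain a' b' where y: "a' \<in> F0" "b' \<in> F0" "y = a' + \<pi> * b'" using decomposition by blast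
  have cx: "coord c x = (if c then b else a)" and cy: "coord c y = (if c then b' else a')"
    using coord_eq x y by auto
  have "x + y = (a + a') + \<pi> * (b + b')" using x y by (simp add: algebra_simps)
  then have "coord c (x + y) = (if c then b + b' else a + a')"
    using coord_eq F0_closed(4)[OF x(1) y(1)] F0_closed(4)[OF x(2) y(2)] by simp
  then show "coord c (x + y) = coord c x + coord c y"
    using cx cy by simp
  assume k: "k \<in> F0"
  have "k * x = k * a + \<pi> * (k * b)" using x by (simp add: algebra_simps)
  then have "coord c (k * x) = (if c then k * b else k * a)"
    using coord_eq F0_closed(6)[OF k x(1)] F0_closed(6)[OF k x(2)] by simp
  then show "coord c (k * x) = k * coord c x"
    using cx by simp
qed

lemma coord_basis:
  "coord False 1 = 1" "coord True 1 = 0" "coord False \<pi> = 0" "coord True \<pi> = 1"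
  using coord_eq[of 1 0] coord_eq[of 0 1] F0_closed by auto

text \<open>A summand of strictly smaller valuation cannot be cancelled. Of the equality of
  valuations only the upper bound is recorded, as integrality of x + y is to be passed on to
  x.\<close>

lemma v_add_eq_left:
  assumes "x \<noteq> 0" "y \<noteq> 0" "v x < v y"
  shows "x + y \<noteq> 0 \<and> v (x + y) \<le> v x"
proof
  show ne: "x + y \<noteq> 0"
  proof
    assume "x + y = 0"
    then have "x = - y" by (simp add: eq_neg_iff_add_eq_0)
    then show False using assms v_minus by simp
  qed
  \<comment> \<open>Since x = (x + y) - y, this minimum is at most v x; it cannot be v y, which
    exceeds v x, so it is v (x + y).\<close>
  have "min (v (x + y)) (v (- y)) \<le> v ((x + y) + - y)"
    using assms ne by (intro v_add) auto
  then show "v (x + y) \<le> v x" using assms v_minus by auto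
qed

text \<open>The summands \<open>a\<close> and \<open>\<pi> b\<close> have valuations of different parity, so nothing cancels.\<close>

lemma integral_decomposition:
  assumes "x \<in> OF"
  obtains a b where "a \<in> OF \<inter> F0" "b \<in> OF \<inter> F0" "x = a + \<pi> * b"
proof -
  obtain a b where x: "a \<in> F0" "b \<in> F0" "x = a + \<pi> * b" using decomposition by blast
  have vb: "v (\<pi> * b) = 1 + v b" if "b \<noteq> 0" using that v_mult uniformizer by simp
  have "a \<in> OF \<and> b \<in> OF"
  proof (cases "a = 0 \<or> b = 0")
    case True
    then show ?thesis
    proof
      assume "a = 0"
      have "b \<in> OF"
      proof (cases "b = 0")
        case False
        then have "0 \<le> 1 + v b" using assms x \<open>a = 0\<close> vb uniformizer by (simp add: OF_def)
        \<comment> \<open>Integrality of \<pi> b only gives v b \<ge> -1; parity excludes the value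
          -1. The general case ends in the same way.\<close>
        moreover have "even (v b)" using uniformizer_F0(2) x False by blast
        ultimately have "0 \<le> v b" by presburger
        then show ?thesis by (simp add: OF_def)
      qed (simp add: OF_def)
      then show ?thesis using \<open>a = 0\<close> by (simp add: OF_def)
    qed (use assms x in \<open>simp add: OF_def\<close>)
  next
    case False
    then have ev: "even (v a)" "even (v b)" using uniformizer_F0(2) x by blast+
    have nz: "a \<noteq> 0" "\<pi> * b \<noteq> 0" using False uniformizer by auto
    have "v a \<noteq> 1 + v b" using ev by presburger
    then consider "v a < v (\<pi> * b)" | "v (\<pi> * b) < v a" using vb False by linarith
    then have "0 \<le> v a \<and> 0 \<le> v (\<pi> * b)"
    proof cases
      case 1
      then show ?thesis using v_add_eq_left[OF nz 1] assms x by (auto simp: OF_def)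
    next
      case 2
      then show ?thesis using v_add_eq_left[OF nz(2,1) 2] assms x by (auto simp: OF_def add.commute)
    qed
    then have "0 \<le> v a" "0 \<le> 1 + v b" using vb False by auto
    moreover from this(2) have "0 \<le> v b" using ev by presburger
    ultimately have "0 \<le> v a" "0 \<le> v b" by blast+
    then show ?thesis by (simp add: OF_def)
  qed
  then show thesis using that x by blast
qed

lemma powi_cancel [simp]:
  "\<pi> powi (- k) * (\<pi> powi k * x) = x" "\<pi> powi k * (\<pi> powi (- k) * x) = x"
  "\<pi> powi (- k) * \<pi> powi k = 1"
  using uniformizer by (simp_all add: power_int_minus mult.assoc[symmetric])

lemma frac_ideal_iff: "x \<in> frac_ideal k \<longleftrightarrow> \<pi> powi (- k) * x \<in> OF"
proof
  assume "\<pi> powi (- k) * x \<in> OF"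
  moreover have "x = \<pi> powi k * (\<pi> powi (- k) * x)"
    by simp
  ultimately show "x \<in> frac_ideal k" unfolding frac_ideal_def by blast
qed (auto simp: frac_ideal_def)

section \<open>Lattices and their extensions of scalars\<close>

lemma vec_module_simps [simp]:
  "carrier (vec_module A) = A"
  "\<zero>\<^bsub>vec_module A\<^esub> = (\<lambda>_. 0)"
  "x \<oplus>\<^bsub>vec_module A\<^esub> y = (\<lambda>j. x j + y j)"
  "a \<odot>\<^bsub>vec_module A\<^esub> x = (\<lambda>j. a * x j)"
  by (simp_all add: vec_module_def)

lemma vec_module_module:
  assumes "cring (F_ring\<lparr>carrier := K\<rparr>)" "- 1 \<in> K" "(\<lambda>_. 0) \<in> A"
    and add: "\<And>x y. x \<in> A \<Longrightarrow> y \<in> A \<Longrightarrow> (\<lambda>j. x j + y j) \<in> A"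
    and smult: "\<And>a x. a \<in> K \<Longrightarrow> x \<in> A \<Longrightarrow> (\<lambda>j. a * x j) \<in> A"
  shows "module (F_ring\<lparr>carrier := K\<rparr>) (vec_module A)"
proof -
  have "abelian_group (vec_module A)"
  proof (rule abelian_groupI)
    fix x assume "x \<in> carrier (vec_module A)"
    then have "(\<lambda>j. - 1 * x j) \<in> A" using smult[OF assms(2)] by simp
    then show "\<exists>y\<in>carrier (vec_module A). y \<oplus>\<^bsub>vec_module A\<^esub> x = \<zero>\<^bsub>vec_module A\<^esub>"
      by (intro bexI[of _ "\<lambda>j. - 1 * x j"]) auto
  qed (use assms in \<open>auto simp: ac_simps\<close>)
  then show ?thesis
    using smult by (intro moduleI assms(1)) (auto simp: algebra_simps)
qed

lemma Fn_module: "module F0_ring (vec_module (Fn n))"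
  using F0_closed by (intro vec_module_module F0_cring) (auto simp: Fn_def)

text \<open>\<Lambda>_i is the direct sum of the \<pi>^e O_F e_j with this exponent e, so rescaling
  each coordinate by one power of \<pi> turns membership into integrality.\<close>

definition lattice_exp :: "nat \<Rightarrow> int \<Rightarrow> nat \<Rightarrow> int" where
  "lattice_exp n i j = (if int j \<le> i mod int n then - (i div int n) - 1 else - (i div int n))"

lemma lattice_iff:
  "x \<in> lattice n i \<longleftrightarrow> x \<in> Fn n \<and> (\<forall>j\<in>{1..n}. \<pi> powi (- lattice_exp n i j) * x j \<in> OF)"
  unfolding lattice_def lattice_exp_def frac_ideal_iff[symmetric] by (auto split: if_splits)

lemma lattice_smult: "a \<in> OF \<Longrightarrow> x \<in> lattice n i \<Longrightarrow> (\<lambda>j. a * x j) \<in> lattice n i"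
  using OF_closed(4)[of a] by (auto simp: lattice_iff Fn_def mult.left_commute)

lemma lattice_module: "module OF0_ring (vec_module (lattice n i))"
  unfolding OF0_ring_def
proof (rule vec_module_module)
  show "(\<lambda>j. x j + y j) \<in> lattice n i" if "x \<in> lattice n i" "y \<in> lattice n i" for x y
    using that OF_closed(5) by (auto simp: lattice_iff Fn_def distrib_left)
qed (use OF0_cring OF_closed F0_closed lattice_smult in
    \<open>auto simp: OF0_ring_def lattice_iff Fn_def\<close>)

text \<open>An O_F0-basis of \<Lambda>_i. The index k < 2n encodes a pair: the coordinate k div 2 +
  1, shifted because coordinates start at 1, and the parity of k, which selects the multiple by 1 or
  by \<pi>.\<close>

definition lattice_basis :: "nat \<Rightarrow> int \<Rightarrow> nat \<Rightarrow> nat \<Rightarrow> 'f" where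
  "lattice_basis n i k =
     (\<lambda>j. if j = k div 2 + 1 then \<pi> powi lattice_exp n i j * (if odd k then \<pi> else 1) else 0)"

text \<open>The dual basis, as F0-linear functions on all of F^n rather than only on \<Lambda>_i;
  this is what allows extending them to V.\<close>

definition lattice_coord :: "nat \<Rightarrow> int \<Rightarrow> nat \<Rightarrow> (nat \<Rightarrow> 'f) \<Rightarrow> 'f" where
  "lattice_coord n i k x =
     coord (odd k) (\<pi> powi (- lattice_exp n i (k div 2 + 1)) * x (k div 2 + 1))"

lemma lattice_basis_mem: "k < 2 * n \<Longrightarrow> lattice_basis n i k \<in> lattice n i"
  using OF_closed by (auto simp: lattice_iff Fn_def lattice_basis_def)

lemma lattice_coord_dual: "lattice_coord n i k (lattice_basis n i k') = (if k = k' then 1 else 0)"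
proof (cases "k div 2 = k' div 2")
  case True
  then have "k = k' \<longleftrightarrow> (odd k \<longleftrightarrow> odd k')" by (metis dvd_mult_div_cancel odd_two_times_div_two_succ)
  then show ?thesis
    using True coord_basis
    by (cases "odd k"; cases "odd k'") (auto simp: lattice_coord_def lattice_basis_def)
next
  case False
  moreover have "coord c 0 = 0" for c using coord_linear(2)[of 0 c 0] F0_closed(2) by simp
  ultimately show ?thesis by (auto simp: lattice_coord_def lattice_basis_def)
qed

text \<open>Truncations of x to its first m coordinates enter K one by one: the integral
  decomposition of the next rescaled coordinate gives coefficients in O_F0 at two basis
  vectors.\<close>

lemma lattice_spanned:
  assumes K: "submodule K OF0_ring (vec_module (lattice n i))"
    and b: "\<And>k. k < 2 * n \<Longrightarrow> lattice_basis n i k \<in> K" and x: "x \<in> lattice n i"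
  shows "x \<in> K"
proof -
  have "(\<lambda>j. if j \<le> m then x j else 0) \<in> K" if "m \<le> n" for m
    using that
  proof (induction m)
    case 0
    have "(\<lambda>j. if j \<le> 0 then x j else 0) = (\<lambda>_. 0)" using x by (auto simp: lattice_iff Fn_def)
    then show ?case using submodule_zero[OF K] by simp
  next
    case (Suc m)
    let ?e = "lattice_exp n i (Suc m)"
    have "\<pi> powi (- ?e) * x (Suc m) \<in> OF" using x Suc.prems by (auto simp: lattice_iff)
    then obtain a c where ac: "a \<in> OF \<inter> F0" "c \<in> OF \<inter> F0" "\<pi> powi (- ?e) * x (Suc m) = a + \<pi> * c"
      by (rule integral_decomposition)
    have "\<pi> powi ?e * (\<pi> powi (- ?e) * x (Suc m)) = x (Suc m)"
      by simp
    then have xm: "x (Suc m) = \<pi> powi ?e * (a + \<pi> * c)" using ac(3) by simp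
    have step: "(\<lambda>j. u j + w j) \<in> K" if "u \<in> K" "w \<in> K" for u w
      using submodule_add[OF K that] by simp
    have scale: "(\<lambda>j. a * u j) \<in> K" if "a \<in> OF \<inter> F0" "u \<in> K" for a u
      using submodule_smult[OF K _ that(2), of a] that(1) by (simp add: OF0_ring_def)
    \<comment> \<open>The indices 2 m and 2 m + 1 are those of the two basis vectors at coordinate
      Suc m.\<close>
    have "(\<lambda>j. (if j \<le> m then x j else 0) +
        (a * lattice_basis n i (2 * m) j + c * lattice_basis n i (2 * m + 1) j)) \<in> K"
      using Suc ac b by (intro step scale) auto
    moreover have "(\<lambda>j. (if j \<le> m then x j else 0) +
        (a * lattice_basis n i (2 * m) j + c * lattice_basis n i (2 * m + 1) j)) =
        (\<lambda>j. if j \<le> Suc m then x j else 0)"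
      using xm by (auto simp: fun_eq_iff lattice_basis_def algebra_simps le_Suc_eq)
    ultimately show ?case by simp
  qed
  moreover have "(\<lambda>j. if j \<le> n then x j else 0) = x" using x by (auto simp: lattice_iff Fn_def)
  ultimately show ?thesis by (metis order_refl)
qed

section \<open>The wedge condition\<close>

lemma ring_carriers [simp]: "carrier OF_ring = OF" "carrier OF0_ring = OF \<inter> F0"
  by (simp_all add: OF_ring_def OF0_ring_def)

lemma OF_F_hom: "id \<in> ring_hom OF_ring F_ring"
  by (auto simp: ring_hom_def OF_ring_def)

lemma V_module: "module F_ring (V n)"
  unfolding V_def by (rule base_change_module[OF Fn_module F_cring]) simp

lemma lattice_tensor_module:
  assumes "cring R" "\<alpha> \<in> carrier OF0_ring \<rightarrow> carrier R"
  shows "module R (lattice_tensor n R \<alpha> i)"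
  unfolding lattice_tensor_def by (rule base_change_module[OF lattice_module assms])

section \<open>The operators \<pi> \<otimes> 1 + 1 \<otimes> c\<close>

lemma pi_mult_semilinear:
  "semilinear F0_ring id (vec_module (Fn n)) (vec_module (Fn n)) (\<lambda>x k. \<pi> * x k)"
  "semilinear OF0_ring id (vec_module (lattice n i)) (vec_module (lattice n i)) (\<lambda>x k. \<pi> * x k)"
  using lattice_smult[OF OF_closed(6)]
  by (auto intro!: semilinearI simp: Fn_def algebra_simps)

text \<open>The scalar c is taken in F and mapped to R by \<alpha>: c = \<pi> and c = -\<pi> give
  the operators in the two halves of the wedge condition, and \<alpha> = id gives the same operators
  over O_F.\<close>

definition shift :: "nat \<Rightarrow> 'r ring \<Rightarrow> ('f \<Rightarrow> 'r) \<Rightarrow> int \<Rightarrow> 'f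
    \<Rightarrow> ((nat \<Rightarrow> 'f) \<Rightarrow> 'r) set \<Rightarrow> ((nat \<Rightarrow> 'f) \<Rightarrow> 'r) set" where
  "shift n R \<alpha> i c x = lattice_map n R \<alpha> i \<pi> x
     \<oplus>\<^bsub>lattice_tensor n R \<alpha> i\<^esub> \<alpha> c \<odot>\<^bsub>lattice_tensor n R \<alpha> i\<^esub> x"

text \<open>V is extended from F0 and not from O_F0, so its operator is not an instance of
  \<open>shift\<close>.\<close>

definition V_shift :: "nat \<Rightarrow> 'f \<Rightarrow> ((nat \<Rightarrow> 'f) \<Rightarrow> 'f) set \<Rightarrow> ((nat \<Rightarrow> 'f) \<Rightarrow> 'f) set" where
  "V_shift n c x = base_change_map F_ring id F_ring F0_ring id (vec_module (Fn n)) (\<lambda>x k. \<pi> * x k) x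
     \<oplus>\<^bsub>V n\<^esub> c \<odot>\<^bsub>V n\<^esub> x"

lemma lattice_map_pi_semilinear:
  assumes R: "cring R" and \<alpha>: "\<alpha> \<in> carrier OF0_ring \<rightarrow> carrier R"
  shows "semilinear R id (lattice_tensor n R \<alpha> i) (lattice_tensor n R \<alpha> i) (lattice_map n R \<alpha> i \<pi>)"
  unfolding lattice_tensor_def lattice_map_def
  by (rule base_change_map_semilinear[OF lattice_module R \<alpha> lattice_module R \<alpha> _ pi_mult_semilinear(2)])
    (auto simp: ring_hom_def)

lemma shift_semilinear:
  assumes R: "cring R" and \<alpha>: "\<alpha> \<in> ring_hom OF_ring R" and c: "c \<in> OF"
  shows "semilinear R id (lattice_tensor n R \<alpha> i) (lattice_tensor n R \<alpha> i) (shift n R \<alpha> i c)"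
proof -
  have \<alpha>': "\<alpha> \<in> carrier OF0_ring \<rightarrow> carrier R" using ring_hom_closed[OF \<alpha>] by auto
  show ?thesis
    unfolding shift_def[abs_def] using ring_hom_closed[OF \<alpha>, of c] c
    by (intro semilinear_plus_smult lattice_tensor_module lattice_map_pi_semilinear R \<alpha>') simp
qed

lemma V_shift_semilinear: "semilinear F_ring id (V n) (V n) (V_shift n c)"
  unfolding V_shift_def[abs_def]
proof (rule semilinear_plus_smult[OF V_module])
  show "semilinear F_ring id (V n) (V n)
      (base_change_map F_ring id F_ring F0_ring id (vec_module (Fn n)) (\<lambda>x k. \<pi> * x k))"
    unfolding V_def
    by (rule base_change_map_semilinear[OF Fn_module F_cring _ Fn_module F_cring _ _ pi_mult_semilinear(1)])
      (auto simp: ring_hom_def)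
qed simp

lemma V_shift_eigenspace:
  assumes "x \<in> eigenspace n (- c)"
  shows "V_shift n c x = \<zero>\<^bsub>V n\<^esub>"
proof -
  interpret V: module F_ring "V n" by (rule V_module)
  have x: "x \<in> carrier (V n)" using assms by (simp add: eigenspace_def)
  have "V_shift n c x = (- c) \<odot>\<^bsub>V n\<^esub> x \<oplus>\<^bsub>V n\<^esub> c \<odot>\<^bsub>V n\<^esub> x"
    using assms by (simp add: eigenspace_def V_shift_def)
  also have "\<dots> = \<zero>\<^bsub>V n\<^esub>"
    using V.smult_l_distr[of "- c" c x] x V.smult_l_null[OF x] by simp
  finally show ?thesis .
qed

text \<open>By the bounds \<open>j \<le> r\<close>, \<open>k \<le> s\<close>, a product of \<open>s + 1\<close> eigenvectors in \<open>W\<close> has a factor in the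
  \<open>-\<pi>\<close>-eigenspace, and one of \<open>r + 1\<close> eigenvectors has a factor in the \<open>\<pi>\<close>-eigenspace.\<close>

lemma V_shift_kills_W:
  assumes c: "c = \<pi> \<and> l = s + 1 \<or> c = - \<pi> \<and> l = r + 1" and w: "w \<in> W l n r s"
  shows "exterior_map F_ring id F_ring l (V n) (V_shift n c) w = \<zero>\<^bsub>exterior_power F_ring l (V n)\<^esub>"
proof -
  let ?E = "exterior_power F_ring l (V n)" and ?g = "exterior_map F_ring id F_ring l (V n) (V_shift n c)"
  note E = exterior_power_module[OF V_module, where l = l]
  note alt = wedge_alternating[OF V_module, where l = l]
  note sl = exterior_map_semilinear[OF V_module V_module id_ring_hom V_shift_semilinear, where l = l]
  have eig: "eigenspace n a \<subseteq> carrier (V n)" for a by (auto simp: eigenspace_def)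
  have "W l n r s \<subseteq> {w \<in> carrier ?E. ?g w = \<zero>\<^bsub>?E\<^esub>}"
    unfolding W_def
  proof (intro module_span_minimal semilinear_kernel_submodule[OF E E sl] subsetI; (elim CollectE exE conjE)?)
    fix w xs ys
    assume w: "w = wedge F_ring l (V n) (xs @ ys)" and len: "length xs + length ys = l" "length xs \<le> r" "length ys \<le> s"
      and xs: "set xs \<subseteq> eigenspace n (- \<pi>)" and ys: "set ys \<subseteq> eigenspace n \<pi>"
    have zs: "length (xs @ ys) = l" "set (xs @ ys) \<subseteq> carrier (V n)"
      using len(1) xs ys eig by auto
    have "\<exists>z\<in>set (xs @ ys). z \<in> eigenspace n (- c)"
      using c
    proof
      assume "c = \<pi> \<and> l = s + 1"
      then show ?thesis using len xs by (cases xs) auto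
    next
      assume "c = - \<pi> \<and> l = r + 1"
      then show ?thesis using len ys by (cases ys) auto
    qed
    then have "\<zero>\<^bsub>V n\<^esub> \<in> set (map (V_shift n c) (xs @ ys))"
      using V_shift_eigenspace by (metis image_eqI set_map)
    moreover have "set (map (V_shift n c) (xs @ ys)) \<subseteq> carrier (V n)"
      using zs(2) semilinear_closed[OF V_shift_semilinear] by auto
    ultimately have "wedge F_ring l (V n) (map (V_shift n c) (xs @ ys)) = \<zero>\<^bsub>?E\<^esub>"
      using zs(1) by (intro alternating_zero_entry[OF V_module E alt]) auto
    then show "w \<in> {w \<in> carrier ?E. ?g w = \<zero>\<^bsub>?E\<^esub>}"
      using wedge_closed[OF V_module zs] exterior_map_wedge[OF V_module V_module id_ring_hom V_shift_semilinear zs] w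
      by simp
  qed simp
  then show ?thesis using w by auto
qed

section \<open>The embedding of \<Lambda>_i \<otimes> O_F into V\<close>

abbreviation generic_map :: "nat \<Rightarrow> ((nat \<Rightarrow> 'f) \<Rightarrow> 'f) set \<Rightarrow> ((nat \<Rightarrow> 'f) \<Rightarrow> 'f) set" where
  "generic_map n \<equiv> base_change_map OF_ring id F_ring F0_ring id (vec_module (Fn n)) id"

lemma lattice_inclusion_semilinear:
  "semilinear OF0_ring id (vec_module (lattice n i)) (vec_module (Fn n)) id"
  by (auto simp: semilinear_def lattice_iff)

lemma generic_map_semilinear:
  "semilinear OF_ring id (lattice_tensor n OF_ring id i) (V n) (generic_map n)"
  unfolding lattice_tensor_def V_def
  by (rule base_change_map_semilinear[OF lattice_module OF_cring _ Fn_module F_cring _ OF_F_hom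
        lattice_inclusion_semilinear]) auto

lemma generic_map_tensor_one:
  "x \<in> lattice n i \<Longrightarrow> generic_map n (tensor_one OF0_ring id OF_ring (vec_module (lattice n i)) x) =
     tensor_one F0_ring id F_ring (vec_module (Fn n)) x"
  using base_change_map_tensor_one[OF lattice_module OF_cring _ Fn_module F_cring _ OF_F_hom
        lattice_inclusion_semilinear, of id id x n i] by auto

text \<open>The vectors b_k \<otimes> 1, for the 2n basis vectors b_k of \<Lambda>_i, generate
  \<Lambda>_i \<otimes> O_F, and the F0-linear lattice coordinates lift to F-linear functions on V
  that are dual to their images.\<close>

lemma exterior_generic_map_injective:
  assumes z: "z \<in> carrier (exterior_power OF_ring l (lattice_tensor n OF_ring id i))"
    "exterior_map OF_ring id F_ring l (V n) (generic_map n) z = \<zero>\<^bsub>exterior_power F_ring l (V n)\<^esub>"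
  shows "z = \<zero>\<^bsub>exterior_power OF_ring l (lattice_tensor n OF_ring id i)\<^esub>"
proof -
  let ?M = "vec_module (lattice n i)"
  let ?t = "tensor_one OF0_ring id OF_ring ?M"
  let ?e = "\<lambda>k. presented_map F_ring id (ring_as_module F_ring) (lattice_coord n i k)"
  have id: "id \<in> carrier OF0_ring \<rightarrow> carrier OF_ring" by simp
  have idF: "id \<in> carrier F0_ring \<rightarrow> carrier F_ring" by simp
  note L = lattice_tensor_module[OF OF_cring id]
  have coord: "semilinear F0_ring (\<lambda>a. id (id a)) (vec_module (Fn n)) (ring_as_module F_ring) (lattice_coord n i k)" for k
    by (rule semilinearI) (auto simp: lattice_coord_def coord_linear distrib_left mult.left_commute)
  note lift = ring_as_module_module[OF F_cring] id_ring_hom coord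
  show ?thesis
  proof (rule exterior_map_injective[where d = "2 * n" and b = "\<lambda>k. ?t (lattice_basis n i k)" and e = ?e,
        OF L V_module OF_F_hom _ generic_map_semilinear _ _ _ _ residue_char_not_2(1) z])
    show "a = \<zero>\<^bsub>OF_ring\<^esub>" if "id a = 0" for a using that by (simp add: OF_ring_def)
  next
    fix k assume "k < 2 * n"
    then show "?t (lattice_basis n i k) \<in> carrier (lattice_tensor n OF_ring id i)"
      unfolding lattice_tensor_def
      by (intro tensor_one_closed[OF lattice_module OF_cring id]) (simp add: lattice_basis_mem)
  next
    fix K assume K: "submodule K OF_ring (lattice_tensor n OF_ring id i)"
      and b: "\<And>k. k < 2 * n \<Longrightarrow> ?t (lattice_basis n i k) \<in> K"
    \<comment> \<open>The elements m of \<Lambda>_i with m \<otimes> 1 in K form an O_F0-submodule,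
      so spanning of \<Lambda>_i by its basis carries over to the extension of scalars.\<close>
    let ?K = "{x \<in> carrier ?M. ?t x \<in> K}"
    have "submodule ?K OF0_ring ?M"
      using K unfolding lattice_tensor_def
      by (intro semilinear_vimage_submodule[OF lattice_module base_change_module[OF lattice_module OF_cring id]
            tensor_one_semilinear[OF lattice_module OF_cring id] id])
    then have "x \<in> ?K" if "x \<in> lattice n i" for x
      by (rule lattice_spanned) (use that b lattice_basis_mem in auto)
    then show "carrier (lattice_tensor n OF_ring id i) \<subseteq> K"
      using base_change_induct[OF lattice_module OF_cring id, of K] K
      unfolding lattice_tensor_def by auto
  next
    show "semilinear F_ring id (V n) (ring_as_module F_ring) (?e k)" for k
      unfolding V_def by (rule base_change_lift_semilinear[OF Fn_module F_cring idF lift])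
  next
    fix j k assume "j < 2 * n" "k < 2 * n"
    then have b: "lattice_basis n i k \<in> lattice n i" by (simp add: lattice_basis_mem)
    then have b': "lattice_basis n i k \<in> carrier (vec_module (Fn n))" by (simp add: lattice_iff)
    show "?e j (generic_map n (?t (lattice_basis n i k))) = (if j = k then 1 else 0)"
      unfolding generic_map_tensor_one[OF b]
        base_change_lift_tensor_one[OF Fn_module F_cring idF lift b'] lattice_coord_dual ..
  qed
qed

text \<open>\<open>lattice_W\<close> is described by its image in V, while the claim is over R.
  Vanishing is therefore pulled back from V to O_F by injectivity and then pushed forward along
  \<alpha>; the operator commutes with both changes of scalars.\<close>

lemma shift_kills_lattice_W:
  fixes R :: "'r ring"
  assumes R: "cring R" and \<alpha>: "\<alpha> \<in> ring_hom OF_ring R"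
    and c: "c = \<pi> \<and> l = s + 1 \<or> c = - \<pi> \<and> l = r + 1" and z: "z \<in> lattice_W l n r s i"
  shows "exterior_map R id R l (lattice_tensor n R \<alpha> i) (shift n R \<alpha> i c)
    (exterior_map OF_ring \<alpha> R l (lattice_tensor n R \<alpha> i)
       (base_change_map OF_ring \<alpha> R OF0_ring \<alpha> (vec_module (lattice n i)) id) z)
    = \<zero>\<^bsub>exterior_power R l (lattice_tensor n R \<alpha> i)\<^esub>"
    and "exterior_map OF_ring \<alpha> R l (lattice_tensor n R \<alpha> i)
       (base_change_map OF_ring \<alpha> R OF0_ring \<alpha> (vec_module (lattice n i)) id) z
     \<in> carrier (exterior_power R l (lattice_tensor n R \<alpha> i))"
proof -
  let ?L = "lattice_tensor n OF_ring id i" and ?LR = "lattice_tensor n R \<alpha> i"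
  let ?\<kappa> = "base_change_map OF_ring \<alpha> R OF0_ring \<alpha> (vec_module (lattice n i)) id"
  have idc: "id \<in> carrier OF0_ring \<rightarrow> carrier OF_ring" by simp
  have \<alpha>': "\<alpha> \<in> carrier OF0_ring \<rightarrow> carrier R" using ring_hom_closed[OF \<alpha>] by auto
  have cO: "c \<in> OF" using c OF_closed by auto
  note L = lattice_tensor_module[OF OF_cring idc] and LR = lattice_tensor_module[OF R \<alpha>']
  note gO = shift_semilinear[OF OF_cring id_ring_hom cO] and gR = shift_semilinear[OF R \<alpha> cO]
  have sl_id: "semilinear OF0_ring id (vec_module (lattice n i)) (vec_module (lattice n i)) id"
    by (rule semilinear_id)
  have \<kappa>: "semilinear OF_ring \<alpha> ?L ?LR ?\<kappa>"
    unfolding lattice_tensor_def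
    by (rule base_change_map_semilinear[OF lattice_module OF_cring idc lattice_module R \<alpha>' \<alpha> sl_id]) auto
  have z1: "z \<in> carrier (exterior_power OF_ring l ?L)"
    and z2: "exterior_map OF_ring id F_ring l (V n) (generic_map n) z \<in> W l n r s"
    using z by (auto simp: lattice_W_def)
  let ?gz = "exterior_map OF_ring id OF_ring l ?L (shift n OF_ring id i c) z"
  have gz: "?gz \<in> carrier (exterior_power OF_ring l ?L)"
    by (rule semilinear_closed[OF exterior_map_semilinear[OF L L id_ring_hom gO] z1])
  have "generic_map n (shift n OF_ring id i c x) = V_shift n c (generic_map n x)" if "x \<in> carrier ?L" for x
    using base_change_map_shift[OF lattice_module OF_cring idc Fn_module F_cring _ OF_F_hom
        lattice_inclusion_semilinear _ _ pi_mult_semilinear(2,1) _ _ that[unfolded lattice_tensor_def], of id c] cO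
    by (simp add: shift_def V_shift_def lattice_map_def lattice_tensor_def V_def)
  then have "exterior_map OF_ring id F_ring l (V n) (generic_map n) ?gz =
      exterior_map F_ring id F_ring l (V n) (V_shift n c)
        (exterior_map OF_ring id F_ring l (V n) (generic_map n) z)"
    by (intro exterior_map_commute[OF L L V_module V_module id_ring_hom gO OF_F_hom generic_map_semilinear
          OF_F_hom generic_map_semilinear id_ring_hom V_shift_semilinear _ _ z1]) auto
  also have "\<dots> = \<zero>\<^bsub>exterior_power F_ring l (V n)\<^esub>" by (rule V_shift_kills_W[OF c z2])
  finally have gz0: "?gz = \<zero>\<^bsub>exterior_power OF_ring l ?L\<^esub>"
    by (rule exterior_generic_map_injective[OF gz])
  have "?\<kappa> (shift n OF_ring id i c x) = shift n R \<alpha> i c (?\<kappa> x)" if "x \<in> carrier ?L" for x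
    using base_change_map_shift[OF lattice_module OF_cring idc lattice_module R \<alpha>' \<alpha>
        sl_id _ _ pi_mult_semilinear(2,2) _ _ that[unfolded lattice_tensor_def], of c] cO
    by (simp add: shift_def lattice_map_def lattice_tensor_def)
  then have "exterior_map OF_ring \<alpha> R l ?LR ?\<kappa> ?gz =
      exterior_map R id R l ?LR (shift n R \<alpha> i c) (exterior_map OF_ring \<alpha> R l ?LR ?\<kappa> z)"
    by (intro exterior_map_commute[OF L L LR LR id_ring_hom gO \<alpha> \<kappa> \<alpha> \<kappa> id_ring_hom gR _ _ z1]) auto
  moreover have "exterior_map OF_ring \<alpha> R l ?LR ?\<kappa> ?gz = \<zero>\<^bsub>exterior_power R l ?LR\<^esub>"
    unfolding gz0
    by (rule semilinear_zero[OF exterior_power_module[OF L] exterior_power_module[OF LR]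
          exterior_map_semilinear[OF L LR \<alpha> \<kappa>]])
  ultimately show "exterior_map R id R l ?LR (shift n R \<alpha> i c) (exterior_map OF_ring \<alpha> R l ?LR ?\<kappa> z)
      = \<zero>\<^bsub>exterior_power R l ?LR\<^esub>" by simp
  show "exterior_map OF_ring \<alpha> R l ?LR ?\<kappa> z \<in> carrier (exterior_power R l ?LR)"
    by (rule semilinear_closed[OF exterior_map_semilinear[OF L LR \<alpha> \<kappa>] z1])
qed

text \<open>The condition bounds the image of the exterior power of \<F>_i by a span; the kernel
  over R is a submodule, so vanishing has to be known only at the generators of that span.\<close>

lemma exterior_power_vanishes_shift:
  fixes R :: "'r ring"
  assumes R: "cring R" and \<alpha>: "\<alpha> \<in> ring_hom OF_ring R"
    and c: "c = \<pi> \<and> l = s + 1 \<or> c = - \<pi> \<and> l = r + 1" and i: "i \<in> index_set n I"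
    and LM1: "LM1 n I R \<alpha> \<F>" and K: "K_condition l n r s I R \<alpha> \<F>"
    and f: "\<And>x. x \<in> \<F> i \<Longrightarrow> f x = shift n R \<alpha> i c x"
  shows "exterior_power_vanishes R l (lattice_tensor n R \<alpha> i\<lparr>carrier := \<F> i\<rparr>) f"
proof -
  let ?L = "lattice_tensor n R \<alpha> i" and ?g = "shift n R \<alpha> i c"
  have cO: "c \<in> OF" using c OF_closed by auto
  have \<alpha>': "\<alpha> \<in> carrier OF0_ring \<rightarrow> carrier R" using ring_hom_closed[OF \<alpha>] by auto
  note L = lattice_tensor_module[OF R \<alpha>']
  note E = exterior_power_module[OF L]
  note g = shift_semilinear[OF R \<alpha> cO]
  have ds: "direct_summand R ?L (\<F> i)" and stable: "lattice_map n R \<alpha> i \<pi> ` \<F> i \<subseteq> \<F> i"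
    using LM1 i OF_closed by (auto simp: LM1_def)
  have sub: "submodule (\<F> i) R ?L" using ds by (simp add: direct_summand_def)
  let ?ker = "{w \<in> carrier (exterior_power R l ?L). exterior_map R id R l ?L ?g w = \<zero>\<^bsub>exterior_power R l ?L\<^esub>}"
  have "submodule ?ker R (exterior_power R l ?L)"
    by (rule semilinear_kernel_submodule[OF E E exterior_map_semilinear[OF L L id_ring_hom g]]) simp
  then have "exterior_map R id R l ?L id ` carrier (exterior_power R l (?L\<lparr>carrier := \<F> i\<rparr>)) \<subseteq> ?ker"
    using shift_kills_lattice_W[OF R \<alpha> c]
    by (intro order_trans[OF K[unfolded K_condition_def, rule_format, OF i]] module_span_minimal) auto
  moreover have "?g x \<in> \<F> i" if "x \<in> \<F> i" for x
    unfolding shift_def using stable that ring_hom_closed[OF \<alpha>, of c] cO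
    by (intro submodule_add[OF sub] submodule_smult[OF sub]) auto
  ultimately show ?thesis
    by (intro exterior_power_vanishes_summand[OF L ds g _ _ f]) auto
qed

lemma K_conditions_imp_wedge_condition:
  fixes R :: "'r ring"
  assumes R: "cring R" and \<alpha>: "\<alpha> \<in> ring_hom OF_ring R" and LM1: "LM1 n I R \<alpha> \<F>"
    and K: "K_condition (r + 1) n r s I R \<alpha> \<F>" "K_condition (s + 1) n r s I R \<alpha> \<F>"
  shows "wedge_condition n r s I R \<alpha> \<F>"
  unfolding wedge_condition_def Let_def
proof (intro ballI conjI)
  fix i assume i: "i \<in> index_set n I"
  let ?L = "lattice_tensor n R \<alpha> i"
  have \<alpha>': "\<alpha> \<in> carrier OF0_ring \<rightarrow> carrier R" using ring_hom_closed[OF \<alpha>] by auto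
  interpret L: module R ?L by (rule lattice_tensor_module[OF R \<alpha>'])
  show "exterior_power_vanishes R (s + 1) (?L\<lparr>carrier := \<F> i\<rparr>)
      (\<lambda>x. lattice_map n R \<alpha> i \<pi> x \<oplus>\<^bsub>?L\<^esub> \<alpha> \<pi> \<odot>\<^bsub>?L\<^esub> x)"
    by (rule exterior_power_vanishes_shift[OF R \<alpha> _ i LM1 K(2), where c = \<pi>]) (auto simp: shift_def)
  show "exterior_power_vanishes R (r + 1) (?L\<lparr>carrier := \<F> i\<rparr>)
      (\<lambda>x. lattice_map n R \<alpha> i \<pi> x \<ominus>\<^bsub>?L\<^esub> \<alpha> \<pi> \<odot>\<^bsub>?L\<^esub> x)"
  proof (rule exterior_power_vanishes_shift[OF R \<alpha> _ i LM1 K(1), where c = "- \<pi>"])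
    fix x assume "x \<in> \<F> i"
    then have x: "x \<in> carrier ?L"
      using LM1 i submodule_subset by (fastforce simp: LM1_def direct_summand_def)
    have \<pi>: "\<alpha> \<pi> \<in> carrier R" "\<alpha> (- \<pi>) \<in> carrier R"
      using ring_hom_closed[OF \<alpha>] OF_closed by auto
    \<comment> \<open>The wedge condition subtracts the multiple by \<alpha>(\<pi>), while the
      operator for c = -\<pi> adds the one by \<alpha>(-\<pi>); additivity of \<alpha> identifies
      the two.\<close>
    have "\<alpha> (- \<pi>) \<oplus>\<^bsub>R\<^esub> \<alpha> \<pi> = \<alpha> (- \<pi> \<oplus>\<^bsub>OF_ring\<^esub> \<pi>)"
      using OF_closed by (intro ring_hom_add[OF \<alpha>, symmetric]) auto
    also have "\<dots> = \<zero>\<^bsub>R\<^esub>"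
      using ring_hom_zero_cring[OF OF_cring R \<alpha>] by (simp add: OF_ring_def)
    finally have "\<alpha> (- \<pi>) = \<ominus>\<^bsub>R\<^esub> \<alpha> \<pi>" using \<pi> by (intro L.R.minus_equality[symmetric]) auto
    then show "lattice_map n R \<alpha> i \<pi> x \<ominus>\<^bsub>?L\<^esub> \<alpha> \<pi> \<odot>\<^bsub>?L\<^esub> x = shift n R \<alpha> i (- \<pi>) x"
      using x \<pi> by (simp add: shift_def a_minus_def L.smult_l_minus)
  qed simp
qed

end

theorem lemma5p2p1:
  fixes v :: "'f::field \<Rightarrow> int" and F0 :: "'f set" and \<pi> :: 'f
    and n r s :: nat and I :: "nat set"
    and R :: "'r ring" and \<alpha> :: "'f \<Rightarrow> 'r"
    and \<F> :: "int \<Rightarrow> ((nat \<Rightarrow> 'f) \<Rightarrow> 'r) set set"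
  assumes "ramified_quadratic v F0 \<pi>"
    and "n \<ge> 2" and "r + s = n" and "r \<noteq> s"
    and "I \<noteq> {}" and "I \<subseteq> {0..n div 2}" and "admissible n I"
    and "cring R" and "\<alpha> \<in> ring_hom (ramified_quadratic.OF_ring v) R"
    and "ramified_quadratic.naive_point v F0 \<pi> n r s I R \<alpha> \<F>"
    and "ramified_quadratic.K_condition v F0 \<pi> (r + 1) n r s I R \<alpha> \<F>"
    and "ramified_quadratic.K_condition v F0 \<pi> (s + 1) n r s I R \<alpha> \<F>"
  shows "ramified_quadratic.wedge_condition v F0 \<pi> n r s I R \<alpha> \<F>"
proof -
  interpret ramified_quadratic v F0 \<pi> by fact
  show ?thesis
    using assms by (intro K_conditions_imp_wedge_condition) (simp_all add: naive_point_def)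
qed

end
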